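(* For any $\nu\ge 0$, $\gamma\in(0,\frac32)$ and $\alpha$ with $\frac12\le \alpha<\frac12+\min\left(\frac16,\frac32-\gamma\right)$, there exist infinitely many nontrivial (i.e. not identically zero) stationary weak solutions $\theta$ to the surface quasi-geostrophic equation (with viscosity $\nu$ and dissipation exponent $\gamma$) satisfying $\overline{\theta}=0$ and $\Lambda^{-1}\theta\in C^{\alpha}(\mathbb{T}^2)$.
   Context: $\mathbb{T}^2=[-\pi,\pi]^2$ is the periodic torus; Fourier coefficients are $\hat f(k)=\frac1{(2\pi)^2}\int_{\mathbb{T}^2}f(x)e^{-ix\cdot k}\,dx$, $k\in\mathbb{Z}^2$. All functions $\theta$ are real-valued. $\overline f=\frac1{(2\pi)^2}\int_{\mathbb{T}^2}f\,dx$ is the mean. For $s\ge0$, $\Lambda^s=(-\Delta)^{s/2}$ is defined by $\widehat{\Lambda^s f}(k)=|k|^s\hat f(k)$; for $s<0$ the formula is restricted to $k\ne0$ (the zero mode is set to $0$). $\mathcal{R}_j=\partial_j\Lambda^{-1}$, $j=1,2$, are the Riesz transforms. $\|f\|_{\dot H^s}=\big(\sum_{0\ne k\in\mathbb{Z}^2}|k|^{2s}|\hat f(k)|^2\big)^{1/2}$. $[A,B]=AB-BA$ is the commutator, where a function denotes multiplication by it, so $[\mathcal{R}_j,\phi]\theta=\mathcal{R}_j(\phi\theta)-\phi\,\mathcal{R}_j\theta$. $C^\alpha(\mathbb{T}^2)$ is the usual Hölder space. The surface quasi-geostrophic (SQG) equation is $\partial_t\theta+u\cdot\nabla\theta=-\nu\Lambda^\gamma\theta$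 on $\mathbb{T}^2$, with $u=\nabla^\perp\Lambda^{-1}\theta=(-\mathcal{R}_2\theta,\mathcal{R}_1\theta)$. Definition: $\theta\in\dot H^{-1/2}(\mathbb{T}^2)$ with $\overline\theta=0$ is a stationary weak solution to SQG if for all $\psi\in C^\infty(\mathbb{T}^2)$ $$\frac12\int_{\mathbb{T}^2}(\Lambda^{-\frac12}\theta)\,\Lambda^{\frac12}\big([\mathcal{R}^\perp,\nabla\psi]\theta\big)\,dx=-\nu\int_{\mathbb{T}^2}(\Lambda^{-\frac12}\theta)\,\Lambda^{\gamma+\frac12}\psi\,dx,$$ where $[\mathcal{R}^\perp,\nabla\psi]\theta=-[\mathcal{R}_2,\partial_1\psi]\theta+[\mathcal{R}_1,\partial_2\psi]\theta$. *)

theory Defs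
  imports "HOL-Analysis.Analysis"
begin

text \<open>
  Functions on the torus are functions on \<open>real^2\<close> that are \<open>2\<pi>\<close>-periodic in each variable
  (or, where only almost-everywhere values matter, functions on the fundamental cell).
  Elements of Sobolev spaces of negative order are periodic distributions: continuous
  real-linear functionals on the smooth periodic real-valued functions.  Taking real scalars
  builds in the convention that all functions are real-valued.
\<close>

definition torus :: "(real^2) set" where
  "torus = cbox (\<chi> i. - pi) (\<chi> i. pi)"

definition torus_integral :: "(real^2 \<Rightarrow> real) \<Rightarrow> real" where
  "torus_integral f = integral\<^sup>L (lebesgue_on torus) f"

definition periodic :: "(real^2 \<Rightarrow> real) \<Rightarrow> bool" where
  "periodic f \<longleftrightarrow> (\<forall>x j. f (x + axis j (2 * pi)) = f x)"

definition partial :: "2 \<Rightarrow> (real^2 \<Rightarrow> real) \<Rightarrow> real^2 \<Rightarrow> real" where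
  "partial j f = (\<lambda>x. frechet_derivative f (at x) (axis j 1))"

primrec partials :: "2 list \<Rightarrow> (real^2 \<Rightarrow> real) \<Rightarrow> real^2 \<Rightarrow> real" where
  "partials [] f = f"
| "partials (j # js) f = partial j (partials js f)"

definition smooth :: "(real^2 \<Rightarrow> real) \<Rightarrow> bool" where
  "smooth f \<longleftrightarrow> (\<forall>js x. partials js f differentiable (at x))"

definition test_functions :: "(real^2 \<Rightarrow> real) set" where
  "test_functions = {\<psi>. smooth \<psi> \<and> periodic \<psi>}"


subsection \<open>Periodic distributions\<close>

type_synonym distribution = "(real^2 \<Rightarrow> real) \<Rightarrow> real"

text \<open>
  The last conjunct of the definition below is continuity for the topology of
  \<open>C\<^sup>\<infinity>\<close>: the functional is bounded by some \<open>C\<^sup>N\<close> norm.  Functionals are extensional, so that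
  equality of distributions is equality on test functions.
\<close>

definition distributions :: "distribution set" where
  "distributions = {T. T \<in> extensional test_functions \<and>
     (\<forall>\<phi>\<in>test_functions. \<forall>\<psi>\<in>test_functions. \<forall>a b.
        T (\<lambda>x. a * \<phi> x + b * \<psi> x) = a * T \<phi> + b * T \<psi>) \<and>
     (\<exists>C N. \<forall>\<psi>\<in>test_functions. \<forall>B.
        (\<forall>js x. length js \<le> N \<longrightarrow> \<bar>partials js \<psi> x\<bar> \<le> B) \<longrightarrow> \<bar>T \<psi>\<bar> \<le> C * B)}"

definition zero_dist :: distribution where
  "zero_dist = restrict (\<lambda>\<psi>. 0) test_functions"

definition add_dist :: "distribution \<Rightarrow> distribution \<Rightarrow> distribution" where
  "add_dist S T = restrict (\<lambda>\<psi>. S \<psi> + T \<psi>) test_functions"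

definition diff_dist :: "distribution \<Rightarrow> distribution \<Rightarrow> distribution" where
  "diff_dist S T = restrict (\<lambda>\<psi>. S \<psi> - T \<psi>) test_functions"

definition uminus_dist :: "distribution \<Rightarrow> distribution" where
  "uminus_dist T = restrict (\<lambda>\<psi>. - T \<psi>) test_functions"

definition mult_dist :: "(real^2 \<Rightarrow> real) \<Rightarrow> distribution \<Rightarrow> distribution" where
  "mult_dist \<phi> T = restrict (\<lambda>\<psi>. T (\<lambda>x. \<phi> x * \<psi> x)) test_functions"

definition partial_dist :: "2 \<Rightarrow> distribution \<Rightarrow> distribution" where
  "partial_dist j T = restrict (\<lambda>\<psi>. - T (partial j \<psi>)) test_functions"

definition dist_of :: "(real^2 \<Rightarrow> real) \<Rightarrow> distribution" where
  "dist_of f = restrict (\<lambda>\<psi>. torus_integral (\<lambda>x. f x * \<psi> x)) test_functions"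


subsection \<open>Fourier coefficients and the fractional Laplacian\<close>

definition freq :: "int^2 \<Rightarrow> real^2" where
  "freq k = (\<chi> j. real_of_int (k $ j))"

text \<open>
  The pairing of \<open>T\<close> with \<open>exp (- i x \<bullet> k) = cos (x \<bullet> k) - i sin (x \<bullet> k)\<close>, divided by
  \<open>(2\<pi>)\<^sup>2\<close>; on \<open>dist_of f\<close> this is the usual Fourier coefficient of \<open>f\<close>.
\<close>

definition fourier_coeff :: "distribution \<Rightarrow> int^2 \<Rightarrow> complex" where
  "fourier_coeff T k =
     Complex (T (\<lambda>x. cos (x \<bullet> freq k))) (- T (\<lambda>x. sin (x \<bullet> freq k))) / (2 * of_real pi)^2"

definition mean :: "distribution \<Rightarrow> real" where
  "mean T = T (\<lambda>x. 1) / (2 * pi)^2"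

text \<open>
  Since \<open>0 powr s = 0\<close> for every \<open>s\<close>, the zero mode is annihilated for negative \<open>s\<close> as
  required; only \<open>s = 0\<close>, where the operator is the identity, needs a separate clause.
\<close>

definition Lambda_symbol :: "real \<Rightarrow> int^2 \<Rightarrow> real" where
  "Lambda_symbol s k = (if s = 0 then 1 else norm (freq k) powr s)"

text \<open>
  For every distribution such an \<open>S\<close> exists and is unique, because the symbol is real, even
  and of at most polynomial growth and the Fourier coefficients determine a distribution.
\<close>

definition Lambda :: "real \<Rightarrow> distribution \<Rightarrow> distribution" where
  "Lambda s T = (THE S. S \<in> distributions \<and>
     (\<forall>k. fourier_coeff S k = of_real (Lambda_symbol s k) * fourier_coeff T k))"

definition Riesz :: "2 \<Rightarrow> distribution \<Rightarrow> distribution" where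
  "Riesz j T = partial_dist j (Lambda (-1) T)"

definition Riesz_commutator :: "2 \<Rightarrow> (real^2 \<Rightarrow> real) \<Rightarrow> distribution \<Rightarrow> distribution" where
  "Riesz_commutator j \<phi> T = diff_dist (Riesz j (mult_dist \<phi> T)) (mult_dist \<phi> (Riesz j T))"

definition Riesz_perp_commutator :: "(real^2 \<Rightarrow> real) \<Rightarrow> distribution \<Rightarrow> distribution" where
  "Riesz_perp_commutator \<psi> T =
     add_dist (uminus_dist (Riesz_commutator 2 (partial 1 \<psi>) T))
              (Riesz_commutator 1 (partial 2 \<psi>) T)"


subsection \<open>Function spaces\<close>

definition Hdot :: "real \<Rightarrow> distribution set" where
  "Hdot s = {T \<in> distributions.
     (\<lambda>k. norm (freq k) powr (2 * s) * (cmod (fourier_coeff T k))^2) summable_on (- {0})}"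

definition represents_L2 :: "(real^2 \<Rightarrow> real) \<Rightarrow> distribution \<Rightarrow> bool" where
  "represents_L2 f T \<longleftrightarrow>
     f \<in> borel_measurable (lebesgue_on torus) \<and>
     integrable (lebesgue_on torus) (\<lambda>x. (f x)^2) \<and>
     T = dist_of f"

text \<open>The Hoelder space for exponents \<open>0 < \<alpha> \<le> 1\<close>; the supremum bound is automatic by
  periodicity.\<close>

definition Hoelder :: "real \<Rightarrow> distribution set" where
  "Hoelder \<alpha> = {T. \<exists>f. periodic f \<and>
     (\<exists>C. \<forall>x y. \<bar>f x - f y\<bar> \<le> C * norm (x - y) powr \<alpha>) \<and> T = dist_of f}"


subsection \<open>Stationary weak solutions of SQG\<close>

text \<open>
  The integrals in the weak formulation are integrals of products of \<open>L\<^sup>2\<close> functions;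
  \<open>f\<close>, \<open>g\<close>, \<open>h\<close> are the almost everywhere unique functions that the three distributions are.
\<close>

definition stationary_weak_solution :: "real \<Rightarrow> real \<Rightarrow> distribution \<Rightarrow> bool" where
  "stationary_weak_solution \<nu> \<gamma> \<theta> \<longleftrightarrow>
     \<theta> \<in> Hdot (-1/2) \<and> mean \<theta> = 0 \<and>
     (\<exists>f. represents_L2 f (Lambda (-1/2) \<theta>) \<and>
       (\<forall>\<psi>\<in>test_functions. \<exists>g h.
          represents_L2 g (Lambda (1/2) (Riesz_perp_commutator \<psi> \<theta>)) \<and>
          represents_L2 h (Lambda (\<gamma> + 1/2) (dist_of \<psi>)) \<and>
          1/2 * torus_integral (\<lambda>x. f x * g x) = - \<nu> * torus_integral (\<lambda>x. f x * h x)))"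

end

theory Submission
  imports Defs
begin

text \<open>
  Writing \<open>\<theta> = \<Lambda> f\<close>, the equation says that \<open>\<nabla> \<cdot> (\<Lambda>f \<nabla>\<^sup>\<bottom>f)\<close> balances the dissipation.  The solution is built
  by convex integration in the algebra of absolutely convergent Fourier series: every
  approximation is an even real trigonometric polynomial, and the scalar residual \<open>q\<close> of the
  equation is removed by adding waves \<open>a\<^sub>e cos (L e \<cdot> x)\<close> with \<open>e\<close> ranging over the integer vectors of
  length \<open>\<surd>5\<close> and \<open>L\<close> large.  To leading order the wave in direction \<open>e\<close> contributes the multiplier
  \<open>(e \<cdot> p) (e \<times> p) / \<bar>p\<bar>\<^sup>2\<close> applied to \<open>L a\<^sub>e\<^sup>2\<close>.  This symbol changes sign when \<open>e\<close> is rotated by a right angle,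
  so with \<open>a\<^sub>e = A + z\<^sub>e\<close> and \<open>z\<close> odd under the rotation only the terms \<open>2 A z\<^sub>e\<close> survive, and \<open>z\<close> can be a
  Fourier multiplier of \<open>q\<close>: no square root is taken.  All error terms are estimated frequency by
  frequency.  With \<open>L\<^sub>n\<^sub>+\<^sub>1\<close> about \<open>L\<^sub>n\<^sup>b\<close> for \<open>b\<close> slightly larger than \<open>1\<close>, the residuals tend to zero while
  \<open>f\<close> stays bounded in the required Hoelder space.  Starting from larger and larger
  frequencies gives infinitely many solutions.

  On the side of distributions, smooth functions are the sums of their Fourier series (by
  Stone-Weierstrass), so all operators act on coefficients, and after symmetrisation the weak
  formulation becomes the limiting identity for the coefficients of \<open>f\<close>.
\<close>

section \<open>Frequency vectors and the interaction symbol\<close>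

text \<open>The exponents come from one balance. A wave of frequency \<open>L\<close> and amplitude
  \<open>L powr (- a)\<close> absorbs a residual of size \<open>L powr (1 - 2 * a)\<close>. Writing
  x, y, z for three consecutive frequencies, the step at y leaves errors of order
  \<open>x powr (1 - a) * y powr (- a)\<close>, \<open>y powr (\<gamma> - 1 - a)\<close> and
  \<open>x * y powr (- 2 * a)\<close>, which must not exceed \<open>z powr (1 - 2 * a)\<close>. At b
  = 1 the first and third are borderline; to first order in b - 1 the first improves exactly when a
  < 2/3, while the second requires a < 2 - \<gamma>. The bound a > 1/2 makes the residuals vanish
  and the sum of \<open>sqrt (fnorm k) * \<bar>c k\<bar>\<close> finite; since the symbol is at most
  \<open>sqrt (fnorm k * fnorm m)\<close>, the quadratic term of the limit then converges
  absolutely. Waves in directions that are not opposite would also interact strongly; equal lengths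
  of all directions make the factor \<open>fnorm k - fnorm m\<close> small and prevent this. A
  single orbit of the quarter turn cannot produce every frequency, because its symbol vanishes on
  lines through the origin. The smallest length of integer vectors that gives two orbits is
  \<open>sqrt 5\<close>.\<close>

lemma freq_simps [simp]:
  "freq (k + m) = freq k + freq m" "freq (- k) = - freq k" "freq (k - m) = freq k - freq m"
  "freq 0 = 0"
  by (simp_all add: freq_def vec_eq_iff)

definition fnorm :: "int^2 \<Rightarrow> real" where
  "fnorm k = norm (freq k)"

definition cross :: "int^2 \<Rightarrow> int^2 \<Rightarrow> real" where
  "cross k m = real_of_int (k $ 1 * m $ 2 - k $ 2 * m $ 1)"

definition dot :: "int^2 \<Rightarrow> int^2 \<Rightarrow> real" where
  "dot k m = real_of_int (k $ 1 * m $ 1 + k $ 2 * m $ 2)"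

lemma fnorm_sq: "(fnorm k)^2 = (real_of_int (k $ 1))^2 + (real_of_int (k $ 2))^2"
  by (simp add: fnorm_def freq_def norm_eq_sqrt_inner inner_vec_def sum_2 power2_eq_square)

lemma fnorm_nonneg [simp]: "0 \<le> fnorm k"
  by (simp add: fnorm_def)

lemma fnorm_0 [simp]: "fnorm 0 = 0"
  by (simp add: fnorm_def)

lemma fnorm_minus [simp]: "fnorm (- k) = fnorm k"
  by (simp add: fnorm_def)

lemma fnorm_triangle: "fnorm (k + m) \<le> fnorm k + fnorm m"
  by (simp add: fnorm_def norm_triangle_ineq)

lemma fnorm_diff_le: "\<bar>fnorm k - fnorm m\<bar> \<le> fnorm (k - m)"
  by (simp add: fnorm_def norm_triangle_ineq3)

lemma fnorm_eq_0 [simp]: "fnorm k = 0 \<longleftrightarrow> k = 0"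
proof
  assume "fnorm k = 0"
  then have "(real_of_int (k $ 1))^2 + (real_of_int (k $ 2))^2 = 0"
    using fnorm_sq[of k] by simp
  then have "k $ 1 = 0 \<and> k $ 2 = 0"
    by (simp add: sum_power2_eq_zero_iff)
  then show "k = 0"
    by (simp add: vec_eq_iff forall_2)
qed simp

lemma fnorm_ge_1: "k \<noteq> 0 \<Longrightarrow> 1 \<le> fnorm k"
proof -
  assume "k \<noteq> 0"
  then have "k $ 1 \<noteq> 0 \<or> k $ 2 \<noteq> 0"
    by (auto simp: vec_eq_iff forall_2)
  then have "0 < (k $ 1)^2 + (k $ 2)^2"
    using sum_power2_gt_zero_iff by blast
  then have "1 \<le> (k $ 1)^2 + (k $ 2)^2"
    by linarith
  then have "1 \<le> (fnorm k)^2"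
    unfolding fnorm_sq by (metis of_int_1_le_iff of_int_add of_int_power)
  then show ?thesis
    by (rule power2_le_imp_le[of 1, simplified]) (use fnorm_nonneg in simp_all)
qed

lemma fnorm_component: "\<bar>real_of_int (k $ j)\<bar> \<le> fnorm k"
  using component_le_norm_cart[of "freq k" j] by (simp add: fnorm_def freq_def)

lemma finite_fnorm_le: "finite {k. fnorm k \<le> R}"
proof -
  let ?I = "{- \<lceil>\<bar>R\<bar>\<rceil> .. \<lceil>\<bar>R\<bar>\<rceil>}"
  have I: "k $ j \<in> ?I" if "fnorm k \<le> R" for k :: "int^2" and j
    using fnorm_component[of k j] that by (simp add: abs_le_iff) linarith
  have "{k. fnorm k \<le> R} \<subseteq> (\<lambda>(a, b). vector [a, b]) ` (?I \<times> ?I)"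
  proof
    fix k :: "int^2"
    assume "k \<in> {k. fnorm k \<le> R}"
    then have "(k $ 1, k $ 2) \<in> ?I \<times> ?I" using I by blast
    moreover have "k = (\<lambda>(a, b). vector [a, b]) (k $ 1, k $ 2)"
      by (simp add: vec_eq_iff forall_2)
    ultimately show "k \<in> (\<lambda>(a, b). vector [a, b]) ` (?I \<times> ?I)" by (rule rev_image_eqI)
  qed
  then show ?thesis
    by (rule finite_subset) simp
qed

text \<open>Lagrange's identity in the plane; dropping either square gives the two Cauchy-Schwarz
  bounds below.\<close>

lemma cross_dot: "(cross k m)^2 + (dot k m)^2 = (fnorm k)^2 * (fnorm m)^2"
  unfolding fnorm_sq cross_def dot_def by (simp add: algebra_simps power2_eq_square)

lemma abs_cross_le: "\<bar>cross k m\<bar> \<le> fnorm k * fnorm m"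
proof -
  have "(cross k m)^2 \<le> (fnorm k * fnorm m)^2"
    unfolding power_mult_distrib cross_dot[symmetric] by simp
  then show ?thesis using power2_le_imp_le[of "\<bar>cross k m\<bar>"] by simp
qed

lemma abs_dot_le: "\<bar>dot k m\<bar> \<le> fnorm k * fnorm m"
proof -
  have "(dot k m)^2 \<le> (fnorm k * fnorm m)^2"
    unfolding power_mult_distrib cross_dot[symmetric] by simp
  then show ?thesis using power2_le_imp_le[of "\<bar>dot k m\<bar>"] by simp
qed

lemma cross_add_left: "cross (k + m) n = cross k n + cross m n"
  and cross_self [simp]: "cross k k = 0"
  and cross_minus_left [simp]: "cross (- k) m = - cross k m"
  and cross_minus_right [simp]: "cross k (- m) = - cross k m"
  and dot_minus_left [simp]: "dot (- k) m = - dot k m"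
  and dot_minus_right [simp]: "dot k (- m) = - dot k m"
  by (simp_all add: cross_def dot_def algebra_simps)

lemma cross_0 [simp]: "cross k 0 = 0" "cross 0 k = 0"
  and dot_0 [simp]: "dot k 0 = 0" "dot 0 k = 0"
  by (simp_all add: cross_def dot_def)

text \<open>Up to sign, the symmetrised symbol of \<open>(f, g) \<mapsto> \<Delta>\<^sup>-\<^sup>1 \<nabla> \<cdot> (\<Lambda>f \<nabla>\<^sup>\<bottom>g)\<close>; division by zero makes it vanish for
  \<open>k + m = 0\<close>.\<close>

definition sig :: "int^2 \<Rightarrow> int^2 \<Rightarrow> real" where
  "sig k m = (fnorm k - fnorm m) * cross k m / (fnorm (k + m))^2"

text \<open>Since \<open>cross k k = 0\<close>, the output frequency can replace one argument. This
  gains a factor \<open>fnorm (k + m)\<close> against the denominator of \<open>sig\<close>.\<close>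

lemma cross_sum: "cross k m = cross k (k + m)" "cross k m = - cross m (k + m)"
  by (simp_all add: cross_def algebra_simps)

lemma fnorm_diff_le_sum: "\<bar>fnorm k - fnorm m\<bar> \<le> fnorm (k + m)"
  using fnorm_diff_le[of k "- m"] by simp

text \<open>Both factors of the numerator are small with the output frequency: the difference of
  lengths by the triangle inequality, the cross product by \<open>cross_sum\<close>. Together they
  cancel the denominator and leave one derivative, which by symmetry may be put on either
  argument.\<close>

lemma abs_sig_le_left: "\<bar>sig k m\<bar> \<le> fnorm k"
proof (cases "k + m = 0")
  case False
  then have pos: "0 < fnorm (k + m)"
    by (simp add: order_less_le)
  have "\<bar>(fnorm k - fnorm m) * cross k m\<bar> \<le> fnorm (k + m) * (fnorm k * fnorm (k + m))"
    unfolding abs_mult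
    by (rule mult_mono[OF fnorm_diff_le_sum]) (use abs_cross_le[of k "k + m"] cross_sum(1)[of k m] in simp_all)
  then show ?thesis
    using pos by (simp add: sig_def abs_mult divide_le_eq power2_eq_square mult_ac)
qed (simp add: sig_def)

lemma sig_commute: "sig k m = sig m k"
  by (simp add: sig_def cross_def add.commute[of m k] algebra_simps)

lemma abs_sig_le_right: "\<bar>sig k m\<bar> \<le> fnorm m"
  using abs_sig_le_left[of m k] by (simp add: sig_commute)

lemma sig_minus [simp]: "sig (- k) (- m) = sig k m"
proof -
  have "fnorm (- k - m) = fnorm (k + m)"
    using fnorm_minus[of "k + m"] by (simp add: algebra_simps)
  then show ?thesis by (simp add: sig_def)
qed

definition smul :: "int \<Rightarrow> int^2 \<Rightarrow> int^2" where
  "smul L e = (\<chi> i. L * e $ i)"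

lemma fnorm_smul: "fnorm (smul L e) = \<bar>real_of_int L\<bar> * fnorm e"
proof -
  have "freq (smul L e) = real_of_int L *\<^sub>R freq e"
    by (simp add: freq_def smul_def vec_eq_iff)
  then show ?thesis by (simp add: fnorm_def)
qed

lemma smul_simps [simp]:
  "cross (smul L e) m = real_of_int L * cross e m" "cross m (smul L e) = real_of_int L * cross m e"
  "dot (smul L e) m = real_of_int L * dot e m" "dot m (smul L e) = real_of_int L * dot m e"
  "smul L (- e) = - smul L e"
  by (simp_all add: cross_def dot_def smul_def vec_eq_iff algebra_simps)

lemma smul_add: "smul L (e + d) = smul L e + smul L d"
  by (simp add: smul_def vec_eq_iff algebra_simps)

definition dirs :: "(int^2) set" where
  "dirs = {e. (e $ 1)^2 + (e $ 2)^2 = 5}"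

lemma dirs_fnorm: "e \<in> dirs \<Longrightarrow> fnorm e = sqrt 5"
proof -
  assume "e \<in> dirs"
  then have "(e $ 1)^2 + (e $ 2)^2 = 5" by (simp add: dirs_def)
  then have "(fnorm e)^2 = 5"
    unfolding fnorm_sq by (metis of_int_add of_int_numeral of_int_power)
  then show ?thesis
    by (metis fnorm_nonneg real_sqrt_unique)
qed

lemma finite_dirs [simp]: "finite dirs"
proof (rule finite_subset)
  show "dirs \<subseteq> {k. fnorm k \<le> sqrt 5}" by (auto simp: dirs_fnorm)
qed (rule finite_fnorm_le)

lemma dirs_minus [simp]: "- e \<in> dirs \<longleftrightarrow> e \<in> dirs"
  by (simp add: dirs_def)

definition rot :: "int^2 \<Rightarrow> int^2" where
  "rot e = vector [- (e $ 2), e $ 1]"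

lemma rot_dirs [simp]: "e \<in> dirs \<Longrightarrow> rot e \<in> dirs"
  by (simp add: dirs_def rot_def add.commute)

lemma rot_rot: "rot (rot e) = - e"
  by (simp add: rot_def vec_eq_iff forall_2)

text \<open>Up to sign and normalisation, this is the symbol through which a wave of frequency
  direction \<open>e\<close> interacts with the opposite wave to produce low frequencies.\<close>

definition sym :: "int^2 \<Rightarrow> int^2 \<Rightarrow> real" where
  "sym e p = dot e p * cross e p"

lemma sym_minus [simp]: "sym (- e) p = sym e p" "sym e (- p) = sym e p" "sym e 0 = 0"
  by (simp_all add: sym_def)

lemma sym_rot: "sym (rot e) p = - sym e p"
  by (simp add: sym_def rot_def dot_def cross_def algebra_simps)

lemma abs_sym_le: "e \<in> dirs \<Longrightarrow> \<bar>sym e p\<bar> \<le> 5 * (fnorm p)^2"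
proof -
  assume e: "e \<in> dirs"
  have "\<bar>sym e p\<bar> \<le> (fnorm e * fnorm p) * (fnorm e * fnorm p)"
    unfolding sym_def abs_mult by (intro mult_mono abs_dot_le abs_cross_le) simp_all
  also have "\<dots> = (fnorm e)^2 * (fnorm p)^2" by (simp add: power2_eq_square)
  finally show ?thesis using dirs_fnorm[OF e] by simp
qed

text \<open>Ellipticity: one vector from each of the two rotation orbits already yields two symbols
  without a common zero other than the origin. This is what allows the division in
  \<open>amp\<close>.\<close>

lemma sum_sym_ge: "4 * (fnorm p)^4 \<le> (\<Sum>e\<in>dirs. (sym e p)^2)"
proof -
  let ?a = "vector [1, 2] :: int^2" and ?b = "vector [2, 1] :: int^2"
  have ne: "?a \<noteq> ?b" by (simp add: vec_eq_iff forall_2)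
  let ?x = "real_of_int (p $ 1)" and ?y = "real_of_int (p $ 2)"
  have "4 * (fnorm p)^4 = 4 * ((?x^2 + ?y^2))^2"
    by (simp add: fnorm_sq[symmetric])
  also have "\<dots> \<le> (sym ?a p)^2 + (sym ?b p)^2"
  proof -
    \<comment> \<open>The two symbols are 2 (y^2 - x^2) - 3 x y and 2 (y^2 - x^2) + 3 x y, so their
      squares add up to 8 (x^2 - y^2)^2 + 18 (x y)^2, whereas (x^2 + y^2)^2 = (x^2 - y^2)^2 + 4 (x
      y)^2.\<close>
    have "(sym ?a p)^2 + (sym ?b p)^2 - 4 * ((?x^2 + ?y^2))^2 = 4 * (?x^2 - ?y^2)^2 + 2 * (?x * ?y)^2"
      by (simp add: sym_def dot_def cross_def algebra_simps power2_eq_square)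
    then show ?thesis by (smt (verit) zero_le_power2)
  qed
  also have "\<dots> = (\<Sum>e\<in>{?a, ?b}. (sym e p)^2)" using ne by simp
  also have "\<dots> \<le> (\<Sum>e\<in>dirs. (sym e p)^2)"
  proof (rule sum_mono2)
    show "{?a, ?b} \<subseteq> dirs" by (simp add: dirs_def)
  qed simp_all
  finally show ?thesis .
qed

section \<open>Interaction of two waves of nearly equal length\<close>

text \<open>Both lengths lie within \<open>\<mu>\<close> of \<open>sqrt 5 * L\<close>, so their
  difference is at most \<open>2 * \<mu>\<close> instead of order \<open>L\<close>. The integer
  vector \<open>e + e'\<close> is nonzero, so the output frequency is at least \<open>L / 2\<close>
  and the remaining quotient of lengths is at most 6.\<close>

lemma sig_wave_far:
  fixes \<mu> :: real
  assumes e: "e \<in> dirs" "e' \<in> dirs" "e' \<noteq> - e" and L: "0 < (L::int)" and mu: "4 * \<mu> \<le> real_of_int L"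
    and u: "fnorm u \<le> \<mu>" and v: "fnorm v \<le> \<mu>"
  shows "\<bar>sig (smul L e + u) (smul L e' + v)\<bar> \<le> 12 * \<mu>"
proof -
  define k where "k = smul L e + u"
  define m where "m = smul L e' + v"
  have r5: "sqrt 5 \<le> 5/2" by (rule real_le_lsqrt) (auto simp: power2_eq_square)
  have L0: "0 < real_of_int L" using L by simp
  have mu0: "0 \<le> \<mu>" using u fnorm_nonneg[of u] by linarith
  have k: "\<bar>fnorm k - sqrt 5 * L\<bar> \<le> \<mu>"
    using fnorm_diff_le[of k "smul L e"] u L dirs_fnorm[OF e(1)] by (simp add: k_def fnorm_smul mult.commute)
  have m: "\<bar>fnorm m - sqrt 5 * L\<bar> \<le> \<mu>"
    using fnorm_diff_le[of m "smul L e'"] v L dirs_fnorm[OF e(2)] by (simp add: m_def fnorm_smul mult.commute)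
  have km: "\<bar>fnorm k - fnorm m\<bar> \<le> 2 * \<mu>" using k m by linarith
  have "sqrt 5 * L \<le> 5/2 * L" using r5 L0 by (intro mult_right_mono) auto
  then have k3: "fnorm k \<le> 3 * L" using k mu by linarith
  have "e + e' \<noteq> 0" using e(3) by (metis add.inverse_unique)
  then have "real_of_int L * 1 \<le> fnorm (smul L (e + e'))"
    unfolding fnorm_smul using L0 by (intro mult_mono) (auto simp: fnorm_ge_1)
  moreover have "fnorm (smul L (e + e')) \<le> fnorm (k + m) + (fnorm u + fnorm v)"
  proof -
    have "smul L (e + e') = (k + m) + (- u + - v)" by (simp add: k_def m_def smul_add)
    then show ?thesis
      using fnorm_triangle[of "k + m" "- u + - v"] fnorm_triangle[of "- u" "- v"] by (simp only: fnorm_minus)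
  qed
  ultimately have p: "L / 2 \<le> fnorm (k + m)" using u v mu by linarith
  then have p0: "0 < fnorm (k + m)" using L0 by linarith
  have "\<bar>sig k m\<bar> = \<bar>fnorm k - fnorm m\<bar> * \<bar>cross k (k + m)\<bar> / (fnorm (k + m))^2"
    by (simp add: sig_def abs_mult cross_sum(1)[symmetric])
  also have "\<dots> \<le> (2 * \<mu>) * (fnorm k * fnorm (k + m)) / (fnorm (k + m))^2"
    by (intro divide_right_mono mult_mono km abs_cross_le) (use mu0 in auto)
  also have "\<dots> = (2 * \<mu>) * fnorm k / fnorm (k + m)"
    using p0 by (simp add: power2_eq_square)
  also have "\<dots> \<le> (2 * \<mu>) * (3 * L) / (L / 2)"
    by (intro frac_le mult_left_mono k3 p) (use L0 mu0 in auto)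
  also have "\<dots> = 12 * \<mu>" using L0 by simp
  finally show ?thesis by (simp add: k_def m_def)
qed

text \<open>The large parts cancel in the output p = u + v. A difference of lengths is the
  difference of squares over the sum: the former is \<open>2 * L * dot e p\<close> plus a term
  bounded by \<open>2 * \<mu> * fnorm p\<close>, the latter close to \<open>2 * sqrt 5 * L\<close>.
  Hence the difference is about \<open>dot e p / sqrt 5\<close>, while the cross product is about
  \<open>L * cross e p\<close>. The constant 12 is that of \<open>sig_wave_far\<close>.\<close>

lemma sig_wave_opposite:
  fixes \<mu> :: real
  assumes e: "e \<in> dirs" and L: "0 < (L::int)" and mu: "4 * \<mu> \<le> real_of_int L"
    and u: "fnorm u \<le> \<mu>" and v: "fnorm v \<le> \<mu>"
  shows "\<bar>sig (smul L e + u) (smul L (- e) + v)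
           - L * sym e (u + v) / (sqrt 5 * (fnorm (u + v))^2)\<bar> \<le> 12 * \<mu>"
proof (cases "u + v = 0")
  case True
  then show ?thesis using order_trans[OF fnorm_nonneg u] by (simp add: sig_def add_eq_0_iff)
next
  case False
  define k where "k = smul L e + u"
  define m where "m = smul L (- e) + v"
  define p where "p = u + v"
  define S where "S = fnorm k + fnorm m"
  define x where "x = fnorm k - fnorm m"
  have r5: "2 \<le> sqrt 5" by (rule real_le_rsqrt) simp
  have r5': "sqrt 5 \<le> 5/2" by (rule real_le_lsqrt) (auto simp: power2_eq_square)
  have L0: "0 < real_of_int L" using L by simp
  have mu0: "0 \<le> \<mu>" using u fnorm_nonneg[of u] by linarith
  have km: "k + m = p" by (simp add: k_def m_def p_def)
  have p0: "0 < fnorm p" using False by (simp add: p_def order_less_le)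
  have k: "\<bar>fnorm k - sqrt 5 * L\<bar> \<le> \<mu>"
    using fnorm_diff_le[of k "smul L e"] u L dirs_fnorm[OF e(1)] by (simp add: k_def fnorm_smul mult.commute)
  have m: "\<bar>fnorm m - sqrt 5 * L\<bar> \<le> \<mu>"
    using fnorm_diff_le[of m "smul L (- e)"] v L dirs_fnorm[OF e(1)] by (simp add: m_def fnorm_smul mult.commute)
  have "2 * real_of_int L \<le> sqrt 5 * L" using r5 L0 by (intro mult_right_mono) auto
  then have S: "2 * L \<le> S" "\<bar>2 * (sqrt 5 * L) - S\<bar> \<le> 2 * \<mu>"
    using k m mu by (auto simp: S_def)
  then have S0: "0 < S" using L0 by linarith
  have x1: "\<bar>x\<bar> \<le> fnorm p" using fnorm_diff_le_sum[of k m] by (simp add: x_def km)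
  have "x * S = (fnorm k)^2 - (fnorm m)^2" by (simp add: x_def S_def power2_eq_square algebra_simps)
  also have "\<dots> = 2 * L * dot e p + dot (u - v) p"
    unfolding fnorm_sq k_def m_def p_def dot_def smul_def by (simp add: power2_eq_square algebra_simps)
  finally have xS: "x = (2 * L * dot e p + dot (u - v) p) / S"
    using S0 by (simp add: field_simps)
  have dp: "\<bar>dot e p\<bar> \<le> sqrt 5 * fnorm p" and cp: "\<bar>cross e p\<bar> \<le> sqrt 5 * fnorm p"
    using abs_dot_le[of e p] abs_cross_le[of e p] by (simp_all add: dirs_fnorm[OF e])
  have "fnorm (u - v) \<le> 2 * \<mu>" using fnorm_triangle[of u "- v"] u v by simp
  then have duv: "\<bar>dot (u - v) p\<bar> \<le> 2 * \<mu> * fnorm p"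
    using abs_dot_le[of "u - v" p] by (meson fnorm_nonneg mult_right_mono order_trans)
  \<comment> \<open>Two sources of error: replacing \<open>S\<close> by
    \<open>2 * sqrt 5 * L\<close>, and the lower-order term in the difference of squares.\<close>
  have "x - dot e p / sqrt 5 = dot e p * ((2 * (sqrt 5 * L) - S) / (sqrt 5 * S)) + dot (u - v) p / S"
    using S0 unfolding xS by (simp add: field_simps)
  also have "\<bar>\<dots>\<bar> \<le> (sqrt 5 * fnorm p) * (2 * \<mu> / (sqrt 5 * (2 * L))) + 2 * \<mu> * fnorm p / (2 * L)"
  proof (rule order_trans[OF abs_triangle_ineq add_mono])
    have "\<bar>(2 * (sqrt 5 * L) - S) / (sqrt 5 * S)\<bar> = \<bar>2 * (sqrt 5 * L) - S\<bar> / (sqrt 5 * S)"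
      using S0 by (simp add: abs_mult)
    also have "\<dots> \<le> 2 * \<mu> / (sqrt 5 * (2 * L))"
      by (intro frac_le mult_left_mono S) (use mu0 L0 in auto)
    finally show "\<bar>dot e p * ((2 * (sqrt 5 * L) - S) / (sqrt 5 * S))\<bar> \<le> (sqrt 5 * fnorm p) * (2 * \<mu> / (sqrt 5 * (2 * L)))"
      unfolding abs_mult[of "dot e p"] by (intro mult_mono dp) auto
    have "\<bar>dot (u - v) p / S\<bar> = \<bar>dot (u - v) p\<bar> / S" using S0 by simp
    also have "\<dots> \<le> 2 * \<mu> * fnorm p / (2 * L)"
      by (intro frac_le duv S) (use mu0 L0 in auto)
    finally show "\<bar>dot (u - v) p / S\<bar> \<le> 2 * \<mu> * fnorm p / (2 * L)" .
  qed
  also have "\<dots> = 2 * \<mu> * fnorm p / L" using L0 by (simp add: field_simps)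
  finally have x2: "\<bar>x - dot e p / sqrt 5\<bar> \<le> 2 * \<mu> * fnorm p / L" .
  have "cross k m = cross k p" using cross_sum(1)[of k m] km by simp
  also have "\<dots> = L * cross e p + cross u p" by (simp add: k_def cross_add_left)
  finally have "sig k m = x * (L * cross e p + cross u p) / (fnorm p)^2" by (simp add: sig_def x_def km)
  then have "sig k m - L * sym e p / (sqrt 5 * (fnorm p)^2)
      = (L * cross e p * (x - dot e p / sqrt 5) + x * cross u p) / (fnorm p)^2"
    by (simp add: sym_def diff_divide_distrib add_divide_distrib algebra_simps)
  also have "\<bar>\<dots>\<bar> = \<bar>L * cross e p * (x - dot e p / sqrt 5) + x * cross u p\<bar> / (fnorm p)^2"
    by simp
  also have "\<dots> \<le> (L * (5/2 * fnorm p) * (2 * \<mu> * fnorm p / L) + fnorm p * (\<mu> * fnorm p)) / (fnorm p)^2"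
  proof (intro divide_right_mono order_trans[OF abs_triangle_ineq add_mono])
    have "\<bar>cross e p\<bar> \<le> 5/2 * fnorm p" using cp r5' by (meson fnorm_nonneg mult_right_mono order_trans)
    then show "\<bar>L * cross e p * (x - dot e p / sqrt 5)\<bar> \<le> L * (5/2 * fnorm p) * (2 * \<mu> * fnorm p / L)"
      unfolding abs_mult using L0 by (intro mult_mono x2) auto
    have "\<bar>cross u p\<bar> \<le> \<mu> * fnorm p" using abs_cross_le[of u p] u by (meson fnorm_nonneg mult_right_mono order_trans)
    then show "\<bar>x * cross u p\<bar> \<le> fnorm p * (\<mu> * fnorm p)"
      unfolding abs_mult by (intro mult_mono x1) auto
  qed simp
  also have "\<dots> = 6 * \<mu>" using p0 L0 by (auto simp: power2_eq_square field_simps)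
  finally show ?thesis using mu0 by (simp add: k_def m_def p_def)
qed

section \<open>Finitely supported coefficients\<close>

definition fsup :: "(int^2 \<Rightarrow> real) \<Rightarrow> bool" where
  "fsup f \<longleftrightarrow> finite {k. f k \<noteq> 0}"

text \<open>An infinite sum, so that \<open>Q\<close> and the equation also make sense for the
  limit, whose support is infinite. The calculus below concerns finitely supported first arguments
  and arbitrary second ones.\<close>

definition pair :: "(int^2 \<Rightarrow> real) \<Rightarrow> (int^2 \<Rightarrow> real) \<Rightarrow> real" where
  "pair f G = (\<Sum>\<^sub>\<infinity>k. f k * G k)"

lemma pair_sum:
  assumes "finite A" "\<And>k. f k \<noteq> 0 \<Longrightarrow> k \<in> A"
  shows "pair f G = (\<Sum>k\<in>A. f k * G k)"
proof -
  have "pair f G = infsum (\<lambda>k. f k * G k) A"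
    unfolding pair_def by (rule infsum_cong_neutral) (use assms in auto)
  then show ?thesis using assms by simp
qed

lemma fsup_pair: "fsup f \<Longrightarrow> pair f G = (\<Sum>k | f k \<noteq> 0. f k * G k)"
  by (rule pair_sum) (auto simp: fsup_def)

lemma fsup_intros:
  "fsup f \<Longrightarrow> fsup g \<Longrightarrow> fsup (\<lambda>k. f k + g k)"
  "fsup f \<Longrightarrow> fsup (\<lambda>k. \<bar>f k\<bar>)"
  "fsup f \<Longrightarrow> fsup (\<lambda>k. h k * f k)"
  "fsup f \<Longrightarrow> fsup (\<lambda>k. f k * h k)"
  "fsup f \<Longrightarrow> fsup (\<lambda>k. f (k - a))"
  "finite E \<Longrightarrow> (\<And>e. e \<in> E \<Longrightarrow> fsup (F e)) \<Longrightarrow> fsup (\<lambda>k. \<Sum>e\<in>E. F e k)"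
  "fsup (\<lambda>k. if k = 0 then A else 0)"
proof -
  show "fsup f \<Longrightarrow> fsup g \<Longrightarrow> fsup (\<lambda>k. f k + g k)"
    unfolding fsup_def by (rule finite_subset[of _ "{k. f k \<noteq> 0} \<union> {k. g k \<noteq> 0}"]) auto
  show "fsup f \<Longrightarrow> fsup (\<lambda>k. f (k - a))"
    unfolding fsup_def by (rule finite_subset[of _ "(\<lambda>k. k + a) ` {k. f k \<noteq> 0}"])
      (force simp: image_iff intro: exI[of _ "_ - a"])+
  show "finite E \<Longrightarrow> (\<And>e. e \<in> E \<Longrightarrow> fsup (F e)) \<Longrightarrow> fsup (\<lambda>k. \<Sum>e\<in>E. F e k)"
    unfolding fsup_def by (rule finite_subset[of _ "\<Union>e\<in>E. {k. F e k \<noteq> 0}"])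
      (auto intro: ccontr sum.neutral)
  show "fsup (\<lambda>k. if k = 0 then A else 0)"
    unfolding fsup_def by (rule finite_subset[of _ "{0}"]) auto
qed (auto simp: fsup_def intro: rev_finite_subset)

lemma fsup_bounded: "(\<And>k. f k \<noteq> 0 \<Longrightarrow> fnorm k \<le> R) \<Longrightarrow> fsup f"
  unfolding fsup_def by (rule finite_subset[OF _ finite_fnorm_le[of R]]) auto

lemma pair_cong: "(\<And>k. f k \<noteq> 0 \<Longrightarrow> G k = H k) \<Longrightarrow> pair f G = pair f H"
  unfolding pair_def by (rule infsum_cong) auto

lemma pair_add_right: "fsup f \<Longrightarrow> pair f (\<lambda>k. G k + H k) = pair f G + pair f H"
  by (simp add: fsup_pair algebra_simps sum.distrib)

lemma pair_diff_right: "fsup f \<Longrightarrow> pair f (\<lambda>k. G k - H k) = pair f G - pair f H"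
  by (simp add: fsup_pair algebra_simps sum_subtractf)

lemma pair_cmult_right: "pair f (\<lambda>k. c * G k) = c * pair f G"
  unfolding pair_def by (subst infsum_cmult_right'[symmetric]) (simp add: mult_ac)

lemma pair_cmult_left: "pair (\<lambda>k. c * f k) G = c * pair f G"
  unfolding pair_def by (subst infsum_cmult_right'[symmetric]) (simp add: mult_ac)

lemma pair_mult_left: "pair (\<lambda>k. h k * f k) G = pair f (\<lambda>k. h k * G k)"
  unfolding pair_def by (simp add: mult_ac)

lemma pair_add_left:
  assumes "fsup f" "fsup g"
  shows "pair (\<lambda>k. f k + g k) G = pair f G + pair g G"
proof -
  let ?A = "{k. f k \<noteq> 0} \<union> {k. g k \<noteq> 0}"
  have "finite ?A" using assms by (simp add: fsup_def)
  then have "pair f G = (\<Sum>k\<in>?A. f k * G k)" "pair g G = (\<Sum>k\<in>?A. g k * G k)"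
    "pair (\<lambda>k. f k + g k) G = (\<Sum>k\<in>?A. (f k + g k) * G k)"
    by (auto intro!: pair_sum)
  then show ?thesis by (simp add: algebra_simps sum.distrib)
qed

lemma pair_sum_left:
  assumes "finite E" "\<And>e. e \<in> E \<Longrightarrow> fsup (F e)"
  shows "pair (\<lambda>k. \<Sum>e\<in>E. F e k) G = (\<Sum>e\<in>E. pair (F e) G)"
  using assms
proof (induction E rule: finite_induct)
  case empty
  then show ?case by (simp add: pair_def)
next
  case (insert x E)
  then show ?case by (simp add: pair_add_left fsup_intros)
qed

lemma pair_sum_right:
  assumes "fsup f"
  shows "pair f (\<lambda>k. \<Sum>e\<in>E. G e k) = (\<Sum>e\<in>E. pair f (G e))"
  unfolding fsup_pair[OF assms] sum_distrib_left by (rule sum.swap)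

lemma pair_swap:
  assumes "fsup f" "fsup g"
  shows "pair f (\<lambda>k. pair g (\<lambda>m. H k m)) = pair g (\<lambda>m. pair f (\<lambda>k. H k m))"
  unfolding fsup_pair[OF assms(1)] fsup_pair[OF assms(2)] sum_distrib_left
  by (subst sum.swap) (simp add: mult_ac)

lemma pair_shift: "pair (\<lambda>k. f (k - a)) G = pair f (\<lambda>k. G (k + a))"
  unfolding pair_def
  using infsum_reindex_bij_betw[of "\<lambda>k. k + a" UNIV UNIV "\<lambda>k. f (k - a) * G k"]
  by (simp add: bij_plus_right)

lemma pair_delta: "pair (\<lambda>k. if k = 0 then A else 0) G = A * G 0"
  by (subst pair_sum[of "{0}"]) (auto split: if_splits)

lemma abs_pair_le:
  assumes "fsup f" "\<And>k. f k \<noteq> 0 \<Longrightarrow> \<bar>G k\<bar> \<le> H k"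
  shows "\<bar>pair f G\<bar> \<le> pair (\<lambda>k. \<bar>f k\<bar>) H"
proof -
  have "\<bar>pair f G\<bar> \<le> (\<Sum>k | f k \<noteq> 0. \<bar>f k * G k\<bar>)"
    unfolding fsup_pair[OF assms(1)] by (rule sum_abs)
  also have "\<dots> \<le> (\<Sum>k | f k \<noteq> 0. \<bar>f k\<bar> * H k)"
    by (rule sum_mono) (auto simp: abs_mult intro!: mult_left_mono assms(2))
  also have "\<dots> = pair (\<lambda>k. \<bar>f k\<bar>) H"
    using fsup_pair[OF fsup_intros(2)[OF assms(1)], of H] by simp
  finally show ?thesis .
qed

definition l1 :: "(int^2 \<Rightarrow> real) \<Rightarrow> real" where
  "l1 f = pair (\<lambda>k. \<bar>f k\<bar>) (\<lambda>_. 1)"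

lemma l1_nonneg [simp]: "0 \<le> l1 f"
  by (simp add: l1_def pair_def infsum_nonneg)

lemma pair_abs_const: "pair (\<lambda>k. \<bar>f k\<bar>) (\<lambda>_. c) = c * l1 f"
  using pair_cmult_right[of "\<lambda>k. \<bar>f k\<bar>" c "\<lambda>_. 1"] by (simp add: l1_def)

lemma abs_pair_le_l1:
  assumes "fsup f" "\<And>k. f k \<noteq> 0 \<Longrightarrow> \<bar>G k\<bar> \<le> c"
  shows "\<bar>pair f G\<bar> \<le> c * l1 f"
  using abs_pair_le[OF assms] by (simp add: pair_abs_const)

lemma pair_abs_mono:
  assumes "fsup f" "\<And>k. f k \<noteq> 0 \<Longrightarrow> G k \<le> H k"
  shows "pair (\<lambda>k. \<bar>f k\<bar>) G \<le> pair (\<lambda>k. \<bar>f k\<bar>) H"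
  using fsup_pair[OF fsup_intros(2)[OF assms(1)]] by (auto intro!: sum_mono mult_left_mono assms(2))

text \<open>Duality: it is enough to estimate pairings with functions bounded by 1, in which the
  convolution inside \<open>Q\<close> unfolds into a double sum.\<close>

lemma l1_eq_pair_sgn: "l1 f = pair f (\<lambda>k. sgn (f k))"
  by (simp add: l1_def pair_def abs_sgn)

lemma pair_abs_add_le:
  assumes "fsup f" "fsup g" "\<And>k. 0 \<le> H k"
  shows "pair (\<lambda>k. \<bar>f k + g k\<bar>) H \<le> pair (\<lambda>k. \<bar>f k\<bar>) H + pair (\<lambda>k. \<bar>g k\<bar>) H"
proof -
  have f: "fsup (\<lambda>k. \<bar>f k\<bar>)" "fsup (\<lambda>k. \<bar>g k\<bar>)" using assms by (auto intro: fsup_intros)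
  let ?A = "{k. f k \<noteq> 0} \<union> {k. g k \<noteq> 0}"
  have A: "finite ?A" using assms by (simp add: fsup_def)
  have "pair (\<lambda>k. \<bar>f k + g k\<bar>) H = (\<Sum>k\<in>?A. \<bar>f k + g k\<bar> * H k)"
    by (rule pair_sum[OF A]) auto
  also have "\<dots> \<le> (\<Sum>k\<in>?A. (\<bar>f k\<bar> + \<bar>g k\<bar>) * H k)"
    by (intro sum_mono mult_right_mono abs_triangle_ineq assms)
  also have "\<dots> = pair (\<lambda>k. \<bar>f k\<bar> + \<bar>g k\<bar>) H"
    by (rule pair_sum[OF A, symmetric]) auto
  finally show ?thesis using pair_add_left[OF f] by simp
qed

text \<open>If f is the stream function and \<theta> = \<open>Lambda 1\<close> of it, then
  \<open>(fnorm p)^2 * Q f f p\<close> is the Fourier coefficient of the transport term at p. The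
  factor 1/2 comes from the symmetrisation of the symbol.\<close>

definition Q :: "(int^2 \<Rightarrow> real) \<Rightarrow> (int^2 \<Rightarrow> real) \<Rightarrow> int^2 \<Rightarrow> real" where
  "Q f g p = 1/2 * pair f (\<lambda>k. sig k (p - k) * g (p - k))"

lemma Q_nonzero:
  assumes "Q f g p \<noteq> 0"
  obtains k m where "f k \<noteq> 0" "g m \<noteq> 0" "p = k + m"
proof -
  have "\<exists>k. f k \<noteq> 0 \<and> g (p - k) \<noteq> 0"
  proof (rule ccontr)
    assume *: "\<nexists>k. f k \<noteq> 0 \<and> g (p - k) \<noteq> 0"
    have "(\<lambda>k. f k * (sig k (p - k) * g (p - k))) = (\<lambda>_. 0)"
      using * by (intro ext) auto
    then show False using assms by (simp add: Q_def pair_def)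
  qed
  then show ?thesis using that[of _ "p - _"] by force
qed

lemma fsup_Q:
  assumes "fsup f" "fsup g"
  shows "fsup (Q f g)"
proof -
  have "{p. Q f g p \<noteq> 0} \<subseteq> (\<lambda>(k, m). k + m) ` ({k. f k \<noteq> 0} \<times> {k. g k \<noteq> 0})"
    by (force elim: Q_nonzero)
  then show ?thesis unfolding fsup_def by (rule finite_subset) (use assms in \<open>simp add: fsup_def\<close>)
qed

text \<open>Substituting p = k + m gives a double sum in which the bounds on \<open>sig\<close>
  apply termwise.\<close>

lemma pair_Q:
  assumes f: "fsup f" and g: "fsup g"
  shows "pair (Q f g) s = 1/2 * pair f (\<lambda>k. pair g (\<lambda>m. sig k m * s (k + m)))"
proof -
  let ?P = "{p. Q f g p \<noteq> 0} \<union> (\<lambda>(k, m). k + m) ` ({k. f k \<noteq> 0} \<times> {k. g k \<noteq> 0})"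
  have P: "finite ?P" using fsup_Q[OF f g] f g by (auto simp: fsup_def)
  have inner: "(\<Sum>p\<in>?P. sig k (p - k) * g (p - k) * s p) = pair g (\<lambda>m. sig k m * s (k + m))"
    if "f k \<noteq> 0" for k
  proof -
    have "p \<in> ?P" if "g (p - k) \<noteq> 0" for p
      using that \<open>f k \<noteq> 0\<close> by (intro UnI2 image_eqI[of _ _ "(k, p - k)"]) auto
    then have "pair (\<lambda>p. g (p - k)) (\<lambda>p. sig k (p - k) * s p) = (\<Sum>p\<in>?P. g (p - k) * (sig k (p - k) * s p))"
      by (intro pair_sum P) auto
    then show ?thesis unfolding pair_shift by (simp add: mult_ac add.commute)
  qed
  have "pair (Q f g) s = (\<Sum>p\<in>?P. Q f g p * s p)"
    by (rule pair_sum[OF P]) auto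
  also have "\<dots> = 1/2 * (\<Sum>p\<in>?P. \<Sum>k | f k \<noteq> 0. f k * (sig k (p - k) * g (p - k) * s p))"
    unfolding Q_def fsup_pair[OF f] by (simp add: sum_distrib_left sum_distrib_right mult_ac)
  also have "\<dots> = 1/2 * (\<Sum>k | f k \<noteq> 0. f k * (\<Sum>p\<in>?P. sig k (p - k) * g (p - k) * s p))"
    by (subst sum.swap) (simp add: sum_distrib_left)
  also have "\<dots> = 1/2 * (\<Sum>k | f k \<noteq> 0. f k * pair g (\<lambda>m. sig k m * s (k + m)))"
    using inner by (intro arg_cong[where f = "\<lambda>x. 1/2 * x"] sum.cong) auto
  also have "\<dots> = 1/2 * pair f (\<lambda>k. pair g (\<lambda>m. sig k m * s (k + m)))"
    by (simp add: fsup_pair[OF f])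
  finally show ?thesis .
qed

lemma Q_add:
  assumes "fsup f" "fsup g"
  shows "Q (\<lambda>k. f k + g k) (\<lambda>k. f k + g k) p = Q f f p + Q f g p + Q g f p + Q g g p"
  unfolding Q_def using assms
  by (simp add: pair_add_left pair_add_right distrib_left fsup_intros)

lemma Q_even:
  assumes "\<And>k. f (- k) = f k" "\<And>k. g (- k) = g k"
  shows "Q f g (- p) = Q f g p"
proof -
  have "pair f (\<lambda>k. sig k (- p - k) * g (- p - k)) = (\<Sum>\<^sub>\<infinity>k. f (- k) * (sig (- k) (- p + k) * g (- p + k)))"
    unfolding pair_def
    using infsum_reindex_bij_betw[OF bij_uminus, of "\<lambda>k. f k * (sig k (- p - k) * g (- p - k))"]
    by simp
  also have "\<dots> = (\<Sum>\<^sub>\<infinity>k. f k * (sig k (p - k) * g (p - k)))"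
  proof (rule infsum_cong)
    fix k
    have "sig (- k) (- p + k) = sig k (p - k)" "g (- p + k) = g (p - k)"
      using sig_minus[of k "p - k"] assms(2)[of "p - k"] by simp_all
    then show "f (- k) * (sig (- k) (- p + k) * g (- p + k)) = f k * (sig k (p - k) * g (p - k))"
      by (simp add: assms)
  qed
  finally show ?thesis by (simp add: Q_def pair_def)
qed

definition grad_l1 :: "(int^2 \<Rightarrow> real) \<Rightarrow> real" where
  "grad_l1 f = pair (\<lambda>k. \<bar>f k\<bar>) fnorm"

text \<open>The derivative left over in \<open>sig\<close> can always be put on f, in either order
  of the arguments. In the iteration f is the old low-frequency part and g the new wave.\<close>

lemma pair_Q_cross:
  assumes f: "fsup f" and g: "fsup g" and s: "\<And>p. \<bar>s p\<bar> \<le> 1"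
  shows "\<bar>pair (Q f g) s\<bar> \<le> 1/2 * (grad_l1 f * l1 g)" "\<bar>pair (Q g f) s\<bar> \<le> 1/2 * (grad_l1 f * l1 g)"
proof -
  have sl: "\<bar>sig k m * s (k + m)\<bar> \<le> fnorm k" "\<bar>sig m k * s (m + k)\<bar> \<le> fnorm k" for k m
    using mult_mono[OF abs_sig_le_left[of k m] s[of "k + m"]]
    by (simp_all add: abs_mult sig_commute[of m k] add.commute[of m k])
  have *: "\<bar>pair f (\<lambda>k. pair g (\<lambda>m. H k m))\<bar> \<le> grad_l1 f * l1 g"
    if "\<And>k m. \<bar>H k m\<bar> \<le> fnorm k" for H
  proof -
    have "\<bar>pair f (\<lambda>k. pair g (\<lambda>m. H k m))\<bar> \<le> pair (\<lambda>k. \<bar>f k\<bar>) (\<lambda>k. l1 g * fnorm k)"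
      by (intro abs_pair_le[OF f]) (use abs_pair_le_l1[OF g that] in \<open>simp add: mult.commute\<close>)
    then show ?thesis unfolding pair_cmult_right grad_l1_def by (simp only: mult.commute)
  qed
  show "\<bar>pair (Q f g) s\<bar> \<le> 1/2 * (grad_l1 f * l1 g)"
    unfolding pair_Q[OF f g] using *[OF sl(1)] by simp
  show "\<bar>pair (Q g f) s\<bar> \<le> 1/2 * (grad_l1 f * l1 g)"
    unfolding pair_Q[OF g f] pair_swap[OF g f] using *[OF sl(2)] by simp
qed

section \<open>One step of the iteration\<close>

text \<open>The correction z to the constant amplitude \<open>A\<close>. Division by the sum of
  squares gives the least-norm solution of the single linear equation per frequency that the terms
  \<open>2 * A * z\<close> have to satisfy. The prefactor undoes \<open>A\<close> and the constant
  \<open>L / sqrt 5\<close> of \<open>sig_wave_opposite\<close>, and z inherits from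
  \<open>sym\<close> its oddness under \<open>rot\<close>.\<close>

definition amp :: "real \<Rightarrow> int \<Rightarrow> (int^2 \<Rightarrow> real) \<Rightarrow> int^2 \<Rightarrow> int^2 \<Rightarrow> real" where
  "amp A L q e p = - (sqrt 5 / (A * L) * (sym e p * (fnorm p)^2 / (\<Sum>d\<in>dirs. (sym d p)^2))) * q p"

definition wave :: "real \<Rightarrow> int \<Rightarrow> (int^2 \<Rightarrow> real) \<Rightarrow> int^2 \<Rightarrow> real" where
  "wave A L q k = (\<Sum>e\<in>dirs. (if k - smul L e = 0 then A else 0) + amp A L q e (k - smul L e))"

lemma fsup_amp [simp]: "fsup q \<Longrightarrow> fsup (amp A L q e)"
  using fsup_intros(3)[of q "\<lambda>p. - (sqrt 5 / (A * L) * (sym e p * (fnorm p)^2 / (\<Sum>d\<in>dirs. (sym d p)^2)))"]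
  by (simp add: amp_def[abs_def])

lemma amp_minus: "amp A L q (- e) = amp A L q e"
  by (rule ext) (simp add: amp_def)

lemma amp_rot: "amp A L q (rot e) p = - amp A L q e p"
  by (simp add: amp_def sym_rot)

text \<open>By \<open>abs_sym_le\<close> and \<open>sum_sym_ge\<close> the quotient is at most 5/4;
  with \<open>sqrt 5\<close> at most 12/5 this gives the constant 3.\<close>

lemma abs_amp_le:
  assumes e: "e \<in> dirs" and "0 < A" "0 < (L::int)" "q 0 = 0"
  shows "\<bar>amp A L q e p\<bar> \<le> 3 / (A * L) * \<bar>q p\<bar>"
proof (cases "p = 0")
  case True
  then show ?thesis using assms by (simp add: amp_def)
next
  case False
  then have p: "0 < fnorm p" by (simp add: order_less_le)
  have W: "0 < (\<Sum>d\<in>dirs. (sym d p)^2)"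
    using sum_sym_ge[of p] p by (smt (verit) zero_less_power)
  have r5: "sqrt 5 \<le> 12/5" by (rule real_le_lsqrt) (auto simp: power2_eq_square)
  have "\<bar>sym e p * (fnorm p)^2 / (\<Sum>d\<in>dirs. (sym d p)^2)\<bar> = \<bar>sym e p\<bar> * (fnorm p)^2 / (\<Sum>d\<in>dirs. (sym d p)^2)"
    using W by (simp add: abs_mult)
  also have "\<dots> \<le> (5 * (fnorm p)^2) * (fnorm p)^2 / (4 * (fnorm p)^4)"
    by (intro frac_le mult_right_mono abs_sym_le e sum_sym_ge) (use p in auto)
  also have "\<dots> = 5/4" using p False by (simp add: power2_eq_square power4_eq_xxxx)
  finally have X: "\<bar>sym e p * (fnorm p)^2 / (\<Sum>d\<in>dirs. (sym d p)^2)\<bar> \<le> 5/4" .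
  have "\<bar>sqrt 5 / (A * L) * (sym e p * (fnorm p)^2 / (\<Sum>d\<in>dirs. (sym d p)^2))\<bar>
      = sqrt 5 / (A * L) * \<bar>sym e p * (fnorm p)^2 / (\<Sum>d\<in>dirs. (sym d p)^2)\<bar>"
    using assms unfolding abs_mult[of "sqrt 5 / (A * L)"] by simp
  also have "\<dots> \<le> (12/5) / (A * L) * (5/4)"
    by (intro mult_mono X divide_right_mono r5) (use assms in auto)
  finally have "\<bar>sqrt 5 / (A * L) * (sym e p * (fnorm p)^2 / (\<Sum>d\<in>dirs. (sym d p)^2))\<bar> \<le> 3 / (A * L)"
    by simp
  then show ?thesis unfolding amp_def abs_mult[of _ "q p"] abs_minus_cancel
    by (rule mult_right_mono) simp
qed

lemma amp_nonzero: "amp A L q e p \<noteq> 0 \<Longrightarrow> q p \<noteq> 0"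
  by (auto simp: amp_def)

context
  fixes A :: real and L :: int and q :: "int^2 \<Rightarrow> real" and \<mu> :: real
  assumes A: "0 < A" and L: "0 < L" and q0: "q 0 = 0" and qe: "\<And>p. q (- p) = q p"
    and qs: "\<And>p. q p \<noteq> 0 \<Longrightarrow> fnorm p \<le> \<mu>" and mu: "0 \<le> \<mu>" "10 * \<mu> \<le> real_of_int L"
    and ql: "l1 q \<le> A^2 * L"
begin

definition full_amp :: "int^2 \<Rightarrow> int^2 \<Rightarrow> real" where
  "full_amp e p = (if p = 0 then A else 0) + amp A L q e p"

lemma q_fsup: "fsup q"
  using fsup_bounded qs .

lemma full_amp_fsup: "fsup (full_amp e)"
  unfolding full_amp_def[abs_def] by (intro fsup_intros fsup_amp q_fsup)

lemma full_amp_nonzero: "full_amp e p \<noteq> 0 \<Longrightarrow> fnorm p \<le> \<mu>"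
  using amp_nonzero qs mu by (auto simp: full_amp_def split: if_splits)

text \<open>The constant part contributes \<open>A\<close>. The bound \<open>A^2 * L\<close> on the
  residual was chosen so that the correction contributes no more than \<open>3 * A\<close>.\<close>

lemma full_amp_l1:
  assumes e: "e \<in> dirs"
  shows "l1 (full_amp e) \<le> 4 * A"
proof -
  have "l1 (full_amp e) \<le> l1 (\<lambda>p. if p = 0 then A else 0) + l1 (amp A L q e)"
    unfolding l1_def full_amp_def by (intro pair_abs_add_le fsup_intros fsup_amp q_fsup) simp
  also have "l1 (\<lambda>p. if p = 0 then A else 0) = A"
    unfolding l1_def using pair_delta[of A "\<lambda>_. 1"] A by (simp add: if_distrib cong: if_cong)
  also have "l1 (amp A L q e) \<le> 3 / (A * L) * l1 q"
  proof -
    have "l1 (amp A L q e) = (\<Sum>p | q p \<noteq> 0. \<bar>amp A L q e p\<bar>)"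
      unfolding l1_def using q_fsup amp_nonzero[of A L q e] by (subst pair_sum[of "{p. q p \<noteq> 0}"]) (auto simp: fsup_def)
    also have "\<dots> \<le> (\<Sum>p | q p \<noteq> 0. 3 / (A * L) * \<bar>q p\<bar>)"
      by (intro sum_mono abs_amp_le e A L q0)
    also have "\<dots> = 3 / (A * L) * l1 q"
      unfolding l1_def using q_fsup by (subst pair_sum[of "{p. q p \<noteq> 0}"]) (auto simp: fsup_def sum_distrib_left)
    finally show ?thesis .
  qed
  also have "3 / (A * L) * l1 q \<le> 3 / (A * L) * (A^2 * L)"
    by (intro mult_left_mono ql) (use A L in auto)
  also have "\<dots> = 3 * A" using A L by (simp add: power2_eq_square)
  finally show ?thesis by simp
qed

lemma wave_eq: "wave A L q = (\<lambda>k. \<Sum>e\<in>dirs. full_amp e (k - smul L e))"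
  by (rule ext) (simp add: wave_def full_amp_def)

lemma fsup_wave: "fsup (wave A L q)"
  unfolding wave_eq by (intro fsup_intros full_amp_fsup) simp

lemma pair_wave: "pair (wave A L q) G = (\<Sum>e\<in>dirs. pair (full_amp e) (\<lambda>u. G (smul L e + u)))"
  unfolding wave_eq
  by (subst pair_sum_left) (auto intro: fsup_intros full_amp_fsup simp: pair_shift add.commute)

lemma wave_even: "wave A L q (- k) = wave A L q k"
proof -
  have fe: "full_amp (- e) (- p) = full_amp e p" for e p
    by (simp add: full_amp_def amp_minus) (simp add: amp_def qe)
  have "wave A L q (- k) = (\<Sum>e\<in>dirs. full_amp (- e) (- k - smul L (- e)))"
    unfolding wave_eq by (rule sum.reindex_bij_witness[of _ uminus uminus]) auto
  also have "\<dots> = (\<Sum>e\<in>dirs. full_amp e (k - smul L e))"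
    using fe[of _ "k - smul L _"] by (intro sum.cong) (auto simp: algebra_simps)
  finally show ?thesis by (simp add: wave_eq)
qed

text \<open>\<open>sqrt 5\<close> lies between 11/5 and 12/5, and the spread \<open>\<mu>\<close> of
  each packet is at most \<open>L / 10\<close>. This is where the factor 10 in the scale separation
  is needed.\<close>

lemma wave_support:
  assumes "wave A L q k \<noteq> 0"
  shows "2 * real_of_int L \<le> fnorm k" "fnorm k \<le> 3 * real_of_int L"
proof -
  obtain e where e: "e \<in> dirs" "full_amp e (k - smul L e) \<noteq> 0"
    using assms unfolding wave_eq by (meson sum.neutral)
  have "fnorm (k - smul L e) \<le> \<mu>" using full_amp_nonzero e by blast
  then have k: "\<bar>fnorm k - sqrt 5 * L\<bar> \<le> \<mu>"
    using fnorm_diff_le[of k "smul L e"] L dirs_fnorm[OF e(1)] by (simp add: fnorm_smul mult.commute)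
  have r5: "11/5 \<le> sqrt 5" by (rule real_le_rsqrt) (simp add: power2_eq_square)
  have r5': "sqrt 5 \<le> 12/5" by (rule real_le_lsqrt) (auto simp: power2_eq_square)
  have "11/5 * real_of_int L \<le> sqrt 5 * L" "sqrt 5 * L \<le> 12/5 * L"
    using r5 r5' L by (auto intro: mult_right_mono)
  then show "2 * real_of_int L \<le> fnorm k" "fnorm k \<le> 3 * real_of_int L" using k mu by linarith+
qed

lemma wave_l1: "l1 (wave A L q) \<le> 4 * card dirs * A"
proof -
  have "l1 (wave A L q) = (\<Sum>e\<in>dirs. pair (full_amp e) (\<lambda>u. sgn (wave A L q (smul L e + u))))"
    unfolding l1_eq_pair_sgn by (rule pair_wave)
  also have "\<dots> \<le> (\<Sum>e\<in>dirs. 4 * A)"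
  proof (rule sum_mono)
    fix e assume "e \<in> dirs"
    have "\<bar>pair (full_amp e) (\<lambda>u. sgn (wave A L q (smul L e + u)))\<bar> \<le> 1 * l1 (full_amp e)"
      by (intro abs_pair_le_l1 full_amp_fsup) (simp add: abs_sgn_eq)
    then show "pair (full_amp e) (\<lambda>u. sgn (wave A L q (smul L e + u))) \<le> 4 * A"
      using full_amp_l1[OF \<open>e \<in> dirs\<close>] by linarith
  qed
  finally show ?thesis by simp
qed

text \<open>Distinct packet centres are at least \<open>L\<close> apart and thus outside each
  other's packets, and the correction vanishes at the centre. This explicit coefficient shows later
  that the limit is nonzero.\<close>

lemma wave_pos:
  assumes "e \<in> dirs"
  shows "wave A L q (smul L e) = A"
proof -
  have "full_amp d (smul L e - smul L d) = (if d = e then A else 0)" if "d \<in> dirs" for d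
  proof (cases "d = e")
    case True
    then show ?thesis using q0 by (simp add: full_amp_def amp_def)
  next
    case False
    have "smul L e - smul L d = smul L (e - d)" using smul_add[of L e "- d"] by simp
    then have "fnorm (smul L e - smul L d) = L * fnorm (e - d)" using L by (simp add: fnorm_smul)
    moreover have "1 \<le> fnorm (e - d)" using False by (simp add: fnorm_ge_1)
    ultimately have "L \<le> fnorm (smul L e - smul L d)" using L by simp
    then have "\<not> fnorm (smul L e - smul L d) \<le> \<mu>" using mu L by linarith
    then show ?thesis using full_amp_nonzero False by auto
  qed
  then have "wave A L q (smul L e) = (\<Sum>d\<in>dirs. if d = e then A else 0)"
    unfolding wave_eq by (intro sum.cong) auto
  then show ?thesis using assms by simp
qed

text \<open>The square of the amplitude \<open>A + z\<close> has the three parts \<open>A\<^sup>2\<close>, \<open>2 A z\<close> and \<open>z\<^sup>2\<close>.  The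
  first does not see the symbol, the last cancels between orthogonal directions, and the
  second was chosen to produce \<open>- q\<close>.\<close>

lemma wave_main_term:
  "(\<Sum>e\<in>dirs. pair (full_amp e) (\<lambda>u. pair (full_amp (- e))
      (\<lambda>v. L * sym e (u + v) / (sqrt 5 * (fnorm (u + v))^2) * s (u + v)))) = - 2 * pair q s"
proof -
  define K where "K e p = L * sym e p / (sqrt 5 * (fnorm p)^2) * s p" for e p
  let ?z = "amp A L q"
  have K0: "K e 0 = 0" for e by (simp add: K_def)
  have K_rot: "K (rot e) p = - K e p" for e p by (simp add: K_def sym_rot)
  have fs [simp]: "fsup (?z e)" "fsup (\<lambda>p. if p = (0::int^2) then A else 0)" for e
    by (simp_all add: q_fsup fsup_intros)
  have inner: "pair (full_amp e) (\<lambda>v. K e (u + v)) = A * K e u + pair (?z e) (\<lambda>v. K e (u + v))" for e u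
    unfolding full_amp_def[abs_def] by (simp add: pair_add_left pair_delta)
  have "pair (full_amp e) (\<lambda>u. pair (full_amp (- e)) (\<lambda>v. K e (u + v)))
      = 2 * A * pair (?z e) (K e) + pair (?z e) (\<lambda>u. pair (?z e) (\<lambda>v. K e (u + v)))" for e
  proof -
    have "full_amp (- e) = full_amp e" by (rule ext) (simp add: full_amp_def amp_minus)
    then have "pair (full_amp e) (\<lambda>u. pair (full_amp (- e)) (\<lambda>v. K e (u + v)))
        = pair (full_amp e) (\<lambda>u. A * K e u + pair (?z e) (\<lambda>v. K e (u + v)))"
      by (simp add: inner)
    also have "\<dots> = A * pair (full_amp e) (K e) + pair (full_amp e) (\<lambda>u. pair (?z e) (\<lambda>v. K e (u + v)))"
      using pair_cmult_right[of "full_amp e" A "K e"] by (simp add: pair_add_right full_amp_fsup)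
    also have "pair (full_amp e) (K e) = pair (?z e) (K e)"
      unfolding full_amp_def[abs_def] by (simp add: pair_add_left pair_delta K0)
    also have "pair (full_amp e) (\<lambda>u. pair (?z e) (\<lambda>v. K e (u + v)))
        = A * pair (?z e) (K e) + pair (?z e) (\<lambda>u. pair (?z e) (\<lambda>v. K e (u + v)))"
      unfolding full_amp_def[abs_def] by (simp add: pair_add_left pair_delta)
    finally show ?thesis by simp
  qed
  then have "(\<Sum>e\<in>dirs. pair (full_amp e) (\<lambda>u. pair (full_amp (- e)) (\<lambda>v. K e (u + v))))
     = 2 * A * (\<Sum>e\<in>dirs. pair (?z e) (K e)) + (\<Sum>e\<in>dirs. pair (?z e) (\<lambda>u. pair (?z e) (\<lambda>v. K e (u + v))))"
    by (simp add: sum.distrib sum_distrib_left)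
  moreover have "(\<Sum>e\<in>dirs. pair (?z e) (\<lambda>u. pair (?z e) (\<lambda>v. K e (u + v)))) = 0" (is "sum ?Z dirs = 0")
  proof -
    \<comment> \<open>The term contains two factors z and one factor \<open>K\<close>, all odd under
      \<open>rot\<close>, so it changes sign. As \<open>rot\<close> permutes \<open>dirs\<close>,
      with its third iterate as inverse, the sum equals its own negative.\<close>
    have "?Z (rot e) = - ?Z e" for e
    proof -
      have z: "?z (rot e) = (\<lambda>p. - 1 * ?z e p)" by (rule ext) (simp add: amp_rot)
      have K: "K (rot e) (u + v) = - 1 * K e (u + v)" for u v by (simp add: K_rot)
      show ?thesis unfolding z K pair_cmult_left pair_cmult_right by simp
    qed
    moreover have "sum ?Z dirs = (\<Sum>e\<in>dirs. ?Z (rot e))"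
      by (rule sum.reindex_bij_witness[of _ rot "\<lambda>e. rot (rot (rot e))"]) (simp_all add: rot_rot)
    ultimately show ?thesis by (simp add: sum_negf)
  qed
  moreover have "A * (\<Sum>e\<in>dirs. pair (?z e) (K e)) = - pair q s"
  proof -
    have "A * (\<Sum>e\<in>dirs. pair (?z e) (K e))
        = pair q (\<lambda>p. A * (\<Sum>e\<in>dirs. - (sqrt 5 / (A * L) * (sym e p * (fnorm p)^2 / (\<Sum>d\<in>dirs. (sym d p)^2))) * K e p))"
      unfolding pair_cmult_right pair_sum_right[OF q_fsup] amp_def[abs_def] pair_mult_left ..
    also have "\<dots> = pair q (\<lambda>p. - 1 * s p)"
    proof (rule pair_cong)
      fix p assume "q p \<noteq> 0"
      then have p: "0 < fnorm p" using q0 by (auto simp: order_less_le)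
      have W: "0 < (\<Sum>d\<in>dirs. (sym d p)^2)" (is "0 < ?W")
        using sum_sym_ge[of p] p by (smt (verit) zero_less_power)
      have "A * (- (sqrt 5 / (A * L) * (sym e p * (fnorm p)^2 / ?W)) * K e p) = - ((sym e p)^2 * (s p / ?W))" for e
        using p W A L by (simp add: K_def power2_eq_square)
      then have "A * (\<Sum>e\<in>dirs. - (sqrt 5 / (A * L) * (sym e p * (fnorm p)^2 / ?W)) * K e p) = (\<Sum>e\<in>dirs. - ((sym e p)^2 * (s p / ?W)))"
        by (simp add: sum_distrib_left)
      also have "\<dots> = - ?W * (s p / ?W)" by (simp only: sum_distrib_right[symmetric] sum_negf mult_minus_left)
      finally show "A * (\<Sum>e\<in>dirs. - (sqrt 5 / (A * L) * (sym e p * (fnorm p)^2 / ?W)) * K e p) = - 1 * s p"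
        using W by simp
    qed
    also have "\<dots> = - pair q s" by (simp only: pair_cmult_right)
    finally show ?thesis .
  qed
  ultimately show ?thesis by (simp add: K_def)
qed

text \<open>In the sum over pairs of directions only opposite ones have a leading part, evaluated by
  \<open>wave_main_term\<close>. Each pair has an error of at most \<open>12 * \<mu>\<close> times
  the two amplitude norms \<open>4 * A\<close>, that is \<open>192 * \<mu> * A^2\<close>, and the
  factor 1/2 in \<open>Q\<close> halves it.\<close>

lemma wave_self:
  assumes s: "\<And>p. \<bar>s p\<bar> \<le> 1"
  shows "\<bar>pair (Q (wave A L q) (wave A L q)) s + pair q s\<bar> \<le> 96 * (card dirs)^2 * \<mu> * A^2"
proof -
  let ?w = "wave A L q"
  define M where "M e e' u v = (if e' = - e then L * sym e (u + v) / (sqrt 5 * (fnorm (u + v))^2) else 0) * s (u + v)"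
    for e e' u v
  define G where "G e e' u v = sig (smul L e + u) (smul L e' + v) * s (smul L e + u + (smul L e' + v))" for e e' u v
  have err: "\<bar>pair (full_amp e) (\<lambda>u. pair (full_amp e') (\<lambda>v. G e e' u v))
      - pair (full_amp e) (\<lambda>u. pair (full_amp e') (\<lambda>v. M e e' u v))\<bar> \<le> 192 * \<mu> * A^2"
    if e: "e \<in> dirs" "e' \<in> dirs" for e e'
  proof -
    have b: "\<bar>G e e' u v - M e e' u v\<bar> \<le> 12 * \<mu>" if u: "fnorm u \<le> \<mu>" and v: "fnorm v \<le> \<mu>" for u v
    proof (cases "e' = - e")
      case True
      then have "G e e' u v - M e e' u v = (sig (smul L e + u) (smul L (- e) + v)
           - L * sym e (u + v) / (sqrt 5 * (fnorm (u + v))^2)) * s (u + v)"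
        by (simp add: G_def M_def algebra_simps)
      also have "\<bar>\<dots>\<bar> \<le> 12 * \<mu> * 1"
        unfolding abs_mult using sig_wave_opposite[OF e(1) L, of \<mu> u v] mu u v
        by (intro mult_mono s) auto
      finally show ?thesis by simp
    next
      case False
      have "\<bar>G e e' u v\<bar> \<le> 12 * \<mu> * 1"
        unfolding abs_mult G_def using sig_wave_far[OF e False L, of \<mu> u v] mu u v
        by (intro mult_mono s) auto
      then show ?thesis using False by (simp add: M_def)
    qed
    have "pair (full_amp e) (\<lambda>u. pair (full_amp e') (\<lambda>v. G e e' u v))
      - pair (full_amp e) (\<lambda>u. pair (full_amp e') (\<lambda>v. M e e' u v))
      = pair (full_amp e) (\<lambda>u. pair (full_amp e') (\<lambda>v. G e e' u v - M e e' u v))"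
      by (simp add: pair_diff_right full_amp_fsup)
    also have "\<bar>\<dots>\<bar> \<le> (12 * \<mu> * l1 (full_amp e')) * l1 (full_amp e)"
      by (intro abs_pair_le_l1 full_amp_fsup b full_amp_nonzero)
    also have "\<dots> \<le> (12 * \<mu> * (4 * A)) * (4 * A)"
      by (intro mult_mono full_amp_l1 e mult_nonneg_nonneg) (use mu A in auto)
    finally show ?thesis by (simp add: power2_eq_square mult_ac)
  qed
  have "pair (Q ?w ?w) s = 1/2 * (\<Sum>e\<in>dirs. \<Sum>e'\<in>dirs. pair (full_amp e) (\<lambda>u. pair (full_amp e') (\<lambda>v. G e e' u v)))"
    unfolding pair_Q[OF fsup_wave fsup_wave] pair_wave G_def by (simp add: pair_sum_right full_amp_fsup)
  moreover have "- pair q s = 1/2 * (\<Sum>e\<in>dirs. \<Sum>e'\<in>dirs. pair (full_amp e) (\<lambda>u. pair (full_amp e') (\<lambda>v. M e e' u v)))"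
  proof -
    have "(\<Sum>e'\<in>dirs. pair (full_amp e) (\<lambda>u. pair (full_amp e') (\<lambda>v. M e e' u v)))
       = pair (full_amp e) (\<lambda>u. pair (full_amp (- e)) (\<lambda>v. L * sym e (u + v) / (sqrt 5 * (fnorm (u + v))^2) * s (u + v)))"
      if "e \<in> dirs" for e
    proof -
      have "(\<Sum>e'\<in>dirs. pair (full_amp e) (\<lambda>u. pair (full_amp e') (\<lambda>v. M e e' u v)))
          = (\<Sum>e'\<in>{- e}. pair (full_amp e) (\<lambda>u. pair (full_amp e') (\<lambda>v. M e e' u v)))"
      proof (rule sum.mono_neutral_right)
        show "\<forall>e'\<in>dirs - {- e}. pair (full_amp e) (\<lambda>u. pair (full_amp e') (\<lambda>v. M e e' u v)) = 0"
          by (auto simp: M_def pair_def)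
      qed (use that in auto)
      then show ?thesis by (simp add: M_def)
    qed
    then show ?thesis using wave_main_term[of s] by simp
  qed
  ultimately have "pair (Q ?w ?w) s + pair q s = 1/2 * (\<Sum>e\<in>dirs. \<Sum>e'\<in>dirs.
     pair (full_amp e) (\<lambda>u. pair (full_amp e') (\<lambda>v. G e e' u v))
      - pair (full_amp e) (\<lambda>u. pair (full_amp e') (\<lambda>v. M e e' u v)))"
    by (simp add: sum_subtractf)
  also have "\<bar>\<dots>\<bar> \<le> 1/2 * (\<Sum>e\<in>dirs. \<Sum>e'\<in>dirs. 192 * \<mu> * A^2)"
    unfolding abs_mult by (intro mult_mono order_trans[OF sum_abs] sum_mono err) (auto intro: sum_nonneg)
  also have "\<dots> = 96 * (card dirs)^2 * \<mu> * A^2"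
    by (simp add: power2_eq_square)
  finally show ?thesis .
qed

end

section \<open>The iteration and its limit\<close>

text \<open>The stationary equation for \<theta> = \<open>Lambda 1\<close> of f, divided by
  \<open>(fnorm p)^2\<close>. The dissipation, of order \<gamma> + 1 in f, thereby has order
  \<gamma> - 1.\<close>

definition resid :: "real \<Rightarrow> real \<Rightarrow> (int^2 \<Rightarrow> real) \<Rightarrow> int^2 \<Rightarrow> real" where
  "resid \<kappa> \<gamma> f p = Q f f p + \<kappa> * fnorm p powr (\<gamma> - 1) * f p"

lemma fsup_resid: "fsup f \<Longrightarrow> fsup (resid \<kappa> \<gamma> f)"
  unfolding resid_def[abs_def] by (intro fsup_intros fsup_Q)

lemma resid_even: "(\<And>k. f (- k) = f k) \<Longrightarrow> resid \<kappa> \<gamma> f (- p) = resid \<kappa> \<gamma> f p"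
  by (simp add: resid_def Q_even)

text \<open>The quadratic part vanishes through the zero denominator of \<open>sig\<close>, the
  dissipation because \<open>0 powr x = 0\<close>. Waves can only remove a residual without zero
  mode.\<close>

lemma resid_0: "resid \<kappa> \<gamma> f 0 = 0"
  by (simp add: resid_def Q_def sig_def pair_def)

lemma resid_support:
  assumes "\<And>k. f k \<noteq> 0 \<Longrightarrow> fnorm k \<le> R" "resid \<kappa> \<gamma> f p \<noteq> 0"
  shows "fnorm p \<le> 2 * R"
proof (cases "f p = 0")
  case True
  then have "Q f f p \<noteq> 0" using assms(2) by (simp add: resid_def)
  then obtain k m where "f k \<noteq> 0" "f m \<noteq> 0" "p = k + m" by (rule Q_nonzero)
  then show ?thesis using fnorm_triangle[of k m] assms(1)[of k] assms(1)[of m] by simp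
next
  case False
  then show ?thesis using assms(1)[of p] fnorm_nonneg[of p] by linarith
qed

text \<open>Expanding \<open>Q\<close> on f plus the wave, the old residual is nearly cancelled by
  the self-interaction of the wave (\<open>wave_self\<close>). What remains are the cross terms,
  controlled by the gradient of f, and the dissipation of the wave.\<close>

lemma resid_step:
  fixes f :: "int^2 \<Rightarrow> real" and A \<mu> :: real and \<kappa> \<gamma> :: real
  defines "q \<equiv> resid \<kappa> \<gamma> f"
  assumes A: "0 < A" and L: "0 < (L::int)" and f: "fsup f" and fe: "\<And>p. f (- p) = f p"
    and qs: "\<And>p. q p \<noteq> 0 \<Longrightarrow> fnorm p \<le> \<mu>" and mu: "0 \<le> \<mu>" "10 * \<mu> \<le> real_of_int L"
    and ql: "l1 q \<le> A^2 * L" and ga: "0 < \<gamma>" "\<gamma> < 2"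
  shows "l1 (resid \<kappa> \<gamma> (\<lambda>k. f k + wave A L q k))
    \<le> (grad_l1 f + 3 * \<bar>\<kappa>\<bar> * L powr (\<gamma> - 1)) * (4 * card dirs * A) + 96 * (card dirs)^2 * \<mu> * A^2"
proof -
  have q0: "q 0 = 0" and qe: "\<And>p. q (- p) = q p" and qf: "fsup q"
    using fe f by (auto simp: q_def resid_0 resid_even fsup_resid)
  note ctx = A L q0 qe qs mu ql
  let ?w = "wave A L q"
  have w: "fsup ?w" by (rule fsup_wave[OF ctx])
  let ?r = "resid \<kappa> \<gamma> (\<lambda>k. f k + ?w k)"
  define s where "s p = sgn (?r p)" for p
  have s1: "\<bar>s p\<bar> \<le> 1" for p by (simp add: s_def abs_sgn_eq)
  \<comment> \<open>The sign of the exponent decides which end of the annulus is used: the outer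
    radius \<open>3 * L\<close> if \<gamma> is at least 1, where \<gamma> < 2 keeps the constant
    below 3, and the inner one otherwise.\<close>
  have D: "fnorm p powr (\<gamma> - 1) \<le> 3 * L powr (\<gamma> - 1)" if "?w p \<noteq> 0" for p
  proof -
    have p: "2 * real_of_int L \<le> fnorm p" "fnorm p \<le> 3 * real_of_int L" using wave_support[OF ctx that] by auto
    have L0: "0 < real_of_int L" using L by simp
    show ?thesis
    proof (cases "1 \<le> \<gamma>")
      case True
      have "fnorm p powr (\<gamma> - 1) \<le> (3 * real_of_int L) powr (\<gamma> - 1)"
        using p True by (intro powr_mono2) auto
      also have "\<dots> = 3 powr (\<gamma> - 1) * L powr (\<gamma> - 1)" using L0 by (simp add: powr_mult)
      also have "\<dots> \<le> 3 powr 1 * L powr (\<gamma> - 1)" using ga by (intro mult_right_mono powr_mono) auto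
      finally show ?thesis by simp
    next
      case False
      have "fnorm p powr (\<gamma> - 1) \<le> L powr (\<gamma> - 1)"
        using p False L0 by (intro powr_mono2') auto
      then show ?thesis by (smt (verit) powr_ge_zero)
    qed
  qed
  let ?D = "\<lambda>p. \<kappa> * fnorm p powr (\<gamma> - 1) * ?w p"
  have r: "?r = (\<lambda>p. q p + (Q f ?w p + (Q ?w f p + (Q ?w ?w p + ?D p))))"
  proof
    fix p
    have "?r p = (Q f f p + \<kappa> * fnorm p powr (\<gamma> - 1) * f p) + Q f ?w p + Q ?w f p + Q ?w ?w p + ?D p"
      unfolding resid_def[of _ _ "\<lambda>k. f k + ?w k"] Q_add[OF f w] by (simp add: distrib_left)
    then show "?r p = q p + (Q f ?w p + (Q ?w f p + (Q ?w ?w p + ?D p)))"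
      by (simp only: q_def resid_def[of \<kappa> \<gamma> f] add.assoc)
  qed
  have "l1 ?r = pair ?r s" unfolding s_def by (rule l1_eq_pair_sgn)
  also have "\<dots> = pair q s + (pair (Q f ?w) s + (pair (Q ?w f) s + (pair (Q ?w ?w) s + pair ?D s)))"
    unfolding r using f w qf by (simp add: pair_add_left fsup_intros fsup_Q)
  also have "\<dots> \<le> grad_l1 f * l1 ?w + 3 * \<bar>\<kappa>\<bar> * L powr (\<gamma> - 1) * l1 ?w + 96 * (card dirs)^2 * \<mu> * A^2"
  proof -
    have "\<bar>pair ?D s\<bar> \<le> (3 * \<bar>\<kappa>\<bar> * L powr (\<gamma> - 1)) * l1 ?w"
    proof -
      have "pair ?D s = pair ?w (\<lambda>p. \<kappa> * fnorm p powr (\<gamma> - 1) * s p)"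
        by (rule pair_mult_left)
      also have "\<bar>\<dots>\<bar> \<le> (3 * \<bar>\<kappa>\<bar> * L powr (\<gamma> - 1)) * l1 ?w"
      proof (rule abs_pair_le_l1[OF w])
        fix p assume "?w p \<noteq> 0"
        then have "\<bar>\<kappa>\<bar> * fnorm p powr (\<gamma> - 1) * \<bar>s p\<bar> \<le> \<bar>\<kappa>\<bar> * (3 * L powr (\<gamma> - 1)) * 1"
          by (intro mult_mono D s1) auto
        then show "\<bar>\<kappa> * fnorm p powr (\<gamma> - 1) * s p\<bar> \<le> 3 * \<bar>\<kappa>\<bar> * L powr (\<gamma> - 1)"
          by (simp add: abs_mult mult_ac)
      qed
      finally show ?thesis .
    qed
    then show ?thesis
      using pair_Q_cross[of f ?w s, OF f w s1] wave_self[of A L q \<mu> s, OF ctx s1] by linarith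
  qed
  also have "\<dots> = (grad_l1 f + 3 * \<bar>\<kappa>\<bar> * L powr (\<gamma> - 1)) * l1 ?w + 96 * (card dirs)^2 * \<mu> * A^2"
    by (simp add: algebra_simps)
  also have "\<dots> \<le> (grad_l1 f + 3 * \<bar>\<kappa>\<bar> * L powr (\<gamma> - 1)) * (4 * card dirs * A) + 96 * (card dirs)^2 * \<mu> * A^2"
  proof -
    have "0 \<le> grad_l1 f" by (simp add: grad_l1_def pair_def infsum_nonneg)
    then show ?thesis by (intro add_right_mono mult_left_mono wave_l1[OF ctx]) auto
  qed
  finally show ?thesis .
qed

text \<open>The geometric mean of the two bounds on \<open>sig\<close> puts half a derivative on
  each factor. One weighted factor is then bounded by the sum, the other is summable.\<close>

lemma sig_prod_summable:
  assumes "(\<lambda>k. sqrt (fnorm k) * \<bar>c k\<bar>) summable_on UNIV"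
  shows "(\<lambda>k. c k * (sig k (p - k) * c (p - k))) summable_on UNIV"
proof -
  let ?g = "\<lambda>k. sqrt (fnorm k) * \<bar>c k\<bar>"
  have M: "?g m \<le> infsum ?g UNIV" for m
    using finite_sum_le_infsum[OF assms, of "{m}"] by simp
  have "(\<lambda>k. infsum ?g UNIV * ?g k) summable_on UNIV"
    using assms by (rule summable_on_cmult_right)
  then have "(\<lambda>k. norm (c k * (sig k (p - k) * c (p - k)))) summable_on UNIV"
  proof (rule Infinite_Sum.abs_summable_on_comparison_test')
    fix k
    let ?m = "p - k"
    have "\<bar>sig k ?m\<bar> \<le> sqrt (fnorm k) * sqrt (fnorm ?m)"
    proof -
      have "\<bar>sig k ?m\<bar> * \<bar>sig k ?m\<bar> \<le> fnorm k * fnorm ?m"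
        by (intro mult_mono abs_sig_le_left abs_sig_le_right) auto
      then have "sqrt (\<bar>sig k ?m\<bar> * \<bar>sig k ?m\<bar>) \<le> sqrt (fnorm k * fnorm ?m)"
        by (rule real_sqrt_le_mono)
      then show ?thesis by (simp add: real_sqrt_mult)
    qed
    then have "\<bar>c k\<bar> * (\<bar>sig k ?m\<bar> * \<bar>c ?m\<bar>) \<le> \<bar>c k\<bar> * ((sqrt (fnorm k) * sqrt (fnorm ?m)) * \<bar>c ?m\<bar>)"
      by (intro mult_left_mono mult_right_mono) auto
    also have "\<dots> = ?g ?m * ?g k" by simp
    also have "\<dots> \<le> infsum ?g UNIV * ?g k" by (intro mult_right_mono M) auto
    finally show "norm (c k * (sig k ?m * c ?m)) \<le> infsum ?g UNIV * ?g k"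
      by (simp add: abs_mult)
  qed
  then show ?thesis by (rule abs_summable_summable)
qed

text \<open>The summands in the last assumption bound the interaction of the new waves with the
  previous approximation, their dissipation, and the error of their self-interaction; the right-hand
  side is the size of residual that the next step can absorb.\<close>

locale frequency_sequence =
  fixes \<kappa> \<gamma> a :: real and L :: "nat \<Rightarrow> int"
  assumes ga: "0 < \<gamma>" "\<gamma> < 2" and a: "1/2 < a" "a < 1"
    and L0: "1 \<le> L 0" and L_step: "\<And>n. 60 * L n \<le> L (Suc n)"
    and L_double: "\<And>n. 2 * L n powr (1 - a) \<le> L (Suc n) powr (1 - a)"
    and L_err: "\<And>n. (24 * card dirs * L n powr (1 - a) + 3 * \<bar>\<kappa>\<bar> * L (Suc n) powr (\<gamma> - 1))
          * (4 * card dirs * L (Suc n) powr (- a)) + 576 * (card dirs)^2 * real_of_int (L n) * L (Suc n) powr (- 2 * a)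
        \<le> L (Suc (Suc n)) powr (1 - 2 * a)"
begin

definition ampl :: "nat \<Rightarrow> real" where
  "ampl n = L n powr (- a)"

primrec approx :: "nat \<Rightarrow> int^2 \<Rightarrow> real" where
  "approx 0 = (\<lambda>k. 0)"
| "approx (Suc n) = (\<lambda>k. approx n k + wave (ampl (Suc n)) (L (Suc n)) (resid \<kappa> \<gamma> (approx n)) k)"

abbreviation (input) W :: "nat \<Rightarrow> int^2 \<Rightarrow> real" where
  "W n \<equiv> wave (ampl (Suc n)) (L (Suc n)) (resid \<kappa> \<gamma> (approx n))"

lemma L_pos: "1 \<le> L n"
proof (induction n)
  case (Suc n)
  then show ?case using L_step[of n] by linarith
qed (rule L0)

lemma L_pos': "0 < real_of_int (L n)"
  using L_pos[of n] by simp

lemma L_exp: "2 ^ n \<le> real_of_int (L n)"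
proof (induction n)
  case 0
  then show ?case using L0 by simp
next
  case (Suc n)
  have "60 * real_of_int (L n) \<le> real_of_int (L (Suc n))"
    using L_step[of n] by linarith
  then show ?case using Suc L_pos'[of n] unfolding power_Suc by linarith
qed

lemma L_mono: "m \<le> n \<Longrightarrow> L m \<le> L n"
proof (rule lift_Suc_mono_le[of L])
  show "L n \<le> L (Suc n)" for n using L_step[of n] L_pos[of n] by linarith
qed

lemma L_exp': "2 ^ n \<le> real_of_int (L (Suc n))"
  by (rule order_trans[OF L_exp]) (simp add: L_mono)

lemma ampl_pos: "0 < ampl n"
  using L_pos'[of n] by (simp add: ampl_def)

lemma ampl_sq: "(ampl n)^2 = L n powr (- 2 * a)" "(ampl n)^2 * L n = L n powr (1 - 2 * a)"
proof -
  show *: "(ampl n)^2 = L n powr (- 2 * a)"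
    by (simp add: ampl_def power2_eq_square powr_add[symmetric])
  have "L n powr (1 - 2 * a) = L n powr (- 2 * a) * L n powr 1"
    unfolding powr_add[symmetric] by simp
  then show "(ampl n)^2 * L n = L n powr (1 - 2 * a)"
    using * by (simp add: abs_of_pos[OF L_pos'])
qed

lemma L_A: "L n * ampl n = L n powr (1 - a)"
proof -
  have "L n powr (1 - a) = L n powr 1 * L n powr (- a)" unfolding powr_add[symmetric] by simp
  then show ?thesis by (simp add: ampl_def abs_of_pos[OF L_pos'])
qed

text \<open>Everything the next step needs. The last two conditions are the quantitative ones: the
  gradient governs the cross terms, and the residual must be absorbable by the next wave.\<close>

lemma approx_invariant:
  "(\<forall>k. approx n k \<noteq> 0 \<longrightarrow> fnorm k \<le> 3 * real_of_int (L n)) \<and> (\<forall>k. approx n (- k) = approx n k) \<and> approx n 0 = 0 \<and>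
   grad_l1 (approx n) \<le> 24 * card dirs * L n powr (1 - a) \<and>
   l1 (resid \<kappa> \<gamma> (approx n)) \<le> (ampl (Suc n))^2 * L (Suc n)"
proof (induction n)
  case 0
  have "l1 (resid \<kappa> \<gamma> (\<lambda>k. 0)) = 0" by (simp add: l1_def pair_def resid_def Q_def)
  moreover have "grad_l1 (\<lambda>k. 0) = 0" by (simp add: grad_l1_def pair_def)
  ultimately show ?case using L_pos'[of "Suc 0"] by simp
next
  case (Suc n)
  let ?q = "resid \<kappa> \<gamma> (approx n)"
  have f: "fsup (approx n)" using Suc by (intro fsup_bounded[of _ "3 * real_of_int (L n)"]) auto
  have q: "?q 0 = 0" "\<And>p. ?q (- p) = ?q p" "\<And>p. ?q p \<noteq> 0 \<Longrightarrow> fnorm p \<le> 6 * real_of_int (L n)"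
    using Suc resid_support[of "approx n" "3 * real_of_int (L n)" \<kappa> \<gamma>] by (auto simp: resid_0 resid_even)
  \<comment> \<open>The quadratic term doubles the radius \<open>3 * L n\<close> of the spectrum;
    with the separation factor 10 of a single step this explains the 60 in
    \<open>L_step\<close>.\<close>
  have mu: "0 \<le> 6 * real_of_int (L n)" "10 * (6 * real_of_int (L n)) \<le> real_of_int (L (Suc n))"
    using L_pos[of n] L_step[of n] by linarith+
  have L': "0 < L (Suc n)" using L_pos[of "Suc n"] by simp
  have ql: "l1 ?q \<le> (ampl (Suc n))^2 * L (Suc n)" using Suc by simp
  note ctx = ampl_pos[of "Suc n"] L' q mu ql
  have ws: "2 * real_of_int (L (Suc n)) \<le> fnorm k" "fnorm k \<le> 3 * real_of_int (L (Suc n))" if "W n k \<noteq> 0" for k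
    using wave_support[OF ctx that] by auto
  have wf: "fsup (W n)" by (rule fsup_wave[OF ctx])
  have "fnorm k \<le> 3 * real_of_int (L (Suc n))" if "approx (Suc n) k \<noteq> 0" for k
  proof (cases "W n k = 0")
    case True
    then have "fnorm k \<le> 3 * real_of_int (L n)" using that Suc by simp
    then show ?thesis using L_mono[of n "Suc n"] by simp
  qed (rule ws)
  moreover have "approx (Suc n) (- k) = approx (Suc n) k" for k
    using Suc wave_even[OF ctx] by simp
  moreover have "W n 0 = 0" using ws(1)[of 0] L' by force
  then have "approx (Suc n) 0 = 0" using Suc by simp
  \<comment> \<open>The newest wave takes half of the bound, and \<open>L_double\<close> makes the
    whole old gradient fit into the other half.\<close>
  moreover have "grad_l1 (approx (Suc n)) \<le> 24 * card dirs * L (Suc n) powr (1 - a)"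
  proof -
    have "grad_l1 (approx (Suc n)) \<le> grad_l1 (approx n) + grad_l1 (W n)"
      unfolding grad_l1_def approx.simps by (intro pair_abs_add_le f wf) simp
    also have "grad_l1 (W n) \<le> 3 * real_of_int (L (Suc n)) * l1 (W n)"
      unfolding grad_l1_def pair_abs_const[symmetric] using ws(2) by (intro pair_abs_mono wf)
    also have "\<dots> \<le> 3 * real_of_int (L (Suc n)) * (4 * card dirs * ampl (Suc n))"
      using L' by (intro mult_left_mono wave_l1[OF ctx]) auto
    also have "\<dots> = 12 * card dirs * L (Suc n) powr (1 - a)"
      by (simp add: L_A[symmetric])
    also have "grad_l1 (approx n) \<le> 24 * card dirs * L n powr (1 - a)" using Suc by simp
    also have "\<dots> \<le> 12 * card dirs * L (Suc n) powr (1 - a)"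
      using mult_left_mono[OF L_double[of n], of "12 * real (card dirs)"] by simp
    finally show ?thesis by simp
  qed
  moreover have "l1 (resid \<kappa> \<gamma> (approx (Suc n))) \<le> (ampl (Suc (Suc n)))^2 * L (Suc (Suc n))"
  proof -
    have "l1 (resid \<kappa> \<gamma> (approx (Suc n))) \<le> (grad_l1 (approx n) + 3 * \<bar>\<kappa>\<bar> * L (Suc n) powr (\<gamma> - 1)) * (4 * card dirs * ampl (Suc n))
        + 96 * (card dirs)^2 * (6 * real_of_int (L n)) * (ampl (Suc n))^2"
      unfolding approx.simps using Suc by (intro resid_step[OF ampl_pos L' f _ q(3) mu ql ga]) auto
    also have "\<dots> \<le> (24 * card dirs * L n powr (1 - a) + 3 * \<bar>\<kappa>\<bar> * L (Suc n) powr (\<gamma> - 1)) * (4 * card dirs * ampl (Suc n))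
        + 96 * (card dirs)^2 * (6 * real_of_int (L n)) * (ampl (Suc n))^2"
      using Suc ampl_pos[of "Suc n"] by (intro add_right_mono mult_right_mono) auto
    also have "\<dots> \<le> L (Suc (Suc n)) powr (1 - 2 * a)"
      using L_err[of n] unfolding ampl_sq(1) by (simp add: ampl_def mult_ac)
    finally show ?thesis by (simp only: ampl_sq(2))
  qed
  ultimately show ?case by blast
qed

lemma approx_fsup: "fsup (approx n)"
  using approx_invariant[of n] by (intro fsup_bounded[of _ "3 * real_of_int (L n)"]) auto

lemma W_ctx:
  shows "0 < ampl (Suc n)" "0 < L (Suc n)" "resid \<kappa> \<gamma> (approx n) 0 = 0"
    "\<And>p. resid \<kappa> \<gamma> (approx n) (- p) = resid \<kappa> \<gamma> (approx n) p"
    "\<And>p. resid \<kappa> \<gamma> (approx n) p \<noteq> 0 \<Longrightarrow> fnorm p \<le> 6 * real_of_int (L n)"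
    "0 \<le> 6 * real_of_int (L n)" "10 * (6 * real_of_int (L n)) \<le> real_of_int (L (Suc n))"
    "l1 (resid \<kappa> \<gamma> (approx n)) \<le> (ampl (Suc n))^2 * L (Suc n)"
proof -
  show "10 * (6 * real_of_int (L n)) \<le> real_of_int (L (Suc n))"
    using L_step[of n] by linarith
  show "fnorm p \<le> 6 * real_of_int (L n)" if "resid \<kappa> \<gamma> (approx n) p \<noteq> 0" for p
    using approx_invariant[of n] resid_support[of "approx n" "3 * real_of_int (L n)", OF _ that] by auto
qed (use approx_invariant[of n] L_pos[of n] L_pos[of "Suc n"] ampl_pos[of "Suc n"] in \<open>auto simp: resid_0 resid_even\<close>)

lemma W_support:
  assumes "W n k \<noteq> 0"
  shows "2 * real_of_int (L (Suc n)) \<le> fnorm k" "fnorm k \<le> 3 * real_of_int (L (Suc n))"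
  using wave_support[OF W_ctx[where n = n], of k] assms by blast+

text \<open>All later waves live at frequencies of at least \<open>2 * L (Suc n)\<close>, so smaller
  modes are frozen.\<close>

lemma approx_stable:
  assumes "fnorm k < 2 * real_of_int (L (Suc n))" "n \<le> m"
  shows "approx m k = approx n k"
  using assms(2)
proof (induction m rule: dec_induct)
  case (step m)
  have "W m k = 0"
  proof (rule ccontr)
    assume "W m k \<noteq> 0"
    then have "2 * real_of_int (L (Suc m)) \<le> fnorm k" by (rule W_support)
    moreover have "L (Suc n) \<le> L (Suc m)" using step by (intro L_mono) auto
    ultimately show False using assms(1) by linarith
  qed
  then show ?case using step by simp
qed simp

text \<open>The pointwise limit, read off at a stage at which the mode is already frozen; the index
  is large enough because \<open>L n\<close> is at least \<open>2 ^ n\<close>.\<close>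

definition soln :: "int^2 \<Rightarrow> real" where
  "soln k = approx (nat \<lceil>fnorm k\<rceil>) k"

text \<open>Stage n fits into the ball of radius \<open>3 * L n\<close>, and the next annulus starts
  beyond it. So the approximations are sharp truncations of one family, and limits become limits of
  truncated sums.\<close>

lemma approx_eq_soln: "approx n k = (if fnorm k \<le> 3 * real_of_int (L n) then soln k else 0)"
proof (cases "fnorm k \<le> 3 * real_of_int (L n)")
  case True
  define j where "j = nat \<lceil>fnorm k\<rceil>"
  have "fnorm k \<le> real j" by (simp add: j_def real_nat_ceiling_ge)
  also have "real j < 2 * 2 ^ Suc j"
    using of_nat_less_two_power[of j, where 'a = real] unfolding power_Suc by linarith
  also have "\<dots> \<le> 2 * real_of_int (L (Suc j))" using L_exp[of "Suc j"] by simp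
  finally have j: "fnorm k < 2 * real_of_int (L (Suc j))" by simp
  have n: "fnorm k < 2 * real_of_int (L (Suc n))" using True L_step[of n] L_pos[of n] by linarith
  have "soln k = approx (max n j) k" unfolding soln_def j_def[symmetric] by (rule approx_stable[symmetric]) (use j in auto)
  also have "\<dots> = approx n k" by (rule approx_stable) (use n in auto)
  finally show ?thesis using True by simp
qed (use approx_invariant[of n] in auto)

lemma soln_even: "soln (- k) = soln k"
  using approx_invariant by (simp add: soln_def)

lemma soln_0: "soln 0 = 0"
  using approx_invariant by (simp add: soln_def)

text \<open>The spectrum can be pushed beyond any radius by the choice of \<open>L 0\<close>, which
  is how infinitely many solutions are told apart.\<close>

lemma soln_low: "fnorm k < 2 * real_of_int (L 1) \<Longrightarrow> soln k = 0"
  unfolding soln_def by (subst approx_stable[of k 0]) auto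

lemma soln_nonzero: "\<exists>k. soln k \<noteq> 0"
proof -
  let ?e = "vector [1, 2] :: int^2"
  have e: "?e \<in> dirs" by (simp add: dirs_def)
  have "approx 1 (smul (L 1) ?e) = ampl 1"
    using wave_pos[OF W_ctx[where n = 0] e] by simp
  then have "approx 1 (smul (L 1) ?e) \<noteq> 0" using ampl_pos[of 1] by simp
  then show ?thesis by (metis approx_eq_soln)
qed

text \<open>The wave of frequency \<open>L\<close> contributes a multiple of
  \<open>L powr \<beta> * L powr (- a)\<close>; as the frequencies grow at least like
  \<open>2 ^ n\<close>, these contributions are dominated by a geometric series.\<close>

lemma soln_summable:
  assumes "0 \<le> \<beta>" "\<beta> < a"
  shows "(\<lambda>k. fnorm k powr \<beta> * \<bar>soln k\<bar>) summable_on UNIV"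
proof -
  let ?H = "\<lambda>k. fnorm k powr \<beta>"
  define r where "r = 2 powr (\<beta> - a)"
  have "r < 2 powr 0" unfolding r_def using assms by (intro powr_less_mono) auto
  then have r: "0 < r" "r < 1" by (auto simp: r_def)
  define C where "C = 3 powr \<beta> * (4 * card dirs)"
  have C: "0 \<le> C" by (simp add: C_def)
  have step: "pair (\<lambda>k. \<bar>W n k\<bar>) ?H \<le> C * r ^ n" for n
  proof -
    let ?l = "real_of_int (L (Suc n))"
    have l: "0 < ?l" by (rule L_pos')
    have wf: "fsup (W n)" by (rule fsup_wave[OF W_ctx[where n = n]])
    have "pair (\<lambda>k. \<bar>W n k\<bar>) ?H \<le> (3 * ?l) powr \<beta> * l1 (W n)"
      unfolding pair_abs_const[symmetric]
    proof (rule pair_abs_mono[OF wf])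
      fix k assume "W n k \<noteq> 0"
      then have "fnorm k \<le> 3 * ?l" by (rule W_support)
      then show "?H k \<le> (3 * ?l) powr \<beta>" using assms by (intro powr_mono2) auto
    qed
    also have "\<dots> \<le> (3 * ?l) powr \<beta> * (4 * card dirs * ampl (Suc n))"
      by (intro mult_left_mono wave_l1[OF W_ctx[where n = n]]) auto
    also have "\<dots> = C * ?l powr (\<beta> - a)"
      using l by (simp add: C_def ampl_def powr_mult powr_diff powr_minus field_simps)
    also have "\<dots> \<le> C * r ^ n"
    proof (rule mult_left_mono[OF _ C])
      have "2 ^ n \<le> ?l" by (rule L_exp')
      then have "?l powr (\<beta> - a) \<le> (2 ^ n) powr (\<beta> - a)"
        using assms by (intro powr_mono2') auto
      also have "\<dots> = r ^ n"
        by (simp add: r_def powr_realpow[symmetric] powr_powr mult.commute)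
      finally show "?l powr (\<beta> - a) \<le> r ^ n" .
    qed
    finally show ?thesis .
  qed
  have Fb: "pair (\<lambda>k. \<bar>approx n k\<bar>) ?H \<le> (\<Sum>j<n. C * r ^ j)" for n
  proof (induction n)
    case 0
    then show ?case by (simp add: pair_def)
  next
    case (Suc n)
    have "pair (\<lambda>k. \<bar>approx (Suc n) k\<bar>) ?H \<le> pair (\<lambda>k. \<bar>approx n k\<bar>) ?H + pair (\<lambda>k. \<bar>W n k\<bar>) ?H"
      unfolding approx.simps by (intro pair_abs_add_le approx_fsup fsup_wave[OF W_ctx[where n = n]]) (assumption, rule powr_ge_zero)
    then show ?case using Suc step[of n] by simp
  qed
  have geo: "(\<Sum>j<n. C * r ^ j) \<le> C / (1 - r)" for n
  proof -
    have "(\<Sum>j<n. r ^ j) = (1 - r ^ n) / (1 - r)" using r by (simp add: sum_gp_strict)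
    also have "\<dots> \<le> 1 / (1 - r)" using r by (intro divide_right_mono) auto
    finally show ?thesis
      using mult_left_mono[OF _ C, of "\<Sum>j<n. r ^ j" "1 / (1 - r)"] by (simp add: sum_distrib_left)
  qed
  show ?thesis
  proof (rule nonneg_bdd_above_summable_on)
    show "bdd_above (sum (\<lambda>k. ?H k * \<bar>soln k\<bar>) ` {X. X \<subseteq> UNIV \<and> finite X})"
    proof (rule bdd_aboveI2)
      fix X :: "(int^2) set" assume "X \<in> {X. X \<subseteq> UNIV \<and> finite X}"
      then have X: "finite X" by simp
      obtain R where R: "\<And>k. k \<in> X \<Longrightarrow> fnorm k \<le> R"
        using X by (meson finite_imageI bdd_above_finite bdd_above.E imageI)
      obtain n where n: "R \<le> 2 ^ n"
        using real_arch_pow[of 2 R] by (auto intro: less_imp_le)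
      have Xn: "fnorm k \<le> 3 * real_of_int (L n)" if "k \<in> X" for k
        using R[OF that] n L_exp[of n] L_pos'[of n] by linarith
      have "(\<Sum>k\<in>X. ?H k * \<bar>soln k\<bar>) = (\<Sum>k\<in>X. \<bar>approx n k\<bar> * ?H k)"
        using Xn by (intro sum.cong) (auto simp: approx_eq_soln)
      also have "\<dots> \<le> (\<Sum>k\<in>X \<union> {k. approx n k \<noteq> 0}. \<bar>approx n k\<bar> * ?H k)"
        using X approx_fsup[of n] by (intro sum_mono2) (auto simp: fsup_def)
      also have "\<dots> = pair (\<lambda>k. \<bar>approx n k\<bar>) ?H"
        using X approx_fsup[of n] by (intro pair_sum[symmetric]) (auto simp: fsup_def)
      also have "\<dots> \<le> C / (1 - r)" using Fb[of n] geo[of n] by linarith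
      finally show "(\<Sum>k\<in>X. ?H k * \<bar>soln k\<bar>) \<le> C / (1 - r)" .
    qed
  qed simp
qed

lemma soln_half_summable: "(\<lambda>k. sqrt (fnorm k) * \<bar>soln k\<bar>) summable_on UNIV"
  using soln_summable[of "1/2"] a by (simp add: powr_half_sqrt)

text \<open>The residual coefficients of the approximations have two limits: the residual of
  \<open>soln\<close>, by absolute convergence of the quadratic sum, and 0, by the invariant and a >
  1/2.\<close>

lemma resid_soln: "resid \<kappa> \<gamma> (soln) p = 0"
proof -
  define T where "T k = soln k * (sig k (p - k) * soln (p - k))" for k
  \<comment> \<open>Both factors of the quadratic term are truncated, so both k and p - k are
    restricted; these finite sets still exhaust the lattice.\<close>
  define X where "X n = {k. fnorm k \<le> 3 * real_of_int (L n)} \<inter> {k. fnorm (p - k) \<le> 3 * real_of_int (L n)}" for n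
  have large: "\<forall>\<^sub>F n in sequentially. R \<le> 3 * real_of_int (L n)" for R
  proof -
    obtain N where N: "R \<le> 2 ^ N" using real_arch_pow[of 2 R] by (auto intro: less_imp_le)
    have "R \<le> 3 * real_of_int (L n)" if "N \<le> n" for n
    proof -
      have "(2::real) ^ N \<le> 2 ^ n" using that by (intro power_increasing) auto
      then show ?thesis using N L_exp[of n] L_pos'[of n] by linarith
    qed
    then show ?thesis by (auto simp: eventually_sequentially)
  qed
  have "T summable_on UNIV"
    unfolding T_def by (rule sig_prod_summable[OF soln_half_summable])
  then have "(T has_sum infsum T UNIV) UNIV" by (rule has_sum_infsum)
  then have "(sum T \<longlongrightarrow> infsum T UNIV) (finite_subsets_at_top UNIV)" by (simp add: has_sum_def)
  moreover have "filterlim X (finite_subsets_at_top UNIV) sequentially"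
    unfolding filterlim_finite_subsets_at_top
  proof (intro allI impI)
    fix Y :: "(int^2) set" assume Y: "finite Y \<and> Y \<subseteq> UNIV"
    have "\<forall>\<^sub>F n in sequentially. \<forall>k\<in>Y. k \<in> X n"
      using Y eventually_conj[OF large large]
      by (subst eventually_ball_finite_distrib) (auto simp: X_def)
    then show "\<forall>\<^sub>F n in sequentially. finite (X n) \<and> Y \<subseteq> X n \<and> X n \<subseteq> UNIV"
      by eventually_elim (auto simp: X_def finite_fnorm_le)
  qed
  ultimately have T_lim: "(\<lambda>n. sum T (X n)) \<longlonglongrightarrow> infsum T UNIV"
    by (rule filterlim_compose)
  have QF: "Q (approx n) (approx n) p = 1/2 * sum T (X n)" for n
  proof -
    have "pair (approx n) (\<lambda>k. sig k (p - k) * approx n (p - k)) = infsum T (X n)"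
      unfolding pair_def T_def
      by (rule infsum_cong_neutral) (auto simp: approx_eq_soln X_def)
    moreover have "finite (X n)" by (simp add: X_def finite_fnorm_le)
    ultimately show ?thesis by (simp add: Q_def)
  qed
  have approx_lim: "(\<lambda>n. approx n p) \<longlonglongrightarrow> soln p"
    by (intro tendsto_eventually eventually_mono[OF large[of "fnorm p"]]) (simp add: approx_eq_soln)
  have "(\<lambda>n. resid \<kappa> \<gamma> (approx n) p) \<longlonglongrightarrow> 1/2 * infsum T UNIV + \<kappa> * fnorm p powr (\<gamma> - 1) * soln p"
    unfolding resid_def QF by (intro tendsto_intros T_lim approx_lim)
  moreover have "1/2 * infsum T UNIV = Q soln soln p" by (simp add: Q_def pair_def T_def[abs_def])
  ultimately have lim1: "(\<lambda>n. resid \<kappa> \<gamma> (approx n) p) \<longlonglongrightarrow> resid \<kappa> \<gamma> soln p"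
    by (simp add: resid_def)
  have "(\<lambda>n. resid \<kappa> \<gamma> (approx n) p) \<longlonglongrightarrow> 0"
  proof (rule Lim_null_comparison)
    show "\<forall>\<^sub>F n in sequentially. norm (resid \<kappa> \<gamma> (approx n) p) \<le> (2 powr (1 - 2 * a)) ^ n"
    proof (intro always_eventually allI)
      fix n
      let ?r = "resid \<kappa> \<gamma> (approx n)"
      have fs: "fsup ?r" by (intro fsup_resid approx_fsup)
      have "\<bar>?r p\<bar> \<le> l1 ?r"
      proof (cases "?r p = 0")
        case False
        have "l1 ?r = (\<Sum>k | ?r k \<noteq> 0. \<bar>?r k\<bar>)"
          using fs unfolding l1_def by (subst pair_sum[of "{k. ?r k \<noteq> 0}"]) (auto simp: fsup_def)
        then show ?thesis
          using fs False member_le_sum[of p "{k. ?r k \<noteq> 0}" "\<lambda>k. \<bar>?r k\<bar>"] by (auto simp: fsup_def)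
      qed simp
      also have "\<dots> \<le> L (Suc n) powr (1 - 2 * a)"
        using approx_invariant[of n] unfolding ampl_sq(2) by blast
      also have "\<dots> \<le> (2 ^ n) powr (1 - 2 * a)"
      proof (rule powr_mono2')
        show "2 ^ n \<le> real_of_int (L (Suc n))"
          by (rule L_exp')
      qed (use a in auto)
      also have "\<dots> = (2 powr (1 - 2 * a)) ^ n"
        by (simp add: powr_realpow[symmetric] powr_powr mult.commute)
      finally show "norm (?r p) \<le> (2 powr (1 - 2 * a)) ^ n" by simp
    qed
    have "2 powr (1 - 2 * a) < 2 powr 0" using a by (intro powr_less_mono) auto
    then show "(\<lambda>n. (2 powr (1 - 2 * a)) ^ n) \<longlonglongrightarrow> 0"
      by (intro LIMSEQ_power_zero) auto
  qed
  with lim1 show ?thesis by (rule LIMSEQ_unique)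
qed

end

section \<open>Choice of the frequencies\<close>

lemma eventually_powr_le_1:
  assumes "e < (0::real)"
  shows "\<forall>\<^sub>F x in at_top. K * x powr e \<le> 1"
proof -
  have "((\<lambda>x. K * x powr e) \<longlongrightarrow> K * 0) at_top"
    by (intro tendsto_mult tendsto_const tendsto_neg_powr assms filterlim_ident)
  then have "\<forall>\<^sub>F x in at_top. K * x powr e < 1"
    by (rule order_tendstoD) simp
  then show ?thesis by (rule eventually_mono) simp
qed

lemma powr_le_split:
  fixes x :: real
  assumes "0 < x" "K * x powr (d - e) \<le> 1"
  shows "K * x powr d \<le> x powr e"
proof -
  have "K * x powr d = (K * x powr (d - e)) * x powr e"
    using assms(1) by (simp add: powr_diff)
  also have "\<dots> \<le> 1 * x powr e" using assms by (intro mult_right_mono) auto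
  finally show ?thesis by simp
qed

text \<open>Once b is fixed, every requirement is a constant times a negative power of the
  frequency, hence holds from some \<open>X\<close> on. The starting frequency stays free above
  \<open>X\<close>, so that the spectrum can begin arbitrarily far out.\<close>

lemma admissible_frequencies:
  fixes a \<gamma> \<kappa> :: real
  assumes a: "1/2 < a" "a < 2/3" "a < 2 - \<gamma>" and ga: "0 < \<gamma>"
  shows "\<exists>X. \<forall>N::int. X \<le> real_of_int N \<longrightarrow> (\<exists>L. L 0 = N \<and> frequency_sequence \<kappa> \<gamma> a L)"
proof -
  define C where "C = real (card dirs)"
  have C: "0 \<le> C" by (simp add: C_def)
  \<comment> \<open>The two entries exceed 1 exactly when a < 2/3 and a < 2 - \<gamma>. The first
    makes \<open>e3\<close> and \<open>e5\<close> negative, the second \<open>e4\<close>.\<close>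
  define B where "B = min ((1 - a) / (2 * a - 1)) ((1 + a - \<gamma>) / (2 * a - 1))"
  have "1 < B" unfolding B_def using a by simp
  then obtain b where b: "1 < b" "b < B" using dense by blast
  have b1: "b * (2 * a - 1) < 1 - a" and b2: "b * (2 * a - 1) < 1 + a - \<gamma>"
    using b(2) a by (simp_all add: B_def field_simps)
  \<comment> \<open>With y for the middle one of three frequencies, the previous is about
    \<open>y powr (1 / b)\<close> and the next about \<open>y powr b\<close>. The three exponents
    are those of the cross term, the dissipation and the self-interaction error, each relative to
    the permitted residual.\<close>
  define e3 where "e3 = (1 - a) / b - a - b * (1 - 2 * a)"
  define e4 where "e4 = \<gamma> - 1 - a - b * (1 - 2 * a)"
  define e5 where "e5 = 1 / b - 2 * a - b * (1 - 2 * a)"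
  have "e3 * b = (b - 1) * (b * (2 * a - 1) - (1 - a))"
    using b by (simp add: e3_def field_simps)
  also have "\<dots> < 0" using b b1 by (intro mult_pos_neg) auto
  finally have e3: "e3 < 0" using b by (simp add: mult_less_0_iff)
  have e4: "e4 < 0" using b2 by (simp add: e4_def algebra_simps)
  have "e5 * b = (b - 1) * (b * (2 * a - 1) - 1)"
    using b by (simp add: e5_def field_simps)
  also have "\<dots> < 0" using b b1 a by (intro mult_pos_neg) auto
  finally have e5: "e5 < 0" using b by (simp add: mult_less_0_iff)
  have "\<forall>\<^sub>F x in at_top. 1 \<le> x \<and> 60 * x powr (1 - b) \<le> 1 \<and> 2 * x powr ((1 - a) - b * (1 - a)) \<le> 1 \<and>
     6 * (96 * C^2) * x powr e3 \<le> 1 \<and> 6 * (12 * C * \<bar>\<kappa>\<bar>) * x powr e4 \<le> 1 \<and> 6 * (576 * C^2) * x powr e5 \<le> 1"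
    using b a e3 e4 e5
    by (intro eventually_conj eventually_powr_le_1 eventually_ge_at_top) (auto simp: mult_less_cancel_right1)
  then obtain X where X: "\<And>x. X \<le> x \<Longrightarrow> 1 \<le> x" "\<And>x. X \<le> x \<Longrightarrow> 60 * x powr (1 - b) \<le> 1"
     "\<And>x. X \<le> x \<Longrightarrow> 2 * x powr ((1 - a) - b * (1 - a)) \<le> 1"
     "\<And>x. X \<le> x \<Longrightarrow> 6 * (96 * C^2) * x powr e3 \<le> 1"
     "\<And>x. X \<le> x \<Longrightarrow> 6 * (12 * C * \<bar>\<kappa>\<bar>) * x powr e4 \<le> 1"
     "\<And>x. X \<le> x \<Longrightarrow> 6 * (576 * C^2) * x powr e5 \<le> 1"
    unfolding eventually_at_top_linorder by blast
  show ?thesis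
  proof (intro exI[of _ X] allI impI)
    fix N :: int assume N: "X \<le> real_of_int N"
    define L where "L = rec_nat N (\<lambda>_ l. \<lceil>real_of_int l powr b\<rceil>)"
    have L0: "L 0 = N" and LS: "L (Suc n) = \<lceil>real_of_int (L n) powr b\<rceil>" for n
      by (simp_all add: L_def)
    have LX: "X \<le> L n" for n
    proof (induction n)
      case (Suc n)
      have "real_of_int (L n) powr 1 \<le> real_of_int (L n) powr b"
        using X(1)[OF Suc] b by (intro powr_mono) auto
      also have "\<dots> \<le> L (Suc n)" unfolding LS by (rule le_of_int_ceiling)
      finally show ?case using Suc X(1)[OF Suc] by simp
    qed (simp add: L0 N)
    have L1: "1 \<le> real_of_int (L n)" for n using X(1)[OF LX] .
    have lo: "real_of_int (L n) powr b \<le> L (Suc n)" for n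
      unfolding LS by (rule le_of_int_ceiling)
    have hi: "L (Suc n) \<le> 2 * real_of_int (L n) powr b" for n
    proof -
      have "1 \<le> real_of_int (L n) powr b" using L1[of n] b by (intro ge_one_powr_ge_zero) auto
      then show ?thesis unfolding LS using of_int_ceiling_le_add_one[of "real_of_int (L n) powr b"] by linarith
    qed
    have step: "60 * real_of_int (L n) \<le> real_of_int (L (Suc n))" for n
    proof -
      have "60 * real_of_int (L n) powr 1 \<le> real_of_int (L n) powr b"
        using X(2)[OF LX[of n]] L1[of n] by (intro powr_le_split) auto
      then show ?thesis using L1[of n] lo[of n] by simp
    qed
    have double: "2 * L n powr (1 - a) \<le> L (Suc n) powr (1 - a)" for n
    proof -
      have "2 * L n powr (1 - a) \<le> L n powr (b * (1 - a))"
        using X(3)[OF LX[of n]] L1[of n] by (intro powr_le_split) auto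
      also have "\<dots> = (L n powr b) powr (1 - a)" by (simp add: powr_powr)
      also have "\<dots> \<le> L (Suc n) powr (1 - a)" using lo[of n] a by (intro powr_mono2) auto
      finally show ?thesis .
    qed
    have err: "(24 * C * L n powr (1 - a) + 3 * \<bar>\<kappa>\<bar> * L (Suc n) powr (\<gamma> - 1)) * (4 * C * L (Suc n) powr (- a))
        + 576 * C^2 * real_of_int (L n) * L (Suc n) powr (- 2 * a) \<le> L (Suc (Suc n)) powr (1 - 2 * a)" for n
    proof -
      define x where "x = real_of_int (L n)"
      define y where "y = real_of_int (L (Suc n))"
      define z where "z = real_of_int (L (Suc (Suc n)))"
      have pos: "0 < x" "0 < y" "0 < z" using L1[of n] L1[of "Suc n"] L1[of "Suc (Suc n)"] by (auto simp: x_def y_def z_def)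
      have yX: "X \<le> y" using LX[of "Suc n"] by (simp add: y_def)
      have xy: "x \<le> y powr (1 / b)"
      proof -
        have "x = (x powr b) powr (1 / b)" using pos b by (simp add: powr_powr)
        also have "\<dots> \<le> y powr (1 / b)" using lo[of n] b by (intro powr_mono2) (auto simp: x_def y_def)
        finally show ?thesis .
      qed
      \<comment> \<open>Rounding up at most doubles the frequency, and an exponent above -1 turns
        this into a loss of at most 1/2. Hence each of the three errors is allowed 1/6.\<close>
      have zy: "1/2 * y powr (b * (1 - 2 * a)) \<le> z powr (1 - 2 * a)"
      proof -
        have "2 powr (-1) \<le> 2 powr (1 - 2 * a)" using a by (intro powr_mono) auto
        then have "1/2 * y powr (b * (1 - 2 * a)) \<le> 2 powr (1 - 2 * a) * y powr (b * (1 - 2 * a))"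
          by (intro mult_right_mono) (auto simp: powr_minus)
        also have "\<dots> = (2 * y powr b) powr (1 - 2 * a)" using pos by (simp add: powr_mult powr_powr)
        also have "\<dots> \<le> z powr (1 - 2 * a)"
          using hi[of "Suc n"] a pos by (intro powr_mono2') (auto simp: y_def z_def)
        finally show ?thesis .
      qed
      let ?R = "y powr (b * (1 - 2 * a))"
      have "24 * C * x powr (1 - a) * (4 * C * y powr (- a)) \<le> 24 * C * y powr ((1 - a) / b) * (4 * C * y powr (- a))"
      proof (intro mult_right_mono mult_left_mono)
        have "x powr (1 - a) \<le> (y powr (1 / b)) powr (1 - a)"
          using xy a pos by (intro powr_mono2) auto
        then show "x powr (1 - a) \<le> y powr ((1 - a) / b)" by (simp add: powr_powr)
      qed (use C in auto)
      also have "\<dots> = 96 * C^2 * y powr ((1 - a) / b - a)"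
        by (simp add: powr_diff powr_minus power2_eq_square divide_inverse)
      finally have T1: "24 * C * x powr (1 - a) * (4 * C * y powr (- a)) \<le> 1/6 * ?R"
        using powr_le_split[OF pos(2), of "6 * (96 * C^2)" "(1 - a) / b - a" "b * (1 - 2 * a)"] X(4)[OF yX]
        by (simp add: e3_def)
      have "3 * \<bar>\<kappa>\<bar> * y powr (\<gamma> - 1) * (4 * C * y powr (- a)) = 12 * C * \<bar>\<kappa>\<bar> * y powr (\<gamma> - 1 - a)"
        by (simp add: powr_diff powr_minus divide_inverse)
      then have T2: "3 * \<bar>\<kappa>\<bar> * y powr (\<gamma> - 1) * (4 * C * y powr (- a)) \<le> 1/6 * ?R"
        using powr_le_split[OF pos(2), of "6 * (12 * C * \<bar>\<kappa>\<bar>)" "\<gamma> - 1 - a" "b * (1 - 2 * a)"] X(5)[OF yX]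
        unfolding e4_def by linarith
      have "576 * C^2 * x * y powr (- 2 * a) \<le> 576 * C^2 * y powr (1 / b) * y powr (- 2 * a)"
        by (intro mult_right_mono mult_left_mono xy) (use C in auto)
      also have "\<dots> = 576 * C^2 * y powr (1 / b - 2 * a)"
        by (simp add: powr_diff powr_minus divide_inverse)
      finally have T3: "576 * C^2 * x * y powr (- 2 * a) \<le> 1/6 * ?R"
        using powr_le_split[OF pos(2), of "6 * (576 * C^2)" "1 / b - 2 * a" "b * (1 - 2 * a)"] X(6)[OF yX]
        by (simp add: e5_def)
      have "(24 * C * x powr (1 - a) + 3 * \<bar>\<kappa>\<bar> * y powr (\<gamma> - 1)) * (4 * C * y powr (- a)) + 576 * C^2 * x * y powr (- 2 * a)
          \<le> 1/2 * ?R"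
        using T1 T2 T3 unfolding distrib_right by linarith
      then show ?thesis using zy unfolding x_def y_def z_def by linarith
    qed
    have "frequency_sequence \<kappa> \<gamma> a L"
    proof
      show "60 * L n \<le> L (Suc n)" for n using step[of n] by linarith
      show "1 \<le> L 0" using L1[of 0] by simp
    qed (use ga a double err in \<open>simp_all add: C_def\<close>)
    then show "\<exists>L. L 0 = N \<and> frequency_sequence \<kappa> \<gamma> a L" using L0 by blast
  qed
qed

theorem fourier_solution:
  fixes \<kappa> \<gamma> \<alpha> R :: real
  assumes "0 < \<gamma>" "\<gamma> < 3/2" "1/2 \<le> \<alpha>" "\<alpha> < 1/2 + min (1/6) (3/2 - \<gamma>)"
  obtains c :: "int^2 \<Rightarrow> real" where
    "\<And>k. c (- k) = c k" "\<And>k. fnorm k \<le> R \<Longrightarrow> c k = 0" "c 0 = 0" "\<exists>k. c k \<noteq> 0"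
    "(\<lambda>k. fnorm k powr \<alpha> * \<bar>c k\<bar>) summable_on UNIV"
    "(\<lambda>k. sqrt (fnorm k) * \<bar>c k\<bar>) summable_on UNIV"
    "\<And>p. Q c c p = - \<kappa> * fnorm p powr (\<gamma> - 1) * c p"
proof -
  \<comment> \<open>The bound in the theorem is the same number, since 2/3 = 1/2 + 1/6 and 2 -
    \<gamma> = 1/2 + (3/2 - \<gamma>). The gap between \<alpha> and a pays for summability.\<close>
  have "\<alpha> < min (2/3) (2 - \<gamma>)" using assms by auto
  then obtain a where \<alpha>a: "\<alpha> < a" "a < min (2/3) (2 - \<gamma>)" using dense by blast
  obtain X where X: "\<And>N::int. X \<le> real_of_int N \<Longrightarrow> \<exists>L. L 0 = N \<and> frequency_sequence \<kappa> \<gamma> a L"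
    using admissible_frequencies[of a \<gamma> \<kappa>] \<alpha>a assms by auto
  define N where "N = max \<lceil>X\<rceil> \<lceil>R\<rceil>"
  have N: "X \<le> real_of_int N" "R \<le> real_of_int N"
    by (rule order_trans[OF le_of_int_ceiling], simp add: N_def)+
  obtain L where L: "L 0 = N" "frequency_sequence \<kappa> \<gamma> a L"
    using X[OF N(1)] by blast
  interpret frequency_sequence \<kappa> \<gamma> a L by (rule L)
  have low: "soln k = 0" if "fnorm k \<le> R" for k
    by (rule soln_low) (use that N(2) L(1) L0 L_step[of 0] in simp)
  have eq: "Q soln soln p = - \<kappa> * fnorm p powr (\<gamma> - 1) * soln p" for p
    using resid_soln[of p] by (simp add: resid_def)
  show ?thesis
    by (rule that[OF soln_even low soln_0 soln_nonzero soln_summable soln_half_summable eq])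
       (use assms(3) \<alpha>a in auto)
qed

section \<open>Test functions and integration on the torus\<close>

lemma smooth_differentiable: "smooth f \<Longrightarrow> f differentiable (at x)"
  unfolding smooth_def by (metis partials.simps(1))

lemma partials_append: "partials js (partial j f) = partials (js @ [j]) f"
  by (induction js) auto

lemma smooth_partial: "smooth f \<Longrightarrow> smooth (partial j f)"
  unfolding smooth_def by (simp add: partials_append)

lemma smooth_partials: "smooth f \<Longrightarrow> smooth (partials js f)"
  by (induction js) (auto simp: smooth_partial)

lemma smooth_continuous: "smooth f \<Longrightarrow> continuous_on S f"
  by (meson continuous_at_imp_continuous_on differentiable_imp_continuous_within smooth_differentiable)

lemma smooth_has_derivative: "smooth f \<Longrightarrow> (f has_derivative frechet_derivative f (at x)) (at x)"
  using smooth_differentiable frechet_derivative_works by blast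

lemma partial_eq: "(f has_derivative D) (at x) \<Longrightarrow> partial j f x = D (axis j 1)"
  unfolding partial_def using frechet_derivative_at by metis

lemma partial_lincomb:
  assumes "f differentiable (at x)" "g differentiable (at x)"
  shows "partial j (\<lambda>x. a * f x + b * g x) x = a * partial j f x + b * partial j g x"
proof -
  have "((\<lambda>x. a * f x + b * g x) has_derivative
      (\<lambda>h. a * frechet_derivative f (at x) h + b * frechet_derivative g (at x) h)) (at x)"
    by (intro derivative_intros) (use assms frechet_derivative_works in blast)+
  then show ?thesis by (subst partial_eq) (auto simp: partial_def)
qed

lemma partial_mult:
  assumes "f differentiable (at x)" "g differentiable (at x)"
  shows "partial j (\<lambda>x. f x * g x) x = f x * partial j g x + partial j f x * g x"
proof -
  have "((\<lambda>x. f x * g x) has_derivative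
      (\<lambda>h. f x * frechet_derivative g (at x) h + frechet_derivative f (at x) h * g x)) (at x)"
    by (intro derivative_intros) (use assms frechet_derivative_works in blast)+
  then show ?thesis by (subst partial_eq) (auto simp: partial_def)
qed

lemma partials_lincomb:
  assumes "smooth f" "smooth g"
  shows "partials js (\<lambda>x. a * f x + b * g x) = (\<lambda>x. a * partials js f x + b * partials js g x)"
proof (induction js)
  case (Cons j js)
  show ?case
    unfolding partials.simps Cons
    by (rule ext, rule partial_lincomb) (use smooth_differentiable smooth_partials assms in blast)+
qed simp

lemma smooth_lincomb:
  assumes "smooth f" "smooth g"
  shows "smooth (\<lambda>x. a * f x + b * g x)"
  unfolding smooth_def partials_lincomb[OF assms] 
  by (intro allI derivative_intros) (use smooth_differentiable smooth_partials assms in blast)+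

text \<open>A class containing the product and closed under differentiation by the product rule; it
  replaces an explicit Leibniz formula for iterated derivatives.\<close>

inductive_set prod_class :: "(real^2 \<Rightarrow> real) \<Rightarrow> (real^2 \<Rightarrow> real) \<Rightarrow> (real^2 \<Rightarrow> real) set"
  for f g where
  prod: "(\<lambda>x. partials js f x * partials js' g x) \<in> prod_class f g"
| add: "u \<in> prod_class f g \<Longrightarrow> v \<in> prod_class f g \<Longrightarrow> (\<lambda>x. u x + v x) \<in> prod_class f g"

lemma prod_class_partial:
  assumes "smooth f" "smooth g" "h \<in> prod_class f g"
  shows "(\<forall>x. h differentiable (at x)) \<and> (\<forall>j. partial j h \<in> prod_class f g)"
  using assms(3)
proof induction
  case (prod js js')
  have d: "partials js f differentiable (at x)" "partials js' g differentiable (at x)" for x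
    using assms smooth_differentiable smooth_partials by blast+
  have "partial j (\<lambda>x. partials js f x * partials js' g x)
      = (\<lambda>x. partials js f x * partials (j # js') g x + partials (j # js) f x * partials js' g x)" for j
    by (rule ext) (simp add: partial_mult d)
  moreover have "\<dots> j \<in> prod_class f g" for j
    by (intro prod_class.intros)
  ultimately show ?case using d by (auto intro: derivative_intros)
next
  case (add u v)
  have "partial j (\<lambda>x. u x + v x) = (\<lambda>x. partial j u x + partial j v x)" for j
    using partial_lincomb[of u _ v j 1 1] add by auto
  then show ?case using add by (auto intro: derivative_intros prod_class.add)
qed

lemma smooth_mult:
  assumes "smooth f" "smooth g"
  shows "smooth (\<lambda>x. f x * g x)"
proof -
  have "partials js (\<lambda>x. f x * g x) \<in> prod_class f g" for js
  proof (induction js)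
    case Nil
    show ?case using prod_class.prod[of "[]" f "[]" g] by simp
  next
    case (Cons j js)
    then show ?case using prod_class_partial[OF assms] by simp
  qed
  then show ?thesis unfolding smooth_def using prod_class_partial[OF assms] by blast
qed

lemma partial_trig:
  "partial j (\<lambda>x. a * cos (x \<bullet> v) + b * sin (x \<bullet> v)) x = (b * v $ j) * cos (x \<bullet> v) + (- a * v $ j) * sin (x \<bullet> v)"
  by (subst partial_eq, (rule derivative_eq_intros refl)+) (simp add: inner_axis' algebra_simps)

lemma smooth_trig: "smooth (\<lambda>x. a * cos (x \<bullet> v) + b * sin (x \<bullet> v))"
proof -
  have "\<exists>a' b'. partials js (\<lambda>x. a * cos (x \<bullet> v) + b * sin (x \<bullet> v)) = (\<lambda>x. a' * cos (x \<bullet> v) + b' * sin (x \<bullet> v))" for js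
  proof (induction js)
    case (Cons j js)
    then obtain a' b' where eq: "partials js (\<lambda>x. a * cos (x \<bullet> v) + b * sin (x \<bullet> v)) = (\<lambda>x. a' * cos (x \<bullet> v) + b' * sin (x \<bullet> v))"
      by blast
    show ?case unfolding partials.simps eq
      by (rule exI[of _ "b' * v $ j"], rule exI[of _ "- a' * v $ j"]) (simp add: partial_trig fun_eq_iff)
  qed auto
  moreover have "(\<lambda>x. a' * cos (x \<bullet> v) + b' * sin (x \<bullet> v)) differentiable (at x)" for a' b' x
    unfolding differentiable_def by (rule exI) (rule derivative_eq_intros refl)+
  ultimately show ?thesis unfolding smooth_def by metis
qed

lemma periodic_partial: "periodic f \<Longrightarrow> smooth f \<Longrightarrow> periodic (partial j f)"
  unfolding periodic_def
proof (intro allI)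
  fix x i assume p: "\<forall>x j. f (x + axis j (2 * pi)) = f x" and s: "smooth f"
  let ?t = "axis i (2 * pi) :: real^2"
  have "((\<lambda>y. f (y + ?t)) has_derivative (\<lambda>h. frechet_derivative f (at (x + ?t)) h)) (at x)"
    by (rule has_derivative_compose[of "\<lambda>y. y + ?t" "\<lambda>h. h" x UNIV f "frechet_derivative f (at (x + ?t))"])
       (auto intro!: derivative_eq_intros smooth_has_derivative[OF s])
  then have "(f has_derivative frechet_derivative f (at (x + ?t))) (at x)" using p by simp
  then show "partial j f (x + ?t) = partial j f x"
    by (subst partial_eq[of f _ x]) (auto simp: partial_def)
qed

lemma inner_axis_freq: "axis j (2 * pi) \<bullet> freq k = 2 * pi * real_of_int (k $ j)"
  by (simp add: inner_axis' freq_def)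

lemma periodic_trig: "periodic (\<lambda>x. a * cos (x \<bullet> freq k) + b * sin (x \<bullet> freq k))"
proof -
  have "cos (y + 2 * pi * real_of_int n) = cos y" "sin (y + 2 * pi * real_of_int n) = sin y" for y n
    by (simp_all add: cos_add sin_add cos_int_2pin sin_int_2pin)
  then show ?thesis unfolding periodic_def by (simp add: inner_add_left inner_axis_freq)
qed

lemma trig_test: "(\<lambda>x. a * cos (x \<bullet> freq k) + b * sin (x \<bullet> freq k)) \<in> test_functions"
  by (simp add: test_functions_def smooth_trig periodic_trig)

lemma cos_test: "(\<lambda>x. cos (x \<bullet> freq k)) \<in> test_functions"
  and sin_test: "(\<lambda>x. sin (x \<bullet> freq k)) \<in> test_functions"
  using trig_test[of 1 k 0] trig_test[of 0 k 1] by simp_all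

lemma test_lincomb:
  "f \<in> test_functions \<Longrightarrow> g \<in> test_functions \<Longrightarrow> (\<lambda>x. a * f x + b * g x) \<in> test_functions"
  by (simp add: test_functions_def smooth_lincomb periodic_def)

lemma test_mult: "f \<in> test_functions \<Longrightarrow> g \<in> test_functions \<Longrightarrow> (\<lambda>x. f x * g x) \<in> test_functions"
  by (simp add: test_functions_def smooth_mult periodic_def)

lemma test_partial: "f \<in> test_functions \<Longrightarrow> partial j f \<in> test_functions"
  by (simp add: test_functions_def smooth_partial periodic_partial)

lemma test_partials: "f \<in> test_functions \<Longrightarrow> partials js f \<in> test_functions"
  by (induction js) (auto simp: test_partial)

lemma test_const: "(\<lambda>x. a) \<in> test_functions"
  using trig_test[of a 0 0] by simp

lemma test_sum:
  "finite F \<Longrightarrow> (\<And>k. k \<in> F \<Longrightarrow> f k \<in> test_functions) \<Longrightarrow> (\<lambda>x. \<Sum>k\<in>F. f k x) \<in> test_functions"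
proof (induction F rule: finite_induct)
  case (insert k F)
  then show ?case using test_lincomb[of "f k" "\<lambda>x. \<Sum>k\<in>F. f k x" 1 1] by simp
qed (simp add: test_const)

lemma test_continuous: "f \<in> test_functions \<Longrightarrow> continuous_on S f"
  by (simp add: test_functions_def smooth_continuous)

lemma axis_0 [simp]: "axis j 0 = 0"
  by (simp add: axis_def vec_eq_iff)

lemma shift_int:
  fixes f :: "real^2 \<Rightarrow> 'b"
  assumes p: "\<And>x j. f (x + axis j (2 * pi)) = f x"
  shows "f (x + axis j (2 * pi * real_of_int n)) = f x"
proof -
  have a: "axis j (2 * pi * real_of_int (i + 1)) = (axis j (2 * pi * real_of_int i) :: real^2) + axis j (2 * pi)" for i
    by (simp add: axis_def vec_eq_iff algebra_simps)
  show ?thesis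
  proof (induction n arbitrary: x rule: int_induct[of _ 0])
    case (step1 i)
    have "f (x + axis j (2 * pi * real_of_int (i + 1))) = f (x + axis j (2 * pi * real_of_int i))"
      by (simp only: a add.assoc[symmetric] p)
    then show ?case using step1 by simp
  next
    case (step2 i)
    have "f (x + axis j (2 * pi * real_of_int (i - 1))) = f (x + axis j (2 * pi * real_of_int (i - 1)) + axis j (2 * pi))"
      by (simp only: p)
    also have "\<dots> = f (x + axis j (2 * pi * real_of_int i))"
      by (simp only: add.assoc a[symmetric] diff_add_cancel)
    finally show ?case using step2 by simp
  qed simp
qed

lemma periodic_torus:
  assumes "periodic f"
  obtains y where "y \<in> torus" "f y = f x"
proof -
  have 1: "\<exists>n::int. - pi \<le> t + 2 * pi * n \<and> t + 2 * pi * n \<le> pi" for t :: real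
  proof -
    let ?n = "- \<lfloor>(t + pi) / (2 * pi)\<rfloor>"
    have "of_int \<lfloor>(t + pi) / (2 * pi)\<rfloor> * (2 * pi) \<le> t + pi"
      by (rule floor_divide_lower) simp
    moreover have "t + pi < (of_int \<lfloor>(t + pi) / (2 * pi)\<rfloor> + 1) * (2 * pi)"
      by (rule floor_divide_upper) simp
    ultimately show ?thesis by (intro exI[of _ ?n]) (simp add: algebra_simps)
  qed
  obtain n m :: int where n: "- pi \<le> x $ 1 + 2 * pi * n" "x $ 1 + 2 * pi * n \<le> pi"
    and m: "- pi \<le> x $ 2 + 2 * pi * m" "x $ 2 + 2 * pi * m \<le> pi"
    using 1[of "x $ 1"] 1[of "x $ 2"] by blast
  let ?y = "x + axis 1 (2 * pi * real_of_int n) + axis 2 (2 * pi * real_of_int m)"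
  have "?y \<in> torus" using n m by (simp add: torus_def mem_box_cart forall_2 axis_def)
  moreover have "f ?y = f x" using assms by (simp add: periodic_def shift_int)
  ultimately show ?thesis using that by blast
qed

lemma compact_torus [simp]: "compact torus"
  by (simp add: torus_def)

lemma periodic_bounded:
  assumes "continuous_on UNIV f" "periodic f"
  obtains B where "\<And>x. \<bar>f x\<bar> \<le> B" "0 \<le> B"
proof -
  have "bounded (f ` torus)"
    by (intro compact_imp_bounded compact_continuous_image) (auto intro: continuous_on_subset assms)
  then obtain B where B: "\<And>y. y \<in> torus \<Longrightarrow> \<bar>f y\<bar> \<le> B" by (auto simp: bounded_iff)
  have "\<bar>f x\<bar> \<le> B" for x
    using periodic_torus[OF assms(2), of x] B by metis
  then show ?thesis using that[of B] by (smt (verit))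
qed

lemma integrable_torus: "continuous_on UNIV f \<Longrightarrow> integrable (lebesgue_on torus) f"
  for f :: "real^2 \<Rightarrow> 'b::euclidean_space"
  unfolding torus_def by (rule continuous_imp_integrable) (rule continuous_on_subset, auto)

lemma torus_lebesgue [simp]: "torus \<in> sets lebesgue"
  by (simp add: torus_def)

lemma measure_torus: "measure (lebesgue_on torus) torus = (2 * pi)^2"
proof -
  have "measure (lebesgue_on torus) torus = measure lebesgue torus"
    by (simp add: measure_restrict_space space_restrict_space)
  also have "\<dots> = (2 * pi)^2"
    unfolding torus_def by (simp add: content_cbox_if_cart interval_eq_empty_cart power2_eq_square) 
  finally show ?thesis .
qed

lemma torus_integral_const [simp]: "torus_integral (\<lambda>x. a) = (2 * pi)^2 * a"
  unfolding torus_integral_def by (simp add: measure_torus)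

lemma torus_integral_eq_integral: "continuous_on UNIV f \<Longrightarrow> torus_integral f = integral torus f"
  unfolding torus_integral_def by (intro lebesgue_integral_eq_integral integrable_torus) auto

text \<open>Cut the translated cell where the j-th coordinate equals pi. The part beyond is a full
  period away from the part of the original cell that the translation has left; \<open>M\<close> and
  \<open>M'\<close> are the corners of the two pieces.\<close>

lemma integral_torus_translate:
  assumes f: "continuous_on UNIV f" "periodic f" and h: "0 \<le> h" "h \<le> 2 * pi"
  shows "integral torus (\<lambda>x. f (x + axis j h)) = integral torus f"
proof -
  let ?a = "\<chi> i. - pi :: real^2" and ?b = "\<chi> i. pi :: real^2"
  let ?p = "axis j (2 * pi) :: real^2"
  have int: "f integrable_on cbox u v" for u v
    by (rule integrable_continuous) (rule continuous_on_subset[OF f(1)], auto)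
  have per: "f (x + ?p) = f x" for x using f(2) by (simp add: periodic_def)
  have inner: "x \<bullet> axis j 1 = x $ j" for x :: "real^2" by (simp add: inner_axis)
  define M where "M = (\<chi> i. if i = j then - pi + h else - pi :: real^2)"
  define M' where "M' = (\<chi> i. if i = j then - pi + h else pi :: real^2)"
  have "integral torus (\<lambda>x. f (x + axis j h)) = integral (cbox (?a + axis j h) (?b + axis j h)) f"
    using integral_shift_cbox_plus[of ?a ?b f "axis j h"] by (simp add: torus_def o_def add.commute)
  also have "\<dots> = integral (cbox M ?b) f + integral (cbox (?a + ?p) (M' + ?p)) f"
  proof -
    have k: "axis j 1 \<in> (Basis :: (real^2) set)" by (simp add: axis_in_Basis_iff)
    have "cbox (?a + axis j h) (?b + axis j h) \<inter> {x. x \<bullet> axis j 1 \<le> pi} = cbox M ?b"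
      "cbox (?a + axis j h) (?b + axis j h) \<inter> {x. x \<bullet> axis j 1 \<ge> pi} = cbox (?a + ?p) (M' + ?p)"
      unfolding inner using h exhaust_2[of j] by (auto simp: set_eq_iff mem_box_cart M_def M'_def axis_def forall_2)
    then show ?thesis using integral_split[OF int k, of _ _ pi] by metis
  qed
  also have "integral (cbox (?a + ?p) (M' + ?p)) f = integral (cbox ?a M') f"
    using integral_shift_cbox_plus[of ?a M' f ?p] per by (simp add: o_def add.commute)
  also have "integral (cbox M ?b) f + integral (cbox ?a M') f = integral torus f"
  proof -
    have k: "axis j 1 \<in> (Basis :: (real^2) set)" by (simp add: axis_in_Basis_iff)
    have "cbox ?a ?b \<inter> {x. x \<bullet> axis j 1 \<le> - pi + h} = cbox ?a M'"
      "cbox ?a ?b \<inter> {x. x \<bullet> axis j 1 \<ge> - pi + h} = cbox M ?b"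
      unfolding inner using h exhaust_2[of j] by (auto simp: set_eq_iff mem_box_cart M_def M'_def axis_def forall_2)
    then show ?thesis using integral_split[OF int k, of ?a ?b "- pi + h"] by (simp add: torus_def)
  qed
  finally show ?thesis .
qed

text \<open>The derivative of the constant function \<open>h \<mapsto> \<integral> f (x + h e\<^sub>j) dx\<close> at \<open>0\<close>.\<close>

lemma torus_integral_partial:
  assumes f: "f \<in> test_functions"
  shows "torus_integral (partial j f) = 0"
proof -
  have s: "smooth f" and p: "periodic f" using f by (auto simp: test_functions_def)
  have cf: "continuous_on UNIV f" and cp: "continuous_on UNIV (partial j f)"
    using f test_partial[OF f] test_continuous by blast+
  \<comment> \<open>A one-sided derivative suffices, because it is unique at an end point of a
    nondegenerate interval; only translations with h between 0 and 1 are then needed.\<close>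
  have D: "((\<lambda>h. integral torus (\<lambda>x. f (x + axis j h))) has_vector_derivative
      integral torus (\<lambda>x. partial j f (x + axis j 0))) (at 0 within cbox 0 1)"
    unfolding torus_def
  proof (rule leibniz_rule_vector_derivative)
    fix h x
    have "((\<lambda>h. f (x + axis j h)) has_derivative (\<lambda>d. frechet_derivative f (at (x + axis j h)) (axis j d))) (at h within cbox 0 1)"
    proof (rule has_derivative_compose[of "\<lambda>h. x + axis j h" _ h _ f])
      have "(\<lambda>h. x + axis j h) = (\<lambda>h. x + h *\<^sub>R axis j 1)" "axis j = (\<lambda>d. d *\<^sub>R (axis j 1 :: real^2))"
        by (auto simp: axis_def vec_eq_iff fun_eq_iff)
      then show "((\<lambda>h. x + axis j h) has_derivative axis j) (at h within cbox 0 1)"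
        by (auto intro!: derivative_eq_intros)
    qed (rule smooth_has_derivative[OF s])
    moreover have "frechet_derivative f (at (x + axis j h)) (axis j d) = d *\<^sub>R partial j f (x + axis j h)" for d
    proof -
      have "axis j d = d *\<^sub>R (axis j 1 :: real^2)" by (auto simp: axis_def vec_eq_iff)
      moreover have "linear (frechet_derivative f (at (x + axis j h)))"
        using smooth_has_derivative[OF s] has_derivative_linear by blast
      ultimately show ?thesis by (simp add: linear_cmul partial_def)
    qed
    ultimately show "((\<lambda>h. f (x + axis j h)) has_vector_derivative partial j f (x + axis j h)) (at h within cbox 0 1)"
      by (simp add: has_vector_derivative_def)
  next
    fix h :: real
    show "(\<lambda>x. f (x + axis j h)) integrable_on cbox (\<chi> i. - pi) (\<chi> i. pi)"
      by (intro integrable_continuous continuous_on_compose2[OF cf] continuous_intros) auto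
  next
    have "continuous_on UNIV (\<lambda>h::real. axis j h :: real^2)"
      by (rule linear_continuous_on) (auto simp: axis_def vec_eq_iff intro!: linear_linear[THEN iffD2] linearI)
    then have "continuous_on (cbox 0 1 \<times> cbox (\<chi> i. - pi) (\<chi> i. pi)) (\<lambda>z. partial j f (snd z + axis j (fst z)))"
      by (intro continuous_on_compose2[OF cp] continuous_intros)
         (auto intro!: continuous_on_compose2[of UNIV "axis j"] continuous_intros)
    then show "continuous_on (cbox 0 1 \<times> cbox (\<chi> i. - pi) (\<chi> i. pi)) (\<lambda>(h, x). partial j f (x + axis j h))"
      by (simp add: case_prod_unfold)
  qed auto
  have c: "integral torus (\<lambda>x. f (x + axis j h)) = integral torus f" if "h \<in> cbox 0 1" for h
    using that pi_ge_two by (intro integral_torus_translate cf p) auto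
  have "((\<lambda>h. integral torus f) has_vector_derivative 0) (at 0 within cbox (0::real) 1)" by simp
  then have "((\<lambda>h. integral torus (\<lambda>x. f (x + axis j h))) has_vector_derivative 0) (at 0 within cbox 0 1)"
    by (rule has_vector_derivative_transform[rotated 2]) (use c in auto)
  then have "integral torus (\<lambda>x. partial j f (x + axis j 0)) = 0"
    by (intro vector_derivative_unique_within_closed_interval[OF _ _ D]) auto
  then show ?thesis using torus_integral_eq_integral[OF cp] by simp
qed

section \<open>Fourier series\<close>

definition expi :: "int^2 \<Rightarrow> real^2 \<Rightarrow> complex" where
  "expi k x = cis (x \<bullet> freq k)"

definition cint :: "(real^2 \<Rightarrow> complex) \<Rightarrow> complex" where
  "cint g = integral\<^sup>L (lebesgue_on torus) g"

definition fc :: "(real^2 \<Rightarrow> complex) \<Rightarrow> int^2 \<Rightarrow> complex" where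
  "fc f k = cint (\<lambda>x. f x * expi (- k) x) / (2 * of_real pi)^2"

lemma expi_simps [simp]: "expi 0 x = 1" "cmod (expi k x) = 1" "cnj (expi k x) = expi (- k) x"
  "expi k x * expi m x = expi (k + m) x"
  by (simp_all add: expi_def cis_cnj cis_mult inner_add_right)

lemma continuous_expi: "continuous_on S (expi k)"
proof -
  have "expi k = (\<lambda>x. exp (\<i> * complex_of_real (x \<bullet> freq k)))"
    by (simp add: expi_def cis_conv_exp fun_eq_iff)
  then show ?thesis by (simp only:) (intro continuous_intros)
qed

lemma expi_periodic: "expi k (x + axis j (2 * pi)) = expi k x"
  by (simp add: expi_def inner_add_left inner_axis_freq cis_mult[symmetric] cis_multiple_2pi)

lemma cint_integrable: "continuous_on UNIV g \<Longrightarrow> integrable (lebesgue_on torus) g"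
  for g :: "real^2 \<Rightarrow> complex"
  by (rule integrable_torus)

lemma cint_add: "continuous_on UNIV f \<Longrightarrow> continuous_on UNIV g \<Longrightarrow> cint (\<lambda>x. f x + g x) = cint f + cint g"
  unfolding cint_def by (intro Bochner_Integration.integral_add cint_integrable)

lemma cint_diff: "continuous_on UNIV f \<Longrightarrow> continuous_on UNIV g \<Longrightarrow> cint (\<lambda>x. f x - g x) = cint f - cint g"
  unfolding cint_def by (intro Bochner_Integration.integral_diff cint_integrable)

lemma cint_cmult: "cint (\<lambda>x. a * f x) = a * cint f"
  unfolding cint_def by simp

lemma cint_sum:
  "(\<And>k. k \<in> F \<Longrightarrow> continuous_on UNIV (f k)) \<Longrightarrow> cint (\<lambda>x. \<Sum>k\<in>F. f k x) = (\<Sum>k\<in>F. cint (f k))"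
  unfolding cint_def by (intro Bochner_Integration.integral_sum cint_integrable)

lemma cint_bound:
  assumes "continuous_on UNIV f" "\<And>x. x \<in> torus \<Longrightarrow> cmod (f x) \<le> B"
  shows "cmod (cint f) \<le> (2 * pi)^2 * B"
proof -
  have "cmod (cint f) \<le> (\<integral>x. norm (f x) \<partial>lebesgue_on torus)"
    unfolding cint_def by (rule integral_norm_bound)
  also have "\<dots> \<le> (\<integral>x. B \<partial>lebesgue_on torus)"
  proof (rule integral_mono)
    show "integrable (lebesgue_on torus) (\<lambda>x. norm (f x))" by (intro integrable_norm integrable_torus assms)
    show "integrable (lebesgue_on torus) (\<lambda>x. B)" by (intro integrable_torus) simp
  qed (use assms in \<open>auto simp: space_restrict_space\<close>)
  also have "\<dots> = (2 * pi)^2 * B" by (simp add: measure_torus)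
  finally show ?thesis .
qed

lemma cint_Complex:
  "continuous_on UNIV g \<Longrightarrow> cint g = Complex (torus_integral (\<lambda>x. Re (g x))) (torus_integral (\<lambda>x. Im (g x)))"
  using cint_integrable[of g] by (simp add: complex_eq_iff cint_def torus_integral_def)

lemma cint_of_real: "cint (\<lambda>x. of_real (f x)) = of_real (torus_integral f)"
  by (simp add: cint_def torus_integral_def)

lemma partial_cos_sin:
  "partial j (\<lambda>x. cos (x \<bullet> freq k)) = (\<lambda>x. - real_of_int (k $ j) * sin (x \<bullet> freq k))"
  "partial j (\<lambda>x. sin (x \<bullet> freq k)) = (\<lambda>x. real_of_int (k $ j) * cos (x \<bullet> freq k))"
  using partial_trig[of j 1 "freq k" 0] partial_trig[of j 0 "freq k" 1] by (simp_all add: fun_eq_iff freq_def)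

text \<open>For nonzero k some component is nonzero, and sine and cosine are then derivatives of
  test functions up to that factor, so their integrals vanish.\<close>

lemma cint_expi: "cint (expi k) = (if k = 0 then (2 * of_real pi)^2 else 0)"
proof (cases "k = 0")
  case True
  then have "cint (expi k) = cint (\<lambda>x. of_real 1)" by (intro arg_cong[of _ _ cint] ext) simp
  also have "\<dots> = (2 * of_real pi)^2" unfolding cint_of_real by simp
  finally show ?thesis using True by simp
next
  case False
  then obtain j where j: "k $ j \<noteq> 0" by (auto simp: vec_eq_iff)
  have "torus_integral (\<lambda>x. - real_of_int (k $ j) * sin (x \<bullet> freq k)) = 0"
    "torus_integral (\<lambda>x. real_of_int (k $ j) * cos (x \<bullet> freq k)) = 0"
    using torus_integral_partial[OF cos_test, of j k] torus_integral_partial[OF sin_test, of j k]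
    by (simp_all only: partial_cos_sin)
  then have "torus_integral (\<lambda>x. sin (x \<bullet> freq k)) = 0" "torus_integral (\<lambda>x. cos (x \<bullet> freq k)) = 0"
    using j by (simp_all add: torus_integral_def)
  then show ?thesis using False cint_Complex[OF continuous_expi, of k] by (simp add: expi_def complex_eq_iff)
qed

lemma fc_add: "continuous_on UNIV f \<Longrightarrow> continuous_on UNIV g \<Longrightarrow> fc (\<lambda>x. a * f x + b * g x) k = a * fc f k + b * fc g k"
proof -
  assume c: "continuous_on UNIV f" "continuous_on UNIV g"
  have "cint (\<lambda>x. (a * f x + b * g x) * expi (- k) x) = cint (\<lambda>x. a * (f x * expi (- k) x) + b * (g x * expi (- k) x))"
    by (simp add: algebra_simps)
  also have "\<dots> = a * cint (\<lambda>x. f x * expi (- k) x) + b * cint (\<lambda>x. g x * expi (- k) x)"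
    by (subst cint_add) (auto intro!: continuous_intros c continuous_expi simp: cint_cmult)
  finally show ?thesis by (simp add: fc_def add_divide_distrib)
qed

lemma fc_expi_mult: "fc (\<lambda>x. expi m x * g x) k = fc g (k - m)"
proof -
  have "expi m x * g x * expi (- k) x = g x * expi (- (k - m)) x" for x
    by (simp add: mult.assoc mult.left_commute[of "expi m x"])
  then show ?thesis unfolding fc_def by (simp only:)
qed

lemma fc_expi: "fc (expi m) k = (if k = m then 1 else 0)"
  using cint_expi[of "m - k"] by (simp add: fc_def)

lemma fc_bound:
  assumes "continuous_on UNIV f" "\<And>x. x \<in> torus \<Longrightarrow> cmod (f x) \<le> B"
  shows "cmod (fc f k) \<le> B"
proof -
  have "cmod (cint (\<lambda>x. f x * expi (- k) x)) \<le> (2 * pi)^2 * B"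
    by (rule cint_bound) (auto intro!: continuous_intros assms continuous_expi simp: norm_mult)
  then show ?thesis
    by (simp add: fc_def norm_divide norm_power divide_le_eq mult.commute)
qed

abbreviation rfc :: "(real^2 \<Rightarrow> real) \<Rightarrow> int^2 \<Rightarrow> complex" where
  "rfc \<psi> \<equiv> fc (\<lambda>x. complex_of_real (\<psi> x))"

lemma continuous_of_real_test: "\<psi> \<in> test_functions \<Longrightarrow> continuous_on S (\<lambda>x. complex_of_real (\<psi> x))"
  by (intro continuous_intros test_continuous)

lemma rfc_Complex:
  assumes "continuous_on UNIV \<psi>"
  shows "rfc \<psi> k = Complex (torus_integral (\<lambda>x. \<psi> x * cos (x \<bullet> freq k)))
     (- torus_integral (\<lambda>x. \<psi> x * sin (x \<bullet> freq k))) / (2 * of_real pi)^2"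
  unfolding fc_def
  by (subst cint_Complex) (auto intro!: continuous_intros assms continuous_expi simp: expi_def torus_integral_def)

lemma rfc_minus: "continuous_on UNIV \<psi> \<Longrightarrow> rfc \<psi> (- k) = cnj (rfc \<psi> k)"
  by (simp add: rfc_Complex complex_eq_iff torus_integral_def)

lemma torus_integral_by_parts:
  assumes f: "f \<in> test_functions" and g: "g \<in> test_functions"
  shows "torus_integral (\<lambda>x. partial j f x * g x) = - torus_integral (\<lambda>x. f x * partial j g x)"
proof -
  have "partial j (\<lambda>x. f x * g x) = (\<lambda>x. f x * partial j g x + partial j f x * g x)"
    using f g by (intro ext partial_mult smooth_differentiable) (auto simp: test_functions_def)
  then have "torus_integral (\<lambda>x. f x * partial j g x + partial j f x * g x) = 0"
    using torus_integral_partial[OF test_mult[OF f g], of j] by simp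
  moreover have "torus_integral (\<lambda>x. f x * partial j g x + partial j f x * g x)
     = torus_integral (\<lambda>x. f x * partial j g x) + torus_integral (\<lambda>x. partial j f x * g x)"
    unfolding torus_integral_def
    by (intro Bochner_Integration.integral_add integrable_torus test_continuous test_mult test_partial f g)
  ultimately show ?thesis by simp
qed

lemma torus_integral_cmult: "torus_integral (\<lambda>x. f x * (c * g x)) = c * torus_integral (\<lambda>x. f x * g x)"
  by (simp add: torus_integral_def mult.left_commute[of _ c])

lemma rfc_partial:
  assumes "\<psi> \<in> test_functions"
  shows "rfc (partial j \<psi>) k = \<i> * of_int (k $ j) * rfc \<psi> k"
proof -
  have "torus_integral (\<lambda>x. partial j \<psi> x * cos (x \<bullet> freq k)) = real_of_int (k $ j) * torus_integral (\<lambda>x. \<psi> x * sin (x \<bullet> freq k))"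
    "torus_integral (\<lambda>x. partial j \<psi> x * sin (x \<bullet> freq k)) = - real_of_int (k $ j) * torus_integral (\<lambda>x. \<psi> x * cos (x \<bullet> freq k))"
    using torus_integral_by_parts[OF assms cos_test, of j k] torus_integral_by_parts[OF assms sin_test, of j k]
    unfolding partial_cos_sin torus_integral_cmult by simp_all
  then show ?thesis
    using assms by (simp add: rfc_Complex test_continuous test_partial complex_eq_iff)
qed

lemma rfc_partials_le:
  assumes "\<psi> \<in> test_functions"
  shows "cmod (rfc (partials js \<psi>) k) \<le> fnorm k ^ length js * cmod (rfc \<psi> k)"
proof (induction js)
  case (Cons j js)
  have "cmod (rfc (partials (j # js) \<psi>) k) = \<bar>real_of_int (k $ j)\<bar> * cmod (rfc (partials js \<psi>) k)"
    using rfc_partial[OF test_partials[OF assms], of j js k] by (simp add: norm_mult)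
  also have "\<dots> \<le> fnorm k * (fnorm k ^ length js * cmod (rfc \<psi> k))"
    by (intro mult_mono fnorm_component Cons) auto
  finally show ?case by (simp add: mult.assoc)
qed simp

lemma rfc_replicate:
  assumes "\<psi> \<in> test_functions"
  shows "cmod (rfc (partials (replicate n j) \<psi>) k) = \<bar>real_of_int (k $ j)\<bar> ^ n * cmod (rfc \<psi> k)"
proof (induction n)
  case (Suc n)
  then show ?case
    using rfc_partial[OF test_partials[OF assms], of j "replicate n j" k] by (simp add: norm_mult)
qed simp

text \<open>Never zero, unlike \<open>fnorm\<close>, so it may be divided by; and submultiplicative,
  which lets growth bounds pass through convolutions.\<close>

definition wt :: "int^2 \<Rightarrow> real" where
  "wt k = 1 + fnorm k"

lemma wt_ge_1 [simp]: "1 \<le> wt k" and wt_pos [simp]: "0 < wt k" and wt_nonneg [simp]: "0 \<le> wt k"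
  and wt_minus [simp]: "wt (- k) = wt k"
  using fnorm_nonneg[of k] by (auto simp: wt_def intro: add_pos_nonneg)

lemma wt_mult: "wt (k + m) \<le> wt k * wt m"
proof -
  have "wt k * wt m = 1 + fnorm k + fnorm m + fnorm k * fnorm m" by (simp add: wt_def algebra_simps)
  then show ?thesis
    using fnorm_triangle[of k m] mult_nonneg_nonneg[OF fnorm_nonneg[of k] fnorm_nonneg[of m]]
    unfolding wt_def by linarith
qed

text \<open>Differentiate n times along the coordinate in which k is largest: \<open>wt k\<close> is
  at most three times the maximum of 1 and the two components.\<close>

lemma rfc_decay:
  assumes "\<psi> \<in> test_functions" "\<And>js x. length js \<le> n \<Longrightarrow> \<bar>partials js \<psi> x\<bar> \<le> B"
  shows "wt k ^ n * cmod (rfc \<psi> k) \<le> 3 ^ n * B"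
proof -
  have b: "\<bar>real_of_int (k $ j)\<bar> ^ n * cmod (rfc \<psi> k) \<le> B" for j
    unfolding rfc_replicate[OF assms(1), symmetric]
    by (intro fc_bound continuous_of_real_test test_partials assms(1)) (simp add: assms(2))
  have b0: "1 ^ n * cmod (rfc \<psi> k) \<le> B"
    using fc_bound[OF continuous_of_real_test[OF assms(1)], of B k] assms(2)[of "[]"] by simp
  obtain M where M: "wt k \<le> 3 * M" "0 \<le> M" "M ^ n * cmod (rfc \<psi> k) \<le> B"
  proof -
    have "(fnorm k)^2 \<le> (\<bar>real_of_int (k $ 1)\<bar> + \<bar>real_of_int (k $ 2)\<bar>)^2"
      unfolding fnorm_sq by (simp add: power2_sum)
    then have f: "fnorm k \<le> \<bar>real_of_int (k $ 1)\<bar> + \<bar>real_of_int (k $ 2)\<bar>"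
      by (rule power2_le_imp_le) simp
    consider "\<bar>real_of_int (k $ 1)\<bar> \<le> 1 \<and> \<bar>real_of_int (k $ 2)\<bar> \<le> 1" | "1 \<le> \<bar>real_of_int (k $ 1)\<bar> \<and> \<bar>real_of_int (k $ 2)\<bar> \<le> \<bar>real_of_int (k $ 1)\<bar>"
      | "1 \<le> \<bar>real_of_int (k $ 2)\<bar> \<and> \<bar>real_of_int (k $ 1)\<bar> \<le> \<bar>real_of_int (k $ 2)\<bar>" by linarith
    then show ?thesis
    proof cases
      case 1 then show ?thesis using that[of 1] b0 f by (simp add: wt_def)
    next
      case 2 then show ?thesis using that[of "\<bar>real_of_int (k $ 1)\<bar>"] b f by (simp add: wt_def)
    next
      case 3 then show ?thesis using that[of "\<bar>real_of_int (k $ 2)\<bar>"] b f by (simp add: wt_def)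
    qed
  qed
  have "wt k ^ n * cmod (rfc \<psi> k) \<le> (3 * M) ^ n * cmod (rfc \<psi> k)"
    by (intro mult_right_mono power_mono M) auto
  also have "\<dots> = 3 ^ n * (M ^ n * cmod (rfc \<psi> k))" by (simp add: power_mult_distrib)
  also have "\<dots> \<le> 3 ^ n * B" by (intro mult_left_mono M) auto
  finally show ?thesis .
qed

lemma summable_int_square: "(\<lambda>i::int. 1 / (1 + \<bar>real_of_int i\<bar>)^2) summable_on UNIV"
proof -
  have "summable (\<lambda>n. 1 / (1 + real n)^2)"
    using summable_Suc_iff[of "\<lambda>n. inverse (real n ^ 2)"] inverse_power_summable[of 2, where 'a = real]
    by (simp add: inverse_eq_divide add.commute)
  then have nat: "(\<lambda>n. 1 / (1 + real n)^2) summable_on UNIV"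
    by (intro norm_summable_imp_summable_on) simp
  have "(\<lambda>i::int. 1 / (1 + \<bar>real_of_int i\<bar>)^2) summable_on range int"
    by (subst summable_on_reindex) (auto simp: o_def intro: nat)
  moreover have "(\<lambda>i::int. 1 / (1 + \<bar>real_of_int i\<bar>)^2) summable_on range (\<lambda>n. - int n)"
    by (subst summable_on_reindex) (auto simp: o_def inj_def intro: nat)
  moreover have "range int \<union> range (\<lambda>n. - int n) = UNIV"
  proof -
    have "i \<in> range int \<union> range (\<lambda>n. - int n)" for i
      by (cases i rule: int_cases2) auto
    then show ?thesis by auto
  qed
  ultimately show ?thesis by (metis summable_on_union)
qed

text \<open>The fourth power leaves a square for each coordinate, and the sum is dominated by a
  product of two convergent one-dimensional series.\<close>

lemma summable_wt: "(\<lambda>k. 1 / wt k ^ 4) summable_on UNIV"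
proof (rule nonneg_bdd_above_summable_on)
  let ?g = "\<lambda>i::int. 1 / (1 + \<bar>real_of_int i\<bar>)^2"
  show "bdd_above (sum (\<lambda>k. 1 / wt k ^ 4) ` {F. F \<subseteq> UNIV \<and> finite F})"
  proof (rule bdd_aboveI2)
    fix F :: "(int^2) set" assume "F \<in> {F. F \<subseteq> UNIV \<and> finite F}"
    then have F: "finite F" by simp
    let ?A = "(\<lambda>k. k $ 1) ` F" and ?B = "(\<lambda>k. k $ 2) ` F"
    have "(\<Sum>k\<in>F. 1 / wt k ^ 4) \<le> (\<Sum>k\<in>F. ?g (k $ 1) * ?g (k $ 2))"
    proof (rule sum_mono)
      fix k :: "int^2"
      have "(1 + \<bar>real_of_int (k $ 1)\<bar>)^2 * (1 + \<bar>real_of_int (k $ 2)\<bar>)^2 \<le> wt k ^ 2 * wt k ^ 2"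
        unfolding wt_def by (intro mult_mono power_mono add_left_mono fnorm_component) auto
      also have "\<dots> = wt k ^ 4" by (simp flip: power_add)
      finally have "1 / wt k ^ 4 \<le> 1 / ((1 + \<bar>real_of_int (k $ 1)\<bar>)^2 * (1 + \<bar>real_of_int (k $ 2)\<bar>)^2)"
        by (intro divide_left_mono mult_pos_pos zero_less_power wt_pos) (auto simp: add_pos_nonneg)
      then show "1 / wt k ^ 4 \<le> ?g (k $ 1) * ?g (k $ 2)" by simp
    qed
    also have "\<dots> = (\<Sum>(a, b)\<in>(\<lambda>k. (k $ 1, k $ 2)) ` F. ?g a * ?g b)"
      by (subst sum.reindex) (auto simp: inj_on_def vec_eq_iff forall_2)
    also have "\<dots> \<le> (\<Sum>(a, b)\<in>?A \<times> ?B. ?g a * ?g b)"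
      using F by (intro sum_mono2) auto
    also have "\<dots> = sum ?g ?A * sum ?g ?B"
      by (simp add: sum_product sum.cartesian_product)
    also have "\<dots> \<le> infsum ?g UNIV * infsum ?g UNIV"
      using F by (intro mult_mono finite_sum_le_infsum summable_int_square sum_nonneg infsum_nonneg) auto
    finally show "(\<Sum>k\<in>F. 1 / wt k ^ 4) \<le> infsum ?g UNIV * infsum ?g UNIV" .
  qed
qed simp

lemma partials_bounded:
  assumes "\<psi> \<in> test_functions"
  obtains B where "\<And>js x. length js \<le> n \<Longrightarrow> \<bar>partials js \<psi> x\<bar> \<le> B" "0 \<le> B"
proof -
  have fin: "finite {js :: 2 list. length js \<le> n}"
    using finite_lists_length_le[of "UNIV :: 2 set" n] by simp
  have "\<exists>B. \<forall>x. \<bar>partials js \<psi> x\<bar> \<le> B" for js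
  proof -
    have "continuous_on UNIV (partials js \<psi>)" "periodic (partials js \<psi>)"
      using test_partials[OF assms, of js] by (auto simp: test_functions_def smooth_continuous)
    then show ?thesis by (metis periodic_bounded)
  qed
  then obtain b where b: "\<And>js x. \<bar>partials js \<psi> x\<bar> \<le> b js" by metis
  have "\<bar>partials js \<psi> x\<bar> \<le> (\<Sum>js | length js \<le> n. \<bar>b js\<bar>)" if "length js \<le> n" for js x
    by (rule order_trans[OF b], rule order_trans[OF abs_ge_self], rule member_le_sum) (use that fin in auto)
  then show ?thesis using that by (meson abs_ge_zero sum_nonneg)
qed

lemma rfc_rapid:
  assumes "\<psi> \<in> test_functions"
  shows "(\<lambda>k. wt k ^ n * cmod (rfc \<psi> k)) summable_on UNIV"
proof -
  obtain B where B: "\<And>js x. length js \<le> n + 4 \<Longrightarrow> \<bar>partials js \<psi> x\<bar> \<le> B"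
    using partials_bounded[OF assms, of "n + 4"] by metis
  have "(\<lambda>k. norm (wt k ^ n * cmod (rfc \<psi> k))) summable_on UNIV"
  proof (rule Infinite_Sum.abs_summable_on_comparison_test')
    show "(\<lambda>k. (3 ^ (n + 4) * B) * (1 / wt k ^ 4)) summable_on UNIV"
      by (rule summable_on_cmult_right[OF summable_wt])
    fix k
    have "wt k ^ n * cmod (rfc \<psi> k) = (wt k ^ (n + 4) * cmod (rfc \<psi> k)) * (1 / wt k ^ 4)"
      using less_imp_neq[OF wt_pos[of k]] by (simp add: power_add)
    also have "\<dots> \<le> (3 ^ (n + 4) * B) * (1 / wt k ^ 4)"
      by (intro mult_right_mono rfc_decay assms B) auto
    finally show "norm (wt k ^ n * cmod (rfc \<psi> k)) \<le> (3 ^ (n + 4) * B) * (1 / wt k ^ 4)"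
      by simp
  qed
  then show ?thesis by simp
qed

section \<open>Absolutely convergent Fourier series and inversion\<close>

definition ser :: "(int^2 \<Rightarrow> complex) \<Rightarrow> real^2 \<Rightarrow> complex" where
  "ser a x = (\<Sum>\<^sub>\<infinity>k. a k * expi k x)"

context
  fixes a :: "int^2 \<Rightarrow> complex"
  assumes a: "(\<lambda>k. cmod (a k)) summable_on UNIV"
begin

lemma ser_uniform:
  "uniform_limit UNIV (\<lambda>F x. \<Sum>k\<in>F. a k * expi k x) (ser a) (finite_subsets_at_top UNIV)"
  unfolding ser_def[abs_def] by (rule Weierstrass_m_test_general[OF _ a]) (simp add: norm_mult)

lemma ser_continuous: "continuous_on UNIV (ser a)"
  by (rule uniform_limit_theorem[OF _ ser_uniform])
     (auto intro!: always_eventually continuous_intros continuous_expi)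

lemma ser_has_sum: "((\<lambda>k. a k * expi k x) has_sum ser a x) UNIV"
proof -
  have "(\<lambda>k. norm (a k * expi k x)) summable_on UNIV" using a by (simp add: norm_mult)
  then show ?thesis unfolding ser_def by (rule has_sum_infsum[OF abs_summable_summable])
qed

lemma cint_ser:
  assumes g: "continuous_on UNIV g"
  shows "((\<lambda>k. a k * cint (\<lambda>x. expi k x * g x)) has_sum cint (\<lambda>x. ser a x * g x)) UNIV"
  unfolding has_sum_def
proof (rule tendstoI)
  fix e :: real assume e: "0 < e"
  have "bounded (g ` torus)"
    by (intro compact_imp_bounded compact_continuous_image continuous_on_subset[OF g]) auto
  then obtain B where B: "0 < B" "\<And>x. x \<in> torus \<Longrightarrow> cmod (g x) \<le> B"
    by (auto simp: bounded_pos)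
  define d where "d = e / (2 * ((2 * pi)^2 * B))"
  have d: "0 < d" using e B by (simp add: d_def)
  have "\<forall>\<^sub>F F in finite_subsets_at_top UNIV. \<forall>x\<in>UNIV. dist (\<Sum>k\<in>F. a k * expi k x) (ser a x) < d"
    using ser_uniform d by (rule uniform_limitD)
  moreover have "\<forall>\<^sub>F F in finite_subsets_at_top UNIV. finite (F :: (int^2) set)"
    by (simp add: eventually_finite_subsets_at_top_weakI)
  ultimately show "\<forall>\<^sub>F F in finite_subsets_at_top UNIV.
      dist (\<Sum>k\<in>F. a k * cint (\<lambda>x. expi k x * g x)) (cint (\<lambda>x. ser a x * g x)) < e"
  proof eventually_elim
    case (elim F)
    have "(\<Sum>k\<in>F. a k * cint (\<lambda>x. expi k x * g x)) = cint (\<lambda>x. \<Sum>k\<in>F. a k * (expi k x * g x))"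
      by (subst cint_sum) (auto intro!: continuous_intros continuous_expi g simp: cint_cmult)
    also have "\<dots> = cint (\<lambda>x. (\<Sum>k\<in>F. a k * expi k x) * g x)"
      by (simp add: sum_distrib_right mult.assoc)
    finally have "(\<Sum>k\<in>F. a k * cint (\<lambda>x. expi k x * g x)) - cint (\<lambda>x. ser a x * g x)
        = cint (\<lambda>x. (\<Sum>k\<in>F. a k * expi k x) * g x - ser a x * g x)"
      by (subst cint_diff) (auto intro!: continuous_intros continuous_expi g ser_continuous)
    also have "cmod \<dots> \<le> (2 * pi)^2 * (d * B)"
    proof (rule cint_bound)
      fix x assume x: "x \<in> torus"
      have "cmod ((\<Sum>k\<in>F. a k * expi k x) - ser a x) * cmod (g x) \<le> d * B"
        using elim(1)[THEN bspec, of x] x d by (intro mult_mono B) (simp_all add: dist_norm)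
      then show "cmod ((\<Sum>k\<in>F. a k * expi k x) * g x - ser a x * g x) \<le> d * B"
        by (simp only: norm_mult[symmetric] left_diff_distrib)
    qed (auto intro!: continuous_intros continuous_expi g ser_continuous)
    also have "\<dots> = e / 2" using B by (simp add: d_def)
    also have "\<dots> < e" using e by simp
    finally show ?case by (simp add: dist_norm)
  qed
qed

text \<open>Uniform convergence permits termwise integration, and multiplication by an exponential
  shifts coefficients; this is the convolution formula for products.\<close>

lemma fc_ser_mult:
  assumes g: "continuous_on UNIV g"
  shows "((\<lambda>m. a m * fc g (k - m)) has_sum fc (\<lambda>x. ser a x * g x) k) UNIV"
proof -
  have "((\<lambda>m. a m * cint (\<lambda>x. expi m x * (g x * expi (- k) x)) * (1 / (2 * of_real pi)^2))
      has_sum cint (\<lambda>x. ser a x * (g x * expi (- k) x)) * (1 / (2 * of_real pi)^2)) UNIV"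
    by (rule has_sum_cmult_left[OF cint_ser]) (intro continuous_intros g continuous_expi)
  moreover have "cint (\<lambda>x. expi m x * (g x * expi (- k) x)) * (1 / (2 * of_real pi)^2) = fc g (k - m)" for m
    using fc_expi_mult[of m g k] by (simp add: fc_def mult.assoc)
  ultimately show ?thesis by (simp add: fc_def mult.assoc)
qed

lemma fc_ser: "fc (ser a) k = a k"
proof -
  have 1: "fc (\<lambda>x. 1) j = (if j = 0 then 1 else 0)" for j
  proof -
    have "expi 0 = (\<lambda>x. 1)" by (rule ext) simp
    then show ?thesis using fc_expi[of 0 j] by (simp only:)
  qed
  have "((\<lambda>m. a m * fc (\<lambda>x. 1) (k - m)) has_sum fc (\<lambda>x. ser a x * 1) k) UNIV"
    by (rule fc_ser_mult) simp
  moreover have "((\<lambda>m. a m * fc (\<lambda>x. 1) (k - m)) has_sum a k) UNIV"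
    by (rule has_sum_finite_neutralI[of "{k}"]) (auto simp: 1)
  ultimately show ?thesis
    unfolding mult_1_right by (rule has_sum_unique)
qed

lemma ser_periodic: "ser a (x + axis j (2 * pi)) = ser a x"
  by (simp add: ser_def expi_periodic)

end

text \<open>This class is closed under multiplication by trigonometric polynomials, which are dense by
  Stone-Weierstrass; so its members are orthogonal to themselves.\<close>

definition null_fc :: "(real^2 \<Rightarrow> complex) \<Rightarrow> bool" where
  "null_fc h \<longleftrightarrow> continuous_on UNIV h \<and> (\<forall>k. fc h k = 0)"

lemma null_fc_lincomb: "null_fc f \<Longrightarrow> null_fc g \<Longrightarrow> null_fc (\<lambda>x. a * f x + b * g x)"
  unfolding null_fc_def by (auto intro!: continuous_intros simp: fc_add)

lemma null_fc_expi: "null_fc h \<Longrightarrow> null_fc (\<lambda>x. expi m x * h x)"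
  unfolding null_fc_def by (auto intro!: continuous_intros continuous_expi simp: fc_expi_mult)

text \<open>Realises the quotient torus as a compact subset of a finite-dimensional space, so that
  Stone-Weierstrass applies to periodic functions.\<close>

definition torus_map :: "real^2 \<Rightarrow> complex \<times> complex" where
  "torus_map x = (cis (x $ 1), cis (x $ 2))"

text \<open>In the linear case, a real-linear functional of the two unit complex numbers is a
  combination of the four exponentials with frequencies plus or minus a basis vector, each of which
  only shifts the Fourier coefficients. Sums and products follow by induction.\<close>

lemma null_fc_polynomial:
  assumes "real_polynomial_function p" "null_fc h"
  shows "null_fc (\<lambda>x. of_real (p (torus_map x)) * h x)"
  using assms
proof (induction arbitrary: h)
  case (linear f)
  interpret bounded_linear f by fact
  let ?e1 = "vector [1, 0] :: int^2" and ?e2 = "vector [0, 1] :: int^2"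
  have e: "expi ?e1 x = cis (x $ 1)" "expi ?e2 x = cis (x $ 2)" "expi (- ?e1) x = cis (- x $ 1)" "expi (- ?e2) x = cis (- x $ 2)" for x
    by (simp_all add: expi_def freq_def inner_vec_def sum_2)
  have "f (torus_map x) = cos (x $ 1) * f (1, 0) + sin (x $ 1) * f (\<i>, 0) + cos (x $ 2) * f (0, 1) + sin (x $ 2) * f (0, \<i>)" for x
  proof -
    have "torus_map x = (cos (x $ 1) *\<^sub>R (1, 0) + sin (x $ 1) *\<^sub>R (\<i>, 0)) + (cos (x $ 2) *\<^sub>R (0, 1) + sin (x $ 2) *\<^sub>R (0, \<i>))"
      by (simp add: torus_map_def complex_eq_iff)
    then show ?thesis by (simp only: add scaleR) simp
  qed
  moreover have "((of_real A - \<i> * of_real B) / 2) * (cis t * z) + ((of_real A + \<i> * of_real B) / 2) * (cis (- t) * z)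
      = of_real (cos t * A + sin t * B) * z" for A B t z
    by (simp add: complex_eq_iff field_simps)
  ultimately have "of_real (f (torus_map x)) * h x =
     1 * (((f (1, 0) - \<i> * f (\<i>, 0)) / 2) * (expi ?e1 x * h x) + ((f (1, 0) + \<i> * f (\<i>, 0)) / 2) * (expi (- ?e1) x * h x))
   + 1 * (((f (0, 1) - \<i> * f (0, \<i>)) / 2) * (expi ?e2 x * h x) + ((f (0, 1) + \<i> * f (0, \<i>)) / 2) * (expi (- ?e2) x * h x))" for x
    unfolding e by (simp only: of_real_add add.assoc distrib_right mult_1)
  then show ?case
    by (simp only:) (intro null_fc_lincomb null_fc_expi linear.prems)
next
  case (const c)
  then show ?case using null_fc_lincomb[of h h "of_real c" 0] by simp
next
  case (add f g)
  then show ?case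
    using null_fc_lincomb[OF add.IH(1)[OF add.prems] add.IH(2)[OF add.prems], of 1 1] by (simp add: algebra_simps)
next
  case (mult f g)
  have "null_fc (\<lambda>x. of_real (f (torus_map x)) * (of_real (g (torus_map x)) * h x))"
    by (intro mult.IH mult.prems)
  then show ?case by (simp add: mult.assoc)
qed

lemma continuous_torus_map: "continuous_on S torus_map"
proof -
  have eq: "torus_map = (\<lambda>x. (exp (\<i> * complex_of_real (x $ 1)), exp (\<i> * complex_of_real (x $ 2))))"
    by (simp add: torus_map_def cis_conv_exp fun_eq_iff)
  show ?thesis unfolding eq by (intro continuous_intros)
qed

lemma torus_map_eq:
  fixes h :: "real^2 \<Rightarrow> 'b"
  assumes p: "\<And>x j. h (x + axis j (2 * pi)) = h x" and eq: "torus_map x = torus_map y"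
  shows "h x = h y"
proof -
  have "\<exists>n::int. s = t + 2 * pi * n" if "cis s = cis t" for s t
  proof -
    have "sin s = sin t \<and> cos s = cos t" using that by (simp add: complex_eq_iff)
    then show ?thesis using sin_cos_eq_iff[of s t] by (auto simp: mult_ac)
  qed
  then obtain n m :: int where "x $ 1 = y $ 1 + 2 * pi * n" "x $ 2 = y $ 2 + 2 * pi * m"
    using eq by (auto simp: torus_map_def) metis
  then have "x = y + axis 1 (2 * pi * real_of_int n) + axis 2 (2 * pi * real_of_int m)"
    by (simp add: vec_eq_iff forall_2 axis_def)
  then show ?thesis by (simp add: shift_int p)
qed

text \<open>The function descends to a continuous \<open>H\<close> on the image of the torus. If a
  polynomial \<open>P\<close> approximates \<open>H\<close>, then h is orthogonal to
  \<open>P\<close> composed with \<open>torus_map\<close>, so the integral of the squared modulus of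
  h is below every positive number.\<close>

lemma null_fc_zero:
  assumes h: "null_fc h" and p: "\<And>x j. h (x + axis j (2 * pi)) = h x"
  shows "h x = 0"
proof -
  have c: "continuous_on S h" for S using h continuous_on_subset by (auto simp: null_fc_def)
  let ?S = "torus_map ` torus"
  have S: "compact ?S" by (intro compact_continuous_image continuous_torus_map) simp
  define H where "H = h \<circ> inv_into torus torus_map"
  have H: "H (torus_map x) = h x" if "x \<in> torus" for x
    unfolding H_def o_def by (rule torus_map_eq[OF p]) (simp add: f_inv_into_f that)
  \<comment> \<open>The inverse of \<open>torus_map\<close> is not continuous, but closed sets pull
    back under \<open>H\<close> to images of compact sets, since the cell is compact.\<close>
  have "continuous_on ?S H"
  proof (subst continuous_on_closed_vimage)
    show "closed ?S" using S by (rule compact_imp_closed)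
    show "\<forall>C. closed C \<longrightarrow> closed (H -` C \<inter> ?S)"
    proof (intro allI impI)
      fix C :: "complex set" assume C: "closed C"
      have "H -` C \<inter> ?S = torus_map ` (h -` C \<inter> torus)" using H by auto
      moreover have "compact (torus_map ` (h -` C \<inter> torus))"
      proof (intro compact_continuous_image continuous_torus_map)
        have "closed (h -` C \<inter> torus)"
          using c[of torus] C by (simp add: continuous_on_closed_vimage compact_imp_closed)
        then have "compact (torus \<inter> (h -` C \<inter> torus))" by (intro compact_Int_closed) simp
        moreover have "torus \<inter> (h -` C \<inter> torus) = h -` C \<inter> torus" by auto
        ultimately show "compact (h -` C \<inter> torus)" by simp
      qed
      ultimately show "closed (H -` C \<inter> ?S)" by (simp add: compact_imp_closed)
    qed
  qed
  note Hc = this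
  have "bounded (h ` torus)"
    by (intro compact_imp_bounded compact_continuous_image c) auto
  then obtain B where B: "0 < B" "\<And>x. x \<in> torus \<Longrightarrow> cmod (h x) \<le> B"
    by (auto simp: bounded_pos)
  have "cmod (cint (\<lambda>x. h x * cnj (h x))) \<le> e" if e: "0 < e" for e
  proof -
    define d where "d = e / ((2 * pi)^2 * B)"
    have d: "0 < d" using e B by (simp add: d_def)
    obtain P where P: "polynomial_function P" "\<And>z. z \<in> ?S \<Longrightarrow> cmod (H z - P z) < d"
      using Stone_Weierstrass_polynomial_function[OF S Hc d] by blast
    have re: "real_polynomial_function (\<lambda>z. Re (P z))" and im: "real_polynomial_function (\<lambda>z. Im (P z))"
      using P(1) unfolding polynomial_function_def o_def by (simp_all add: bounded_linear_Re bounded_linear_Im)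
    let ?g = "\<lambda>x. cnj (P (torus_map x))"
    have "(\<lambda>x. 1 * (of_real (Re (P (torus_map x))) * h x) + (- \<i>) * (of_real (Im (P (torus_map x))) * h x)) = (\<lambda>x. h x * ?g x)"
      by (auto simp: complex_eq_iff)
    then have n: "null_fc (\<lambda>x. h x * ?g x)"
      using null_fc_lincomb[OF null_fc_polynomial[OF re h] null_fc_polynomial[OF im h], of 1 "- \<i>"] by simp
    then have "fc (\<lambda>x. h x * ?g x) 0 = 0" by (simp add: null_fc_def)
    then have "cint (\<lambda>x. h x * ?g x) = 0" by (simp add: fc_def)
    then have "cint (\<lambda>x. h x * cnj (h x)) = cint (\<lambda>x. h x * cnj (h x) - h x * ?g x)"
      using n by (subst cint_diff) (auto intro!: continuous_intros c simp: null_fc_def)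
    also have "cmod \<dots> \<le> (2 * pi)^2 * (B * d)"
    proof (rule cint_bound)
      show "continuous_on UNIV (\<lambda>x. h x * cnj (h x) - h x * ?g x)"
        using n by (auto intro!: continuous_intros c simp: null_fc_def)
      fix x assume x: "x \<in> torus"
      have "cmod (h x * cnj (h x) - h x * ?g x) = cmod (h x) * cmod (cnj (h x - P (torus_map x)))"
        by (simp only: norm_mult[symmetric] right_diff_distrib complex_cnj_diff)
      also have "\<dots> \<le> B * d"
        unfolding complex_mod_cnj using P(2)[of "torus_map x"] H x B by (intro mult_mono) auto
      finally show "cmod (h x * cnj (h x) - h x * ?g x) \<le> B * d" .
    qed
    also have "\<dots> = e" using B by (simp add: d_def)
    finally show ?thesis .
  qed
  then have "cmod (cint (\<lambda>x. h x * cnj (h x))) \<le> 0" by (rule field_le_epsilon[of _ 0, simplified])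
  then have "cint (\<lambda>x. of_real ((cmod (h x))^2)) = 0" by (simp only: complex_norm_square norm_le_zero_iff)
  then have "torus_integral (\<lambda>x. (cmod (h x))^2) = 0" unfolding cint_of_real by simp
  then have "integral torus (\<lambda>x. (cmod (h x))^2) = 0"
    by (subst torus_integral_eq_integral[symmetric]) (auto intro!: continuous_intros c)
  then have z: "h y = 0" if "y \<in> torus" for y
    using that pi_gt_zero unfolding torus_def
    by (subst (asm) integral_cbox_eq_0_iff) (auto intro!: continuous_intros c simp: interval_eq_empty_cart not_le)
  show ?thesis
  proof -
    obtain y where "y \<in> torus" "cmod (h y) = cmod (h x)"
      by (rule periodic_torus[of "\<lambda>x. cmod (h x)" x]) (auto simp: periodic_def p)
    then show ?thesis using z by auto
  qed
qed

lemma fourier_inversion: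
  assumes \<psi>: "\<psi> \<in> test_functions"
  shows "ser (rfc \<psi>) x = of_real (\<psi> x)"
proof -
  have r: "(\<lambda>k. cmod (rfc \<psi> k)) summable_on UNIV"
    using rfc_rapid[OF \<psi>, of 0] by simp
  have n: "null_fc (\<lambda>x. 1 * ser (rfc \<psi>) x + (- 1) * complex_of_real (\<psi> x))"
    unfolding null_fc_def
    using fc_add[OF ser_continuous[OF r] continuous_of_real_test[OF \<psi>], of 1 "- 1"] fc_ser[OF r]
    by (auto intro!: continuous_intros ser_continuous[OF r] continuous_of_real_test \<psi>)
  have "\<psi> (x + axis j (2 * pi)) = \<psi> x" for x j
    using \<psi> by (simp add: test_functions_def periodic_def)
  then have "1 * ser (rfc \<psi>) x + (- 1) * complex_of_real (\<psi> x) = 0"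
    by (intro null_fc_zero[OF n]) (simp add: ser_periodic[OF r])
  then show ?thesis by simp
qed

section \<open>Distributions with given Fourier coefficients\<close>

text \<open>Hermitian symmetry encodes real-valuedness; polynomial growth gives continuity of the
  associated functional, by the rapid decay of the coefficients of test functions.\<close>

definition mild :: "(int^2 \<Rightarrow> complex) \<Rightarrow> bool" where
  "mild a \<longleftrightarrow> (\<forall>k. a (- k) = cnj (a k)) \<and> (\<exists>C n. \<forall>k. cmod (a k) \<le> C * wt k ^ n)"

text \<open>Parseval's formula taken as definition.\<close>

definition fdist :: "(int^2 \<Rightarrow> complex) \<Rightarrow> distribution" where
  "fdist a = restrict (\<lambda>\<psi>. (2 * pi)^2 * Re (\<Sum>\<^sub>\<infinity>k. a k * cnj (rfc \<psi> k))) test_functions"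

lemma mildI: "(\<And>k. a (- k) = cnj (a k)) \<Longrightarrow> (\<And>k. cmod (a k) \<le> C * wt k ^ n) \<Longrightarrow> mild a"
  unfolding mild_def by blast

lemma mild_minus: "mild a \<Longrightarrow> a (- k) = cnj (a k)"
  by (simp add: mild_def)

lemma mild_bound:
  assumes "mild a"
  obtains C n where "0 \<le> C" "\<And>k. cmod (a k) \<le> C * wt k ^ n"
proof -
  obtain C n where C: "\<And>k. cmod (a k) \<le> C * wt k ^ n" using assms by (auto simp: mild_def)
  have "0 \<le> C" using order_trans[OF norm_ge_zero C[of 0]] by (simp add: wt_def)
  then show ?thesis using that C by blast
qed

lemma fdist_abs_summable:
  assumes "mild a" "\<psi> \<in> test_functions"
  shows "(\<lambda>k. norm (a k * cnj (rfc \<psi> k))) summable_on UNIV"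
proof -
  obtain C n where C: "0 \<le> C" "\<And>k. cmod (a k) \<le> C * wt k ^ n" using mild_bound[OF assms(1)] by blast
  show ?thesis
  proof (rule Infinite_Sum.abs_summable_on_comparison_test')
    show "(\<lambda>k. C * (wt k ^ n * cmod (rfc \<psi> k))) summable_on UNIV"
      by (rule summable_on_cmult_right[OF rfc_rapid[OF assms(2)]])
    show "norm (a k * cnj (rfc \<psi> k)) \<le> C * (wt k ^ n * cmod (rfc \<psi> k))" for k
      using mult_right_mono[OF C(2)[of k], of "cmod (rfc \<psi> k)"] by (simp add: norm_mult mult.assoc)
  qed
qed

lemma fdist_summable:
  assumes "mild a" "\<psi> \<in> test_functions"
  shows "(\<lambda>k. a k * cnj (rfc \<psi> k)) summable_on UNIV"
  by (rule abs_summable_summable[OF fdist_abs_summable[OF assms]])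

lemma rfc_lincomb:
  assumes "\<phi> \<in> test_functions" "\<psi> \<in> test_functions"
  shows "rfc (\<lambda>x. a * \<phi> x + b * \<psi> x) k = of_real a * rfc \<phi> k + of_real b * rfc \<psi> k"
  using fc_add[OF continuous_of_real_test[OF assms(1)] continuous_of_real_test[OF assms(2)], of "of_real a" "of_real b"]
  by simp

text \<open>The continuity bound uses n derivatives against the growth of the coefficients and four
  more to make the remaining sum converge.\<close>

lemma fdist_distribution:
  assumes a: "mild a"
  shows "fdist a \<in> distributions"
proof -
  have "fdist a (\<lambda>x. s * \<phi> x + t * \<psi> x) = s * fdist a \<phi> + t * fdist a \<psi>"
    if "\<phi> \<in> test_functions" "\<psi> \<in> test_functions" for \<phi> \<psi> s t
  proof -
    have "(\<Sum>\<^sub>\<infinity>k. a k * cnj (rfc (\<lambda>x. s * \<phi> x + t * \<psi> x) k))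
        = (\<Sum>\<^sub>\<infinity>k. of_real s * (a k * cnj (rfc \<phi> k)) + of_real t * (a k * cnj (rfc \<psi> k)))"
      by (simp only: rfc_lincomb[OF that]) (simp add: algebra_simps)
    also have "\<dots> = of_real s * (\<Sum>\<^sub>\<infinity>k. a k * cnj (rfc \<phi> k)) + of_real t * (\<Sum>\<^sub>\<infinity>k. a k * cnj (rfc \<psi> k))"
      by (subst infsum_add)
         (auto intro!: summable_on_cmult_right fdist_summable a that simp: infsum_cmult_right')
    finally show ?thesis using that by (simp add: fdist_def test_lincomb algebra_simps)
  qed
  moreover have "\<exists>C N. \<forall>\<psi>\<in>test_functions. \<forall>B.
        (\<forall>js x. length js \<le> N \<longrightarrow> \<bar>partials js \<psi> x\<bar> \<le> B) \<longrightarrow> \<bar>fdist a \<psi>\<bar> \<le> C * B"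
  proof -
    obtain C n where C: "0 \<le> C" "\<And>k. cmod (a k) \<le> C * wt k ^ n" using mild_bound[OF a] by blast
    let ?W = "\<Sum>\<^sub>\<infinity>k. 1 / wt k ^ 4"
    show ?thesis
    proof (intro exI ballI allI impI)
      fix \<psi> B assume \<psi>: "\<psi> \<in> test_functions" and B: "\<forall>js x. length js \<le> n + 4 \<longrightarrow> \<bar>partials js \<psi> x\<bar> \<le> B"
      have "cmod (\<Sum>\<^sub>\<infinity>k. a k * cnj (rfc \<psi> k)) \<le> (\<Sum>\<^sub>\<infinity>k. C * (3 ^ (n + 4) * B) * (1 / wt k ^ 4))"
      proof (rule norm_infsum_le)
        fix k
        have "cmod (a k) * cmod (rfc \<psi> k) \<le> C * wt k ^ n * cmod (rfc \<psi> k)"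
          by (intro mult_right_mono C) simp
        also have "\<dots> = C * ((wt k ^ (n + 4) * cmod (rfc \<psi> k)) * (1 / wt k ^ 4))"
          using less_imp_neq[OF wt_pos[of k]] by (simp add: power_add)
        also have "\<dots> \<le> C * ((3 ^ (n + 4) * B) * (1 / wt k ^ 4))"
          using B by (intro mult_left_mono mult_right_mono rfc_decay \<psi> C) auto
        finally show "norm (a k * cnj (rfc \<psi> k)) \<le> C * (3 ^ (n + 4) * B) * (1 / wt k ^ 4)"
          by (simp add: norm_mult mult.assoc)
      qed (rule has_sum_infsum fdist_summable a \<psi> summable_on_cmult_right summable_wt)+
      also have "\<dots> = C * (3 ^ (n + 4) * B) * ?W" by (rule infsum_cmult_right')
      finally have "\<bar>Re (\<Sum>\<^sub>\<infinity>k. a k * cnj (rfc \<psi> k))\<bar> \<le> C * (3 ^ (n + 4) * B) * ?W"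
        using abs_Re_le_cmod order_trans by blast
      then show "\<bar>fdist a \<psi>\<bar> \<le> ((2 * pi)^2 * C * 3 ^ (n + 4) * ?W) * B"
        using \<psi> mult_left_mono[of _ "C * (3 ^ (n + 4) * B) * ?W" "(2 * pi)^2"]
        by (simp add: fdist_def abs_mult mult_ac)
    qed
  qed
  ultimately show ?thesis by (auto simp: distributions_def fdist_def)
qed

lemma rfc_cos: "rfc (\<lambda>x. cos (x \<bullet> freq k)) m = (fc (expi k) m + fc (expi (- k)) m) / 2"
proof -
  have "(\<lambda>x. complex_of_real (cos (x \<bullet> freq k))) = (\<lambda>x. (1/2) * expi k x + (1/2) * expi (- k) x)"
    by (auto simp: expi_def complex_eq_iff)
  then show ?thesis using fc_add[OF continuous_expi continuous_expi, of "1/2" k "1/2" "- k" m] by simp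
qed

lemma rfc_sin: "rfc (\<lambda>x. sin (x \<bullet> freq k)) m = (- \<i> * fc (expi k) m + \<i> * fc (expi (- k)) m) / 2"
proof -
  have "(\<lambda>x. complex_of_real (sin (x \<bullet> freq k))) = (\<lambda>x. (- \<i>/2) * expi k x + (\<i>/2) * expi (- k) x)"
    by (auto simp: expi_def complex_eq_iff)
  then show ?thesis using fc_add[OF continuous_expi continuous_expi, of "- \<i>/2" k "\<i>/2" "- k" m]
    by (simp add: add_divide_distrib)
qed

lemma fourier_fdist:
  assumes a: "mild a"
  shows "fourier_coeff (fdist a) k = a k"
proof -
  have e: "((\<lambda>m. a m * cnj (fc (expi j) m)) has_sum a j) UNIV" for j
    by (rule has_sum_finite_neutralI[of "{j}"]) (auto simp: fc_expi)
  have "((\<lambda>m. (1/2) * (a m * cnj (fc (expi k) m)) + (1/2) * (a m * cnj (fc (expi (- k)) m))) has_sum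
      (1/2) * a k + (1/2) * a (- k)) UNIV"
    by (intro has_sum_add has_sum_cmult_right e)
  then have c: "(\<Sum>\<^sub>\<infinity>m. a m * cnj (rfc (\<lambda>x. cos (x \<bullet> freq k)) m)) = (a k + a (- k)) / 2"
    unfolding rfc_cos by (intro infsumI) (simp add: add_divide_distrib algebra_simps)
  have "((\<lambda>m. (\<i>/2) * (a m * cnj (fc (expi k) m)) + (- \<i>/2) * (a m * cnj (fc (expi (- k)) m))) has_sum
      (\<i>/2) * a k + (- \<i>/2) * a (- k)) UNIV"
    by (intro has_sum_add has_sum_cmult_right e)
  then have s: "(\<Sum>\<^sub>\<infinity>m. a m * cnj (rfc (\<lambda>x. sin (x \<bullet> freq k)) m)) = (\<i> * a k - \<i> * a (- k)) / 2"
    unfolding rfc_sin by (intro infsumI) (simp add: add_divide_distrib diff_divide_distrib algebra_simps)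
  have "fdist a (\<lambda>x. cos (x \<bullet> freq k)) = (2 * pi)^2 * Re (a k)"
    "fdist a (\<lambda>x. sin (x \<bullet> freq k)) = - ((2 * pi)^2 * Im (a k))"
    unfolding fdist_def using cos_test[of k] sin_test[of k] by (simp_all add: c s mild_minus[OF a])
  then show ?thesis unfolding fourier_coeff_def by (simp add: complex_eq_iff)
qed

lemma norm_has_sum_tail:
  fixes f :: "'a \<Rightarrow> 'b::banach"
  assumes f: "(f has_sum s) UNIV" and M: "M summable_on UNIV" and le: "\<And>k. norm (f k) \<le> M k" and F: "finite F"
  shows "norm (s - sum f F) \<le> infsum M UNIV - sum M F"
proof -
  have "((\<lambda>k. f k - (if k \<in> F then f k else 0)) has_sum (s - sum f F)) UNIV"
    unfolding diff_conv_add_uminus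
    by (intro has_sum_add has_sum_uminusI f has_sum_finite_neutralI[OF F]) (auto simp: sum_negf)
  moreover have "((\<lambda>k. M k - (if k \<in> F then M k else 0)) has_sum (infsum M UNIV - sum M F)) UNIV"
    unfolding diff_conv_add_uminus
    by (intro has_sum_add has_sum_uminusI has_sum_infsum M has_sum_finite_neutralI[OF F]) (auto simp: sum_negf)
  ultimately show ?thesis by (rule norm_infsum_le) (use le in auto)
qed

lemma partial_sum:
  assumes "finite F" "\<And>k. k \<in> F \<Longrightarrow> f k differentiable (at x)"
  shows "partial j (\<lambda>x. \<Sum>k\<in>F. f k x) x = (\<Sum>k\<in>F. partial j (f k) x)"
proof -
  have "((\<lambda>x. \<Sum>k\<in>F. f k x) has_derivative (\<lambda>h. \<Sum>k\<in>F. frechet_derivative (f k) (at x) h)) (at x)"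
    using assms by (intro has_derivative_sum) (simp add: frechet_derivative_works)
  then show ?thesis by (subst partial_eq) (auto simp: partial_def)
qed

lemma Re_expi: "Re (z * expi k x) = Re z * cos (x \<bullet> freq k) + (- Im z) * sin (x \<bullet> freq k)"
  by (simp add: expi_def)

lemma partials_trig_sum:
  assumes F: "finite F" and \<psi>: "\<psi> \<in> test_functions"
  shows "partials js (\<lambda>x. \<Sum>k\<in>F. Re (rfc \<psi> k * expi k x)) = (\<lambda>x. \<Sum>k\<in>F. Re (rfc (partials js \<psi>) k * expi k x))"
proof (induction js)
  case (Cons j js)
  have d: "(\<lambda>x. Re (z * expi k x)) differentiable (at x)" for z k x
    unfolding Re_expi by (rule smooth_differentiable[OF smooth_trig])
  have p: "partial j (\<lambda>x. Re (z * expi k x)) x = Re (\<i> * of_int (k $ j) * z * expi k x)" for z k x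
    unfolding Re_expi partial_trig by (simp add: freq_def algebra_simps)
  show ?case
    by (rule ext) (simp only: partials.simps Cons partial_sum[OF F d] p rfc_partial[OF test_partials[OF \<psi>]])
qed simp

lemma distribution_lincomb:
  "T \<in> distributions \<Longrightarrow> \<phi> \<in> test_functions \<Longrightarrow> \<psi> \<in> test_functions \<Longrightarrow>
   T (\<lambda>x. a * \<phi> x + b * \<psi> x) = a * T \<phi> + b * T \<psi>"
  by (simp add: distributions_def)

lemma distribution_sum:
  assumes T: "T \<in> distributions" and "finite F" "\<And>k. k \<in> F \<Longrightarrow> f k \<in> test_functions"
  shows "T (\<lambda>x. \<Sum>k\<in>F. f k x) = (\<Sum>k\<in>F. T (f k))"
  using assms(2,3)
proof (induction F rule: finite_induct)
  case empty
  then show ?case using distribution_lincomb[OF T test_const test_const, of 0 0 0 0] by simp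
next
  case (insert k F)
  then show ?case
    using distribution_lincomb[OF T, of "f k" "\<lambda>x. \<Sum>k\<in>F. f k x" 1 1] by (simp add: test_sum)
qed

text \<open>On trigonometric polynomials a distribution is fixed by its Fourier coefficients. The
  partial Fourier sums of a test function converge together with all derivatives up to order n,
  since one summable \<open>M\<close> dominates all these series, so continuity carries the identity
  over.\<close>

lemma distribution_eq_fdist:
  assumes T: "T \<in> distributions" and a: "mild a" and fT: "\<And>k. fourier_coeff T k = a k"
  shows "T = fdist a"
proof (rule extensionalityI)
  show "T \<in> extensional test_functions" "fdist a \<in> extensional test_functions"
    using T by (auto simp: distributions_def fdist_def)
  fix \<psi> assume \<psi>: "\<psi> \<in> test_functions"
  obtain C n where C: "\<And>\<phi> B. \<phi> \<in> test_functions \<Longrightarrow> (\<And>js x. length js \<le> n \<Longrightarrow> \<bar>partials js \<phi> x\<bar> \<le> B) \<Longrightarrow> \<bar>T \<phi>\<bar> \<le> C * B"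
    using T unfolding distributions_def by blast
  define M where "M k = wt k ^ n * cmod (rfc \<psi> k)" for k
  have M: "M summable_on UNIV" unfolding M_def by (rule rfc_rapid[OF \<psi>])
  have trig: "(\<lambda>x. Re (z * expi k x)) \<in> test_functions" for z k
    unfolding Re_expi by (rule trig_test)
  have Ttrig: "T (\<lambda>x. Re (z * expi k x)) = (2 * pi)^2 * Re (a k * cnj z)" for z k
  proof -
    have "T (\<lambda>x. cos (x \<bullet> freq k)) = (2 * pi)^2 * Re (a k)" "T (\<lambda>x. sin (x \<bullet> freq k)) = - ((2 * pi)^2 * Im (a k))"
      using fT[of k] unfolding fourier_coeff_def by (auto simp: complex_eq_iff field_simps)
    then show ?thesis
      unfolding Re_expi distribution_lincomb[OF T cos_test sin_test] by (simp add: algebra_simps)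
  qed
  have bound: "\<bar>T \<psi> - (2 * pi)^2 * Re (\<Sum>k\<in>F. a k * cnj (rfc \<psi> k))\<bar> \<le> C * (infsum M UNIV - sum M F)"
    if F: "finite F" for F
  proof -
    let ?S = "\<lambda>x. \<Sum>k\<in>F. Re (rfc \<psi> k * expi k x)"
    have S: "?S \<in> test_functions" by (intro test_sum F trig)
    have "T ?S = (2 * pi)^2 * Re (\<Sum>k\<in>F. a k * cnj (rfc \<psi> k))"
      unfolding distribution_sum[OF T F trig] Ttrig by (simp add: sum_distrib_left)
    then have "T \<psi> - (2 * pi)^2 * Re (\<Sum>k\<in>F. a k * cnj (rfc \<psi> k)) = T (\<lambda>x. 1 * \<psi> x + (- 1) * ?S x)"
      unfolding distribution_lincomb[OF T \<psi> S] by simp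
    also have "\<bar>\<dots>\<bar> \<le> C * (infsum M UNIV - sum M F)"
    proof (rule C)
      show "(\<lambda>x. 1 * \<psi> x + (- 1) * ?S x) \<in> test_functions" by (rule test_lincomb[OF \<psi> S])
      fix js x assume js: "length (js :: 2 list) \<le> n"
      let ?b = "rfc (partials js \<psi>)"
      have bM: "cmod (?b k) \<le> M k" for k
      proof -
        have "fnorm k ^ length js \<le> wt k ^ length js" by (rule power_mono) (auto simp: wt_def)
        also have "\<dots> \<le> wt k ^ n" by (rule power_increasing[OF js]) simp
        finally show ?thesis
          unfolding M_def by (rule order_trans[OF rfc_partials_le[OF \<psi>] mult_right_mono]) simp
      qed
      have b: "(\<lambda>k. cmod (?b k)) summable_on UNIV"
        using rfc_rapid[OF test_partials[OF \<psi>], of 0 js] by simp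
      have sm: "smooth \<psi>" "smooth ?S" using \<psi> S by (auto simp: test_functions_def)
      have "partials js (\<lambda>x. 1 * \<psi> x + (- 1) * ?S x) x = partials js \<psi> x - (\<Sum>k\<in>F. Re (?b k * expi k x))"
        unfolding partials_lincomb[OF sm] partials_trig_sum[OF F \<psi>] by simp
      also have "\<dots> = Re (ser ?b x - (\<Sum>k\<in>F. ?b k * expi k x))"
        by (simp add: fourier_inversion[OF test_partials[OF \<psi>]])
      also have "\<bar>\<dots>\<bar> \<le> cmod (ser ?b x - (\<Sum>k\<in>F. ?b k * expi k x))" by (rule abs_Re_le_cmod)
      also have "\<dots> \<le> infsum M UNIV - sum M F"
        by (rule norm_has_sum_tail[OF ser_has_sum[OF b] M _ F]) (simp add: norm_mult bM)
      finally show "\<bar>partials js (\<lambda>x. 1 * \<psi> x + (- 1) * ?S x) x\<bar> \<le> infsum M UNIV - sum M F" .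
    qed
    finally show ?thesis .
  qed
  have fd: "fdist a \<psi> = (2 * pi)^2 * Re (\<Sum>\<^sub>\<infinity>k. a k * cnj (rfc \<psi> k))"
    using \<psi> by (simp add: fdist_def)
  have lim: "((\<lambda>F. (2 * pi)^2 * Re (\<Sum>k\<in>F. a k * cnj (rfc \<psi> k))) \<longlongrightarrow> fdist a \<psi>) (finite_subsets_at_top UNIV)"
    using has_sum_infsum[OF fdist_summable[OF a \<psi>]] unfolding has_sum_def fd
    by (intro tendsto_mult tendsto_const tendsto_Re)
  have "((\<lambda>F. C * (infsum M UNIV - sum M F)) \<longlongrightarrow> C * (infsum M UNIV - infsum M UNIV)) (finite_subsets_at_top UNIV)"
    using has_sum_infsum[OF M] unfolding has_sum_def by (intro tendsto_intros)
  then have "((\<lambda>F. C * (infsum M UNIV - sum M F)) \<longlongrightarrow> 0) (finite_subsets_at_top UNIV)" by simp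
  then have "((\<lambda>F. T \<psi> - (2 * pi)^2 * Re (\<Sum>k\<in>F. a k * cnj (rfc \<psi> k))) \<longlongrightarrow> 0) (finite_subsets_at_top UNIV)"
    by (rule Lim_null_comparison[rotated])
       (rule eventually_finite_subsets_at_top_weakI, unfold real_norm_def, rule bound)
  then have "((\<lambda>F. T \<psi> - (T \<psi> - (2 * pi)^2 * Re (\<Sum>k\<in>F. a k * cnj (rfc \<psi> k)))) \<longlongrightarrow> T \<psi> - 0) (finite_subsets_at_top UNIV)"
    by (intro tendsto_diff tendsto_const)
  then have "((\<lambda>F. (2 * pi)^2 * Re (\<Sum>k\<in>F. a k * cnj (rfc \<psi> k))) \<longlongrightarrow> T \<psi>) (finite_subsets_at_top UNIV)"
    by (simp only: diff_diff_eq2 add_diff_cancel_left' diff_zero)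
  then show "T \<psi> = fdist a \<psi>" using lim by (rule tendsto_unique[rotated]) simp
qed

section \<open>Operators on distributions in terms of coefficients\<close>

lemma Lambda_symbol_bound: "\<exists>n. \<forall>k. Lambda_symbol s k \<le> wt k ^ n"
proof -
  have "Lambda_symbol s k \<le> wt k ^ nat \<lceil>\<bar>s\<bar>\<rceil>" for k
  proof (cases "k = 0")
    case False
    have "fnorm k powr s \<le> fnorm k powr \<bar>s\<bar>" using fnorm_ge_1[OF False] by (intro powr_mono) auto
    also have "\<dots> \<le> wt k powr \<bar>s\<bar>" by (intro powr_mono2) (auto simp: wt_def)
    also have "\<dots> \<le> wt k powr real (nat \<lceil>\<bar>s\<bar>\<rceil>)" by (intro powr_mono) (auto simp: real_nat_ceiling_ge)
    also have "\<dots> = wt k ^ nat \<lceil>\<bar>s\<bar>\<rceil>" by (rule powr_realpow) simp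
    finally show ?thesis by (simp add: Lambda_symbol_def fnorm_def)
  qed (simp add: Lambda_symbol_def)
  then show ?thesis by blast
qed

lemma Lambda_symbol_nonneg [simp]: "0 \<le> Lambda_symbol s k"
  by (simp add: Lambda_symbol_def)

lemma mild_Lambda:
  assumes "mild a"
  shows "mild (\<lambda>k. of_real (Lambda_symbol s k) * a k)"
proof -
  obtain C n where C: "0 \<le> C" "\<And>k. cmod (a k) \<le> C * wt k ^ n" using mild_bound[OF assms] by blast
  obtain N where N: "\<And>k. Lambda_symbol s k \<le> wt k ^ N" using Lambda_symbol_bound by blast
  show ?thesis
  proof (rule mildI)
    have "Lambda_symbol s (- k) = Lambda_symbol s k" for k by (simp add: Lambda_symbol_def)
    then show "of_real (Lambda_symbol s (- k)) * a (- k) = cnj (of_real (Lambda_symbol s k) * a k)" for k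
      using mild_minus[OF assms] by simp
    fix k
    have "Lambda_symbol s k * cmod (a k) \<le> wt k ^ N * (C * wt k ^ n)"
      by (intro mult_mono N C) auto
    then show "cmod (of_real (Lambda_symbol s k) * a k) \<le> C * wt k ^ (N + n)"
      by (simp add: norm_mult power_add mult_ac)
  qed
qed

text \<open>Evaluates the definite description: \<open>fdist_distribution\<close> and
  \<open>fourier_fdist\<close> give existence, \<open>distribution_eq_fdist\<close> gives
  uniqueness.\<close>

lemma Lambda_fdist:
  assumes a: "mild a"
  shows "Lambda s (fdist a) = fdist (\<lambda>k. of_real (Lambda_symbol s k) * a k)"
  unfolding Lambda_def fourier_fdist[OF a]
proof (rule the_equality)
  show "fdist (\<lambda>k. of_real (Lambda_symbol s k) * a k) \<in> distributions \<and>
    (\<forall>k. fourier_coeff (fdist (\<lambda>k. of_real (Lambda_symbol s k) * a k)) k = of_real (Lambda_symbol s k) * a k)"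
    using fdist_distribution fourier_fdist mild_Lambda[OF a] by blast
qed (use distribution_eq_fdist mild_Lambda[OF a] in blast)

lemma mild_partial:
  assumes "mild a"
  shows "mild (\<lambda>k. \<i> * of_int (k $ j) * a k)"
proof -
  obtain C n where C: "0 \<le> C" "\<And>k. cmod (a k) \<le> C * wt k ^ n" using mild_bound[OF assms] by blast
  show ?thesis
  proof (rule mildI)
    show "\<i> * of_int ((- k) $ j) * a (- k) = cnj (\<i> * of_int (k $ j) * a k)" for k
      using mild_minus[OF assms] by simp
    fix k
    have "\<bar>real_of_int (k $ j)\<bar> * cmod (a k) \<le> wt k * (C * wt k ^ n)"
      using fnorm_component[of k j] by (intro mult_mono C) (auto simp: wt_def)
    then show "cmod (\<i> * of_int (k $ j) * a k) \<le> C * wt k ^ (Suc n)"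
      by (simp add: norm_mult mult_ac)
  qed
qed

lemma partial_fdist:
  assumes a: "mild a"
  shows "partial_dist j (fdist a) = fdist (\<lambda>k. \<i> * of_int (k $ j) * a k)"
proof (rule ext)
  fix \<psi>
  show "partial_dist j (fdist a) \<psi> = fdist (\<lambda>k. \<i> * of_int (k $ j) * a k) \<psi>"
  proof (cases "\<psi> \<in> test_functions")
    case True
    have "(\<Sum>\<^sub>\<infinity>k. \<i> * of_int (k $ j) * a k * cnj (rfc \<psi> k)) = (\<Sum>\<^sub>\<infinity>k. - (a k * cnj (rfc (partial j \<psi>) k)))"
      by (rule infsum_cong) (simp add: rfc_partial[OF True])
    also have "\<dots> = - (\<Sum>\<^sub>\<infinity>k. a k * cnj (rfc (partial j \<psi>) k))" by (rule infsum_uminus)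
    finally show ?thesis using True by (simp add: partial_dist_def fdist_def test_partial)
  qed (simp add: partial_dist_def fdist_def)
qed

lemma summable_product:
  fixes u :: "'a \<Rightarrow> real" and v :: "'b \<Rightarrow> real"
  assumes "u summable_on UNIV" "v summable_on UNIV" "\<And>x. 0 \<le> u x" "\<And>y. 0 \<le> v y"
  shows "(\<lambda>(x, y). u x * v y) summable_on UNIV"
proof -
  have "(\<lambda>(x, y). u x * v y) summable_on (SIGMA x:UNIV. UNIV)"
  proof (rule summable_on_SigmaI)
    show "((\<lambda>y. case (x, y) of (x, y) \<Rightarrow> u x * v y) has_sum u x * infsum v UNIV) UNIV" for x
      using has_sum_cmult_right[OF has_sum_infsum[OF assms(2)]] by simp
    show "(\<lambda>x. u x * infsum v UNIV) summable_on UNIV"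
      by (rule summable_on_cmult_left[OF assms(1)])
  qed (use assms in auto)
  then show ?thesis by simp
qed

lemma summable_shift_product:
  fixes u v :: "int^2 \<Rightarrow> real"
  assumes "u summable_on UNIV" "v summable_on UNIV" "\<And>x. 0 \<le> u x" "\<And>y. 0 \<le> v y"
  shows "(\<lambda>(k, m). u m * v (m - k)) summable_on UNIV"
proof -
  have "bij (\<lambda>(k, m). (m, m - k) :: (int^2) \<times> (int^2))"
    by (rule o_bij[of "\<lambda>(m, l). (m - l, m)"]) (auto simp: fun_eq_iff)
  from summable_on_reindex_bij_betw[OF this, of "\<lambda>(x, y). u x * v y"] summable_product[OF assms]
  show ?thesis by (simp add: case_prod_unfold)
qed

lemma summable_reflect:
  fixes f :: "int^2 \<Rightarrow> 'a::{comm_monoid_add, topological_space}"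
  shows "(\<lambda>k. f (p - k)) summable_on UNIV \<longleftrightarrow> f summable_on UNIV"
  by (rule summable_on_reindex_bij_betw) (rule o_bij[of "\<lambda>k. p - k"], auto simp: fun_eq_iff)

lemma infsum_reflect:
  fixes f :: "int^2 \<Rightarrow> 'a::{comm_monoid_add, t2_space}"
  shows "(\<Sum>\<^sub>\<infinity>k. f (p - k)) = infsum f UNIV"
  by (rule infsum_reindex_bij_betw) (rule o_bij[of "\<lambda>k. p - k"], auto simp: fun_eq_iff)

definition conv :: "(real^2 \<Rightarrow> real) \<Rightarrow> (int^2 \<Rightarrow> complex) \<Rightarrow> int^2 \<Rightarrow> complex" where
  "conv \<phi> a p = (\<Sum>\<^sub>\<infinity>k. rfc \<phi> (p - k) * a k)"

text \<open>A Peetre-type inequality: growth in the summation index is split between the output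
  frequency and the rapidly decaying coefficient at p - k.\<close>

lemma wt_le: "wt k ^ n \<le> wt p ^ n * wt (p - k) ^ n"
proof -
  have "wt k \<le> wt p * wt (p - k)" using wt_mult[of p "- (p - k)"] wt_minus[of "p - k"] by simp
  then show ?thesis unfolding power_mult_distrib[symmetric] by (rule power_mono) simp
qed

lemma conv_term_bound:
  assumes "\<And>k. cmod (a k) \<le> C * wt k ^ n" "0 \<le> C"
  shows "cmod (rfc \<phi> (p - k) * a k) \<le> C * wt p ^ n * (wt (p - k) ^ n * cmod (rfc \<phi> (p - k)))"
proof -
  have "cmod (a k) \<le> C * (wt p ^ n * wt (p - k) ^ n)"
    using assms(1)[of k] mult_left_mono[OF wt_le[of k n p] assms(2)] by linarith
  from mult_left_mono[OF this, of "cmod (rfc \<phi> (p - k))"]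
  show ?thesis by (simp add: norm_mult mult_ac)
qed

lemma conv_abs_summable:
  assumes "mild a" "\<phi> \<in> test_functions"
  shows "(\<lambda>k. norm (rfc \<phi> (p - k) * a k)) summable_on UNIV"
proof -
  obtain C n where C: "0 \<le> C" "\<And>k. cmod (a k) \<le> C * wt k ^ n" using mild_bound[OF assms(1)] by blast
  show ?thesis
  proof (rule Infinite_Sum.abs_summable_on_comparison_test'[OF _ conv_term_bound[OF C(2,1)]])
    show "(\<lambda>k. C * wt p ^ n * (wt (p - k) ^ n * cmod (rfc \<phi> (p - k)))) summable_on UNIV"
      by (intro summable_on_cmult_right)
         (use rfc_rapid[OF assms(2), of n] in \<open>simp add: summable_reflect[of "\<lambda>m. wt m ^ n * cmod (rfc \<phi> m)"]\<close>)
  qed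
qed

lemma conv_summable:
  assumes "mild a" "\<phi> \<in> test_functions"
  shows "(\<lambda>k. rfc \<phi> (p - k) * a k) summable_on UNIV"
  by (rule abs_summable_summable[OF conv_abs_summable[OF assms]])

lemma mild_conv:
  assumes a: "mild a" and \<phi>: "\<phi> \<in> test_functions"
  shows "mild (conv \<phi> a)"
proof -
  obtain C n where C: "0 \<le> C" "\<And>k. cmod (a k) \<le> C * wt k ^ n" using mild_bound[OF a] by blast
  let ?S = "\<Sum>\<^sub>\<infinity>k. wt k ^ n * cmod (rfc \<phi> k)"
  have r: "rfc \<phi> (- k) = cnj (rfc \<phi> k)" for k by (rule rfc_minus) (rule test_continuous[OF \<phi>])
  show ?thesis
  proof (rule mildI)
    fix p
    have "conv \<phi> a (- p) = (\<Sum>\<^sub>\<infinity>k. rfc \<phi> (- p - (0 - k)) * a (0 - k))"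
      unfolding conv_def by (rule infsum_reflect[symmetric])
    also have "\<dots> = (\<Sum>\<^sub>\<infinity>k. cnj (rfc \<phi> (p - k) * a k))"
      using r[of "p - _"] mild_minus[OF a] by (intro infsum_cong) simp
    finally show "conv \<phi> a (- p) = cnj (conv \<phi> a p)" by (simp only: conv_def infsum_cnj)
    have "cmod (conv \<phi> a p) \<le> (\<Sum>\<^sub>\<infinity>k. C * wt p ^ n * (wt (p - k) ^ n * cmod (rfc \<phi> (p - k))))"
      unfolding conv_def
    proof (rule norm_infsum_le[OF has_sum_infsum has_sum_infsum conv_term_bound[OF C(2,1)]])
      show "(\<lambda>k. C * wt p ^ n * (wt (p - k) ^ n * cmod (rfc \<phi> (p - k)))) summable_on UNIV"
        by (intro summable_on_cmult_right)
           (use rfc_rapid[OF \<phi>, of n] in \<open>simp add: summable_reflect[of "\<lambda>m. wt m ^ n * cmod (rfc \<phi> m)"]\<close>)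
    qed (rule conv_summable[OF a \<phi>])
    also have "\<dots> = C * wt p ^ n * ?S"
      unfolding infsum_cmult_right' by (subst infsum_reflect[of "\<lambda>m. wt m ^ n * cmod (rfc \<phi> m)"]) rule
    finally show "cmod (conv \<phi> a p) \<le> (C * ?S) * wt p ^ n" by (simp add: mult_ac)
  qed
qed

lemma rfc_mult:
  assumes \<phi>: "\<phi> \<in> test_functions" and \<psi>: "\<psi> \<in> test_functions"
  shows "((\<lambda>m. rfc \<psi> m * rfc \<phi> (k - m)) has_sum rfc (\<lambda>x. \<phi> x * \<psi> x) k) UNIV"
proof -
  have "(\<lambda>k. cmod (rfc \<psi> k)) summable_on UNIV" using rfc_rapid[OF \<psi>, of 0] by simp
  from fc_ser_mult[OF this continuous_of_real_test[OF \<phi>], of k]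
  show ?thesis by (simp add: fourier_inversion[OF \<psi>] mult.commute)
qed

text \<open>Both sides are iterated sums of one double series over k and m in opposite orders; the
  decay of the coefficients of both test functions makes it absolutely convergent.\<close>

lemma mult_fdist:
  assumes a: "mild a" and \<phi>: "\<phi> \<in> test_functions"
  shows "mult_dist \<phi> (fdist a) = fdist (conv \<phi> a)"
proof (rule ext)
  fix \<psi>
  show "mult_dist \<phi> (fdist a) \<psi> = fdist (conv \<phi> a) \<psi>"
  proof (cases "\<psi> \<in> test_functions")
    case \<psi>: True
    obtain C n where C: "0 \<le> C" "\<And>k. cmod (a k) \<le> C * wt k ^ n" using mild_bound[OF a] by blast
    have r: "rfc \<phi> (m - k) = cnj (rfc \<phi> (k - m))" for k m
      using rfc_minus[of \<phi> "k - m"] test_continuous[OF \<phi>] by simp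
    let ?f = "\<lambda>k m. cnj (rfc \<psi> m) * (rfc \<phi> (m - k) * a k)"
    have "(\<lambda>x. norm ((\<lambda>(k, m). ?f k m) x)) summable_on UNIV"
    proof (rule Infinite_Sum.abs_summable_on_comparison_test')
      show "(\<lambda>z. C * (\<lambda>(k, m). (wt m ^ n * cmod (rfc \<psi> m)) * (wt (m - k) ^ n * cmod (rfc \<phi> (m - k)))) z) summable_on UNIV"
        by (intro summable_on_cmult_right summable_shift_product rfc_rapid \<phi> \<psi>) auto
      fix z :: "(int^2) \<times> (int^2)"
      obtain k m where z: "z = (k, m)" by (cases z)
      from mult_left_mono[OF conv_term_bound[OF C(2,1), of \<phi> m k], of "cmod (rfc \<psi> m)"]
      show "norm ((\<lambda>(k, m). ?f k m) z) \<le> C * (\<lambda>(k, m). (wt m ^ n * cmod (rfc \<psi> m)) * (wt (m - k) ^ n * cmod (rfc \<phi> (m - k)))) z"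
        by (simp add: z norm_mult mult_ac)
    qed
    then have sm: "(\<lambda>(k, m). ?f k m) summable_on UNIV \<times> UNIV"
      unfolding UNIV_Times_UNIV by (rule abs_summable_summable)
    have "(\<Sum>\<^sub>\<infinity>k. a k * cnj (rfc (\<lambda>x. \<phi> x * \<psi> x) k)) = (\<Sum>\<^sub>\<infinity>k. \<Sum>\<^sub>\<infinity>m. ?f k m)"
    proof (rule infsum_cong)
      fix k
      have "((\<lambda>m. a k * cnj (rfc \<psi> m * rfc \<phi> (k - m))) has_sum a k * cnj (rfc (\<lambda>x. \<phi> x * \<psi> x) k)) UNIV"
        by (intro has_sum_cmult_right) (simp only: has_sum_cnj_iff rfc_mult[OF \<phi> \<psi>])
      moreover have "a k * cnj (rfc \<psi> m * rfc \<phi> (k - m)) = ?f k m" for m by (simp add: r[of m k])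
      ultimately show "a k * cnj (rfc (\<lambda>x. \<phi> x * \<psi> x) k) = (\<Sum>\<^sub>\<infinity>m. ?f k m)"
        by (simp only: infsumI)
    qed
    also have "\<dots> = (\<Sum>\<^sub>\<infinity>m. \<Sum>\<^sub>\<infinity>k. ?f k m)" by (rule infsum_swap_banach[OF sm])
    also have "\<dots> = (\<Sum>\<^sub>\<infinity>m. conv \<phi> a m * cnj (rfc \<psi> m))"
      by (rule infsum_cong) (simp add: conv_def infsum_cmult_right' mult.commute)
    finally show ?thesis using \<psi> \<phi> by (simp add: mult_dist_def fdist_def test_mult)
  qed (simp add: mult_dist_def fdist_def)
qed

lemma mild_lincomb:
  assumes "mild a" "mild b"
  shows "mild (\<lambda>k. of_real s * a k + of_real t * b k)"
proof -
  obtain C n where C: "0 \<le> C" "\<And>k. cmod (a k) \<le> C * wt k ^ n" using mild_bound[OF assms(1)] by blast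
  obtain D m where D: "0 \<le> D" "\<And>k. cmod (b k) \<le> D * wt k ^ m" using mild_bound[OF assms(2)] by blast
  show ?thesis
  proof (rule mildI)
    fix k
    have "cmod (of_real s * a k + of_real t * b k) \<le> \<bar>s\<bar> * cmod (a k) + \<bar>t\<bar> * cmod (b k)"
      by (rule order_trans[OF norm_triangle_ineq]) (simp add: norm_mult)
    also have "\<dots> \<le> \<bar>s\<bar> * (C * wt k ^ (n + m)) + \<bar>t\<bar> * (D * wt k ^ (n + m))"
    proof (intro add_mono mult_left_mono)
      show "cmod (a k) \<le> C * wt k ^ (n + m)"
        by (rule order_trans[OF C(2) mult_left_mono[OF power_increasing C(1)]]) auto
      show "cmod (b k) \<le> D * wt k ^ (n + m)"
        by (rule order_trans[OF D(2) mult_left_mono[OF power_increasing D(1)]]) auto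
    qed auto
    finally show "cmod (of_real s * a k + of_real t * b k) \<le> (\<bar>s\<bar> * C + \<bar>t\<bar> * D) * wt k ^ (n + m)"
      by (simp add: algebra_simps)
  qed (simp add: mild_minus[OF assms(1)] mild_minus[OF assms(2)])
qed

lemma fdist_lincomb:
  assumes "mild a" "mild b" "\<psi> \<in> test_functions"
  shows "fdist (\<lambda>k. of_real s * a k + of_real t * b k) \<psi> = s * fdist a \<psi> + t * fdist b \<psi>"
proof -
  have "(\<Sum>\<^sub>\<infinity>k. (of_real s * a k + of_real t * b k) * cnj (rfc \<psi> k))
      = (\<Sum>\<^sub>\<infinity>k. of_real s * (a k * cnj (rfc \<psi> k)) + of_real t * (b k * cnj (rfc \<psi> k)))"
    by (simp add: algebra_simps)
  also have "\<dots> = of_real s * (\<Sum>\<^sub>\<infinity>k. a k * cnj (rfc \<psi> k)) + of_real t * (\<Sum>\<^sub>\<infinity>k. b k * cnj (rfc \<psi> k))"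
    by (subst infsum_add) (auto intro!: summable_on_cmult_right fdist_summable assms simp: infsum_cmult_right')
  finally show ?thesis using assms(3) by (simp add: fdist_def algebra_simps)
qed

lemma diff_fdist:
  assumes "mild a" "mild b"
  shows "diff_dist (fdist a) (fdist b) = fdist (\<lambda>k. a k - b k)"
  by (rule ext) (use fdist_lincomb[OF assms, of _ 1 "- 1"] in \<open>simp add: diff_dist_def fdist_def restrict_def\<close>)

lemma add_uminus_fdist:
  assumes "mild a" "mild b"
  shows "add_dist (uminus_dist (fdist a)) (fdist b) = fdist (\<lambda>k. b k - a k)"
  by (rule ext) (use fdist_lincomb[OF assms, of _ "- 1" 1] in \<open>simp add: add_dist_def uminus_dist_def fdist_def restrict_def\<close>)

lemma mild_diff: "mild a \<Longrightarrow> mild b \<Longrightarrow> mild (\<lambda>k. a k - b k)"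
  using mild_lincomb[of a b 1 "- 1"] by simp

lemma Riesz_fdist:
  assumes "mild a"
  shows "Riesz j (fdist a) = fdist (\<lambda>k. \<i> * of_int (k $ j) * (of_real (Lambda_symbol (- 1) k) * a k))"
    and "mild (\<lambda>k. \<i> * of_int (k $ j) * (of_real (Lambda_symbol (- 1) k) * a k))"
  unfolding Riesz_def Lambda_fdist[OF assms]
  by (rule partial_fdist mild_partial, rule mild_Lambda[OF assms])+

lemma Lambda_symbol_minus_1: "Lambda_symbol (- 1) k = 1 / fnorm k"
  by (cases "k = 0") (auto simp: Lambda_symbol_def fnorm_def powr_minus divide_inverse)

text \<open>The coefficients of \<open>Riesz_perp_commutator\<close>. Differentiating \<psi> gives
  components of p - k, and between the two commutators the products of components of the same vector
  cancel, which leaves the cross product.\<close>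

definition comm_coeff :: "(real^2 \<Rightarrow> real) \<Rightarrow> (int^2 \<Rightarrow> complex) \<Rightarrow> int^2 \<Rightarrow> complex" where
  "comm_coeff \<psi> a p = (\<Sum>\<^sub>\<infinity>k. of_real (cross p k * (1 / fnorm p - 1 / fnorm k)) * (rfc \<psi> (p - k) * a k))"

lemma Riesz_perp_commutator_fdist:
  assumes a: "mild a" and \<psi>: "\<psi> \<in> test_functions"
  shows "Riesz_perp_commutator \<psi> (fdist a) = fdist (comm_coeff \<psi> a)" and "mild (comm_coeff \<psi> a)"
proof -
  let ?R = "\<lambda>j a k. \<i> * of_int (k $ j) * (of_real (Lambda_symbol (- 1) k) * a k) :: complex"
  let ?C = "\<lambda>j \<phi> p. ?R j (conv \<phi> a) p - conv \<phi> (?R j a) p"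
  have C: "Riesz_commutator j \<phi> (fdist a) = fdist (?C j \<phi>)" "mild (?C j \<phi>)" if \<phi>: "\<phi> \<in> test_functions" for j \<phi>
    unfolding Riesz_commutator_def mult_fdist[OF a \<phi>] Riesz_fdist(1)[OF a] Riesz_fdist(1)[OF mild_conv[OF a \<phi>]]
      mult_fdist[OF Riesz_fdist(2)[OF a] \<phi>]
    by (rule diff_fdist mild_diff, rule Riesz_fdist(2)[OF mild_conv[OF a \<phi>]], rule mild_conv[OF Riesz_fdist(2)[OF a] \<phi>])+
  note t1 = test_partial[OF \<psi>, of 1] and t2 = test_partial[OF \<psi>, of 2]
  have *: "?C 1 (partial 2 \<psi>) p - ?C 2 (partial 1 \<psi>) p = comm_coeff \<psi> a p" for p
  proof -
    have s: "(\<lambda>k. rfc \<phi> (p - k) * a k) summable_on UNIV" "(\<lambda>k. rfc \<phi> (p - k) * ?R j a k) summable_on UNIV"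
      if "\<phi> \<in> test_functions" for \<phi> j
      by (rule conv_summable[OF a that], rule conv_summable[OF Riesz_fdist(2)[OF a] that])
    have CC: "?C j \<phi> p = (\<Sum>\<^sub>\<infinity>k. ?R j (\<lambda>_. 1) p * (rfc \<phi> (p - k) * a k) - rfc \<phi> (p - k) * ?R j a k)"
      "(\<lambda>k. ?R j (\<lambda>_. 1) p * (rfc \<phi> (p - k) * a k) - rfc \<phi> (p - k) * ?R j a k) summable_on UNIV"
      if \<phi>: "\<phi> \<in> test_functions" for \<phi> j
    proof -
      have 1: "(\<lambda>k. ?R j (\<lambda>_. 1) p * (rfc \<phi> (p - k) * a k)) summable_on UNIV"
        by (rule summable_on_cmult_right[OF s(1)[OF \<phi>]])
      have 2: "(\<lambda>k. - (rfc \<phi> (p - k) * ?R j a k)) summable_on UNIV"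
        using s(2)[OF \<phi>, of j] by (simp only: summable_on_uminus)
      show "(\<lambda>k. ?R j (\<lambda>_. 1) p * (rfc \<phi> (p - k) * a k) - rfc \<phi> (p - k) * ?R j a k) summable_on UNIV"
        using summable_on_add[OF 1 2] by simp
      have "?C j \<phi> p = ?R j (\<lambda>_. 1) p * conv \<phi> a p + - conv \<phi> (?R j a) p" by (simp add: mult_ac)
      also have "\<dots> = (\<Sum>\<^sub>\<infinity>k. ?R j (\<lambda>_. 1) p * (rfc \<phi> (p - k) * a k) + - (rfc \<phi> (p - k) * ?R j a k))"
        unfolding conv_def infsum_cmult_right'[symmetric] infsum_uminus[symmetric]
        by (rule infsum_add[symmetric, OF 1 2])
      finally show "?C j \<phi> p = (\<Sum>\<^sub>\<infinity>k. ?R j (\<lambda>_. 1) p * (rfc \<phi> (p - k) * a k) - rfc \<phi> (p - k) * ?R j a k)"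
        by simp
    qed
    let ?t = "\<lambda>j \<phi> k. ?R j (\<lambda>_. 1) p * (rfc \<phi> (p - k) * a k) - rfc \<phi> (p - k) * ?R j a k"
    have "?C 1 (partial 2 \<psi>) p - ?C 2 (partial 1 \<psi>) p = (\<Sum>\<^sub>\<infinity>k. ?t 1 (partial 2 \<psi>) k + - ?t 2 (partial 1 \<psi>) k)"
      unfolding CC(1)[OF t1] CC(1)[OF t2]
      using infsum_add[OF CC(2)[OF t2, of 1] summable_on_uminus[THEN iffD2, OF CC(2)[OF t1, of 2]]]
      by (simp only: infsum_uminus diff_conv_add_uminus)
    also have "\<dots> = comm_coeff \<psi> a p"
      unfolding comm_coeff_def
    proof (rule infsum_cong)
      fix k
      have i: "\<i> * (\<i> * z) = - z" for z :: complex by simp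
      show "?t 1 (partial 2 \<psi>) k + - ?t 2 (partial 1 \<psi>) k
        = of_real (cross p k * (1 / fnorm p - 1 / fnorm k)) * (rfc \<psi> (p - k) * a k)"
        unfolding rfc_partial[OF \<psi>] Lambda_symbol_minus_1 cross_def
        by (simp add: algebra_simps i)
    qed
    finally show ?thesis .
  qed
  have "Riesz_perp_commutator \<psi> (fdist a) = fdist (\<lambda>p. ?C 1 (partial 2 \<psi>) p - ?C 2 (partial 1 \<psi>) p)"
    unfolding Riesz_perp_commutator_def C(1)[OF t1] C(1)[OF t2]
    by (rule add_uminus_fdist) (rule C(2)[OF t1] C(2)[OF t2])+
  then show "Riesz_perp_commutator \<psi> (fdist a) = fdist (comm_coeff \<psi> a)" unfolding * .
  have "mild (\<lambda>p. ?C 1 (partial 2 \<psi>) p - ?C 2 (partial 1 \<psi>) p)"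
    by (rule mild_diff) (rule C(2)[OF t1] C(2)[OF t2])+
  then show "mild (comm_coeff \<psi> a)" unfolding * .
qed

section \<open>Distributions given by absolutely convergent series\<close>

context
  fixes a :: "int^2 \<Rightarrow> complex"
  assumes a: "(\<lambda>k. cmod (a k)) summable_on UNIV" and am: "\<And>k. a (- k) = cnj (a k)"
begin

lemma mild_l1: "mild a"
proof (rule mildI)
  show "a (- k) = cnj (a k)" for k by (rule am)
  show "cmod (a k) \<le> infsum (\<lambda>k. cmod (a k)) UNIV * wt k ^ 0" for k
    using finite_sum_le_infsum[OF a, of "{k}"] by simp
qed

lemma ser_real: "of_real (Re (ser a x)) = ser a x"
proof -
  have "cnj (ser a x) = (\<Sum>\<^sub>\<infinity>k. cnj (a k * expi k x))" by (simp only: ser_def infsum_cnj)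
  also have "\<dots> = (\<Sum>\<^sub>\<infinity>k. a (0 - k) * expi (0 - k) x)"
    by (rule infsum_cong) (simp add: am)
  also have "\<dots> = ser a x" unfolding ser_def by (rule infsum_reflect)
  finally show ?thesis by (simp add: complex_eq_iff)
qed

lemma continuous_Re_ser: "continuous_on UNIV (\<lambda>x. Re (ser a x))"
  by (intro continuous_on_Re ser_continuous a)

lemma torus_integral_ser:
  assumes g: "continuous_on UNIV g"
  shows "torus_integral (\<lambda>x. Re (ser a x) * g x) = (2 * pi)^2 * Re (\<Sum>\<^sub>\<infinity>k. a k * cnj (rfc g k))"
proof -
  have gc: "continuous_on UNIV (\<lambda>x. complex_of_real (g x))" by (intro continuous_intros g)
  have c: "cint (\<lambda>x. expi k x * of_real (g x)) = (2 * of_real pi)^2 * cnj (rfc g k)" for k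
    unfolding rfc_minus[OF g, symmetric] by (simp add: fc_def mult.commute)
  have "of_real (torus_integral (\<lambda>x. Re (ser a x) * g x)) = cint (\<lambda>x. ser a x * of_real (g x))"
    unfolding cint_of_real[symmetric] by (simp add: ser_real)
  also have "\<dots> = (\<Sum>\<^sub>\<infinity>k. (2 * of_real pi)^2 * (a k * cnj (rfc g k)))"
    using infsumI[OF cint_ser[OF a gc]] unfolding c by (simp add: mult_ac)
  also have "\<dots> = of_real ((2 * pi)^2) * (\<Sum>\<^sub>\<infinity>k. a k * cnj (rfc g k))"
    by (subst infsum_cmult_right') simp
  finally have "Re (of_real (torus_integral (\<lambda>x. Re (ser a x) * g x))) = Re (of_real ((2 * pi)^2) * (\<Sum>\<^sub>\<infinity>k. a k * cnj (rfc g k)))"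
    by (rule arg_cong)
  then show ?thesis by (simp only: Re_complex_of_real times_complex.simps Im_complex_of_real mult_zero_left diff_zero)
qed

lemma dist_of_ser: "dist_of (\<lambda>x. Re (ser a x)) = fdist a"
  unfolding dist_of_def fdist_def
  by (rule restrict_ext) (rule torus_integral_ser[OF test_continuous])

lemma represents_ser: "represents_L2 (\<lambda>x. Re (ser a x)) (fdist a)"
  unfolding represents_L2_def
proof (intro conjI)
  show "(\<lambda>x. Re (ser a x)) \<in> borel_measurable (lebesgue_on torus)"
    by (intro borel_measurable_integrable integrable_torus continuous_Re_ser)
  show "integrable (lebesgue_on torus) (\<lambda>x. (Re (ser a x))^2)"
    by (intro integrable_torus continuous_on_power continuous_Re_ser)
qed (rule dist_of_ser[symmetric])

end

lemma parseval:
  assumes a: "(\<lambda>k. cmod (a k)) summable_on UNIV" "\<And>k. a (- k) = cnj (a k)"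
    and b: "(\<lambda>k. cmod (b k)) summable_on UNIV" "\<And>k. b (- k) = cnj (b k)"
  shows "torus_integral (\<lambda>x. Re (ser a x) * Re (ser b x)) = (2 * pi)^2 * Re (\<Sum>\<^sub>\<infinity>k. a k * cnj (b k))"
  unfolding torus_integral_ser[OF a continuous_Re_ser[OF b]] ser_real[OF b]
  by (simp only: fc_ser[OF b(1)])

section \<open>Weak solutions\<close>

lemma min_le_sqrt:
  fixes x y :: real
  assumes "0 \<le> x" "0 \<le> y"
  shows "min x y \<le> sqrt x * sqrt y"
proof -
  have "min x y * min x y \<le> x * y" by (intro mult_mono) (use assms in auto)
  then have "sqrt (min x y * min x y) \<le> sqrt (x * y)" by (rule real_sqrt_le_mono)
  then show ?thesis using assms by (simp add: real_sqrt_mult)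
qed

text \<open>The cross product vanishes at k = p, so p - k may replace either argument. The smaller
  of the two resulting bounds is below their geometric mean.\<close>

lemma abs_cross_le_min: "\<bar>cross p k\<bar> \<le> fnorm (p - k) * (sqrt (fnorm p) * sqrt (fnorm k))"
proof -
  have "cross p k = cross (p - k) k" "cross p k = - cross p (p - k)"
    by (simp_all add: cross_def algebra_simps)
  then have "\<bar>cross p k\<bar> \<le> fnorm (p - k) * fnorm k" "\<bar>cross p k\<bar> \<le> fnorm (p - k) * fnorm p"
    using abs_cross_le[of "p - k" k] abs_cross_le[of p "p - k"] by (simp_all add: mult.commute)
  then have "\<bar>cross p k\<bar> \<le> fnorm (p - k) * min (fnorm p) (fnorm k)"
    by (auto simp: min_def)
  also have "\<dots> \<le> fnorm (p - k) * (sqrt (fnorm p) * sqrt (fnorm k))"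
    by (intro mult_left_mono min_le_sqrt) auto
  finally show ?thesis .
qed

text \<open>The commutator estimate: two powers of p - k fall on the smooth \<psi>, and each of p
  and k carries only half a derivative, which is the regularity available.\<close>

lemma abs_cross_diff_le:
  "\<bar>cross p k * (fnorm k - fnorm p)\<bar> \<le> wt (p - k) ^ 2 * (sqrt (fnorm p) * sqrt (fnorm k))"
proof -
  have "\<bar>fnorm k - fnorm p\<bar> \<le> fnorm (p - k)"
    using fnorm_diff_le[of p k] by linarith
  then have "\<bar>cross p k * (fnorm k - fnorm p)\<bar> \<le> (fnorm (p - k) * (sqrt (fnorm p) * sqrt (fnorm k))) * fnorm (p - k)"
    unfolding abs_mult by (intro mult_mono abs_cross_le_min) auto
  also have "\<dots> = (fnorm (p - k))^2 * (sqrt (fnorm p) * sqrt (fnorm k))"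
    by (simp add: power2_eq_square)
  also have "\<dots> \<le> wt (p - k) ^ 2 * (sqrt (fnorm p) * sqrt (fnorm k))"
    by (intro mult_right_mono power_mono) (auto simp: wt_def)
  finally show ?thesis .
qed

text \<open>Links the symbol of the commutator to the numerator of \<open>sig\<close>. At a zero
  frequency both sides vanish with the cross product.\<close>

lemma cross_inverse_diff: "fnorm p * (cross p k * (1 / fnorm p - 1 / fnorm k)) * fnorm k = cross p k * (fnorm k - fnorm p)"
proof (cases "p = 0 \<or> k = 0")
  case False
  then have "fnorm p \<noteq> 0" "fnorm k \<noteq> 0" by auto
  then show ?thesis by (simp add: field_simps)
qed auto

lemma norm_expi_diff: "cmod (expi k x - expi k y) \<le> fnorm k * norm (x - y)"
proof -
  have "expi k x - expi k y = expi k y * (cis ((x - y) \<bullet> freq k) - 1)"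
    by (simp add: expi_def cis_mult algebra_simps inner_diff_left)
  then have "cmod (expi k x - expi k y) = cmod (cis ((x - y) \<bullet> freq k) - 1)" by (simp add: norm_mult)
  also have "\<dots> = 2 * \<bar>sin ((x - y) \<bullet> freq k / 2)\<bar>"
    using dist_exp_i_1[of "(x - y) \<bullet> freq k"] by (simp add: cis_conv_exp)
  also have "\<dots> \<le> \<bar>(x - y) \<bullet> freq k\<bar>" using abs_sin_x_le_abs_x[of "(x - y) \<bullet> freq k / 2"] by simp
  also have "\<dots> \<le> fnorm k * norm (x - y)"
    using Cauchy_Schwarz_ineq2[of "x - y" "freq k"] by (simp add: fnorm_def mult.commute)
  finally show ?thesis .
qed

text \<open>Interpolates between the Lipschitz bound t and the trivial bound 2, where t is
  \<open>fnorm k * norm (x - y)\<close>.\<close>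

lemma norm_expi_Hoelder:
  assumes "0 < \<alpha>" "\<alpha> \<le> 1"
  shows "cmod (expi k x - expi k y) \<le> 2 * (fnorm k powr \<alpha> * norm (x - y) powr \<alpha>)"
proof -
  let ?t = "fnorm k * norm (x - y)"
  have "cmod (expi k x - expi k y) \<le> 2 * ?t powr \<alpha>"
  proof (cases "?t \<le> 1")
    case True
    have "?t powr 1 \<le> ?t powr \<alpha>" using True assms by (intro powr_mono') auto
    then have "?t \<le> ?t powr \<alpha>" by simp
    then show ?thesis using norm_expi_diff[of k x y] powr_ge_zero[of ?t \<alpha>] by linarith
  next
    case False
    then have "1 \<le> ?t powr \<alpha>" using assms by (intro ge_one_powr_ge_zero) auto
    moreover have "cmod (expi k x - expi k y) \<le> 2" using norm_triangle_ineq4[of "expi k x" "expi k y"] by simp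
    ultimately show ?thesis by linarith
  qed
  then show ?thesis by (simp add: powr_mult)
qed

lemma ser_Hoelder:
  assumes a: "(\<lambda>k. cmod (a k)) summable_on UNIV" "\<And>k. a (- k) = cnj (a k)"
    and h: "(\<lambda>k. fnorm k powr \<alpha> * cmod (a k)) summable_on UNIV" and \<alpha>: "0 < \<alpha>" "\<alpha> \<le> 1"
  shows "fdist a \<in> Hoelder \<alpha>"
proof -
  let ?C = "2 * (\<Sum>\<^sub>\<infinity>k. fnorm k powr \<alpha> * cmod (a k))"
  have "\<bar>Re (ser a x) - Re (ser a y)\<bar> \<le> ?C * norm (x - y) powr \<alpha>" for x y
  proof -
    have "((\<lambda>k. a k * expi k x + - (a k * expi k y)) has_sum ser a x + - ser a y) UNIV"
      by (intro has_sum_add has_sum_uminusI ser_has_sum a)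
    moreover have "((\<lambda>k. fnorm k powr \<alpha> * cmod (a k) * (2 * norm (x - y) powr \<alpha>)) has_sum
       (\<Sum>\<^sub>\<infinity>k. fnorm k powr \<alpha> * cmod (a k)) * (2 * norm (x - y) powr \<alpha>)) UNIV"
      by (intro has_sum_cmult_left has_sum_infsum h)
    moreover have "cmod (a k * expi k x + - (a k * expi k y)) \<le> fnorm k powr \<alpha> * cmod (a k) * (2 * norm (x - y) powr \<alpha>)" for k
    proof -
      have "a k * expi k x + - (a k * expi k y) = a k * (expi k x - expi k y)" by (simp add: algebra_simps)
      then show ?thesis
        using mult_left_mono[OF norm_expi_Hoelder[OF \<alpha>, of k x y], of "cmod (a k)"] by (simp add: norm_mult mult_ac)
    qed
    ultimately have "cmod (ser a x + - ser a y) \<le> (\<Sum>\<^sub>\<infinity>k. fnorm k powr \<alpha> * cmod (a k)) * (2 * norm (x - y) powr \<alpha>)"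
      by (rule norm_infsum_le)
    moreover have "\<bar>Re (ser a x) - Re (ser a y)\<bar> \<le> cmod (ser a x + - ser a y)"
      using abs_Re_le_cmod[of "ser a x + - ser a y"] by simp
    ultimately show ?thesis by (simp add: mult_ac)
  qed
  moreover have "periodic (\<lambda>x. Re (ser a x))" by (simp add: periodic_def ser_periodic[OF a(1)])
  ultimately show ?thesis
    unfolding Hoelder_def using dist_of_ser[OF a, symmetric] by blast
qed

lemma summable_swap_infsum:
  fixes f :: "'a \<times> 'b \<Rightarrow> 'c::banach"
  assumes "f summable_on UNIV"
  shows "(\<lambda>x. \<Sum>\<^sub>\<infinity>y. f (x, y)) summable_on UNIV"
  using summable_on_Sigma_banach[of "\<lambda>x y. f (x, y)" UNIV "\<lambda>_. UNIV"] assms by (simp add: case_prod_unfold)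

text \<open>Here c holds the coefficients of \<open>Lambda (- 1)\<close> of the solution; this
  interface is all that the weak formulation needs from the iteration.\<close>

locale steady_coefficients =
  fixes \<nu> \<gamma> :: real and c :: "int^2 \<Rightarrow> real"
  assumes ga: "0 < \<gamma>" and c_even: "\<And>k. c (- k) = c k" and c_zero: "c 0 = 0"
    and c_sum: "(\<lambda>k. sqrt (fnorm k) * \<bar>c k\<bar>) summable_on UNIV"
    and c_eq: "\<And>p. Q c c p = - \<nu> * fnorm p powr (\<gamma> - 1) * c p"
begin

definition theta :: "int^2 \<Rightarrow> complex" where
  "theta k = of_real (fnorm k * c k)"

abbreviation (input) w :: "int^2 \<Rightarrow> real" where
  "w k \<equiv> sqrt (fnorm k) * \<bar>c k\<bar>"

lemma w_le: "w k \<le> infsum w UNIV"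
  using finite_sum_le_infsum[OF c_sum, of "{k}"] by simp

lemma cmod_theta: "cmod (theta k) = fnorm k * \<bar>c k\<bar>"
  by (simp add: theta_def norm_mult)

lemma mild_theta: "mild theta"
proof (rule mildI)
  show "theta (- k) = cnj (theta k)" for k by (simp add: theta_def c_even)
  fix k
  have "fnorm k * \<bar>c k\<bar> = sqrt (fnorm k) * w k" by (simp add: mult.assoc[symmetric])
  also have "\<dots> \<le> wt k * infsum w UNIV"
  proof (intro mult_mono w_le)
    show "sqrt (fnorm k) \<le> wt k"
      by (rule real_le_lsqrt) (auto simp: wt_def power2_sum)
  qed auto
  finally show "cmod (theta k) \<le> infsum w UNIV * wt k ^ 1" by (simp add: cmod_theta mult_ac)
qed

lemma theta_fc: "fourier_coeff (fdist theta) k = theta k"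
  by (rule fourier_fdist[OF mild_theta])

text \<open>The summand is the square of \<open>w k\<close>, and a summable nonnegative family is
  square summable.\<close>

lemma theta_Hdot: "fdist theta \<in> Hdot (- 1/2)"
proof -
  have "(\<lambda>k. norm (norm (freq k) powr (2 * (- 1/2)) * (cmod (fourier_coeff (fdist theta) k))^2)) summable_on UNIV"
  proof (rule Infinite_Sum.abs_summable_on_comparison_test')
    show "(\<lambda>k. infsum w UNIV * w k) summable_on UNIV" by (rule summable_on_cmult_right[OF c_sum])
    fix k
    have "fnorm k powr (- 1) * (fnorm k * \<bar>c k\<bar>)^2 = w k * w k"
      by (cases "k = 0") (auto simp: powr_minus divide_simps power2_eq_square)
    also have "\<dots> \<le> infsum w UNIV * w k" by (intro mult_right_mono w_le) simp
    finally show "norm (norm (freq k) powr (2 * (- 1/2)) * (cmod (fourier_coeff (fdist theta) k))^2) \<le> infsum w UNIV * w k"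
      unfolding theta_fc cmod_theta by (simp add: fnorm_def)
  qed
  then have "(\<lambda>k. norm (freq k) powr (2 * (- 1/2)) * (cmod (fourier_coeff (fdist theta) k))^2) summable_on UNIV"
    by (rule abs_summable_summable)
  then have "(\<lambda>k. norm (freq k) powr (2 * (- 1/2)) * (cmod (fourier_coeff (fdist theta) k))^2) summable_on - {0}"
    by (rule summable_on_subset_banach) simp
  then show ?thesis by (simp add: Hdot_def fdist_distribution[OF mild_theta])
qed

lemma theta_mean: "mean (fdist theta) = 0"
proof -
  have "Re (fourier_coeff (fdist theta) 0) = 0" unfolding theta_fc by (simp add: theta_def)
  then have "fdist theta (\<lambda>x. 1) = 0" by (simp add: fourier_coeff_def)
  then show ?thesis by (simp add: mean_def)
qed

lemma c_l1: "(\<lambda>k. cmod (of_real (c k))) summable_on UNIV"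
proof -
  have "(\<lambda>k. norm (cmod (of_real (c k)))) summable_on UNIV"
  proof (rule Infinite_Sum.abs_summable_on_comparison_test'[OF c_sum])
    show "norm (cmod (of_real (c k))) \<le> w k" for k
    proof (cases "k = 0")
      case False
      then have "1 * \<bar>c k\<bar> \<le> w k" using fnorm_ge_1[OF False] by (intro mult_right_mono) auto
      then show ?thesis by simp
    qed (simp add: c_zero)
  qed
  then show ?thesis by simp
qed

lemma Lambda_theta:
  "Lambda (- 1) (fdist theta) = fdist (\<lambda>k. of_real (c k))"
  "Lambda (- 1/2) (fdist theta) = fdist (\<lambda>k. of_real (sqrt (fnorm k) * c k))"
proof -
  have 1: "of_real (Lambda_symbol (- 1) k) * theta k = of_real (c k)" for k
    by (cases "k = 0") (auto simp: theta_def c_zero Lambda_symbol_minus_1)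
  have "Lambda_symbol (- 1/2) k * (fnorm k * c k) = sqrt (fnorm k) * c k" for k
  proof (cases "k = 0")
    case False
    then have "fnorm k powr (- 1/2) * fnorm k = fnorm k powr (- 1/2 + 1)"
      unfolding powr_add by simp
    also have "\<dots> = sqrt (fnorm k)" by (simp add: powr_half_sqrt)
    finally show ?thesis by (simp add: Lambda_symbol_def fnorm_def[symmetric] mult.assoc[symmetric])
  qed (simp add: c_zero)
  then have 2: "of_real (Lambda_symbol (- 1/2) k) * theta k = of_real (sqrt (fnorm k) * c k)" for k
    unfolding theta_def by (simp flip: of_real_mult)
  show "Lambda (- 1) (fdist theta) = fdist (\<lambda>k. of_real (c k))"
    "Lambda (- 1/2) (fdist theta) = fdist (\<lambda>k. of_real (sqrt (fnorm k) * c k))"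
    unfolding Lambda_fdist[OF mild_theta] 1 2 by rule+
qed

lemma half_l1:
  "(\<lambda>k. cmod (of_real (sqrt (fnorm k) * c k))) summable_on UNIV"
  using c_sum by (simp add: norm_mult)

context
  fixes \<psi> assumes \<psi>: "\<psi> \<in> test_functions"
begin

abbreviation (input) G :: "int^2 \<Rightarrow> int^2 \<Rightarrow> complex" where
  "G p k \<equiv> of_real (cross p k * (fnorm k - fnorm p) * c p * c k) * rfc \<psi> (p - k)"

lemma comm_term:
  "of_real (fnorm p) * (of_real (cross p k * (1 / fnorm p - 1 / fnorm k)) * (rfc \<psi> (p - k) * theta k))
    = of_real (cross p k * (fnorm k - fnorm p) * c k) * rfc \<psi> (p - k)"
  unfolding cross_inverse_diff[symmetric] theta_def by (simp add: mult_ac)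

text \<open>Half a derivative of the commutator still has absolutely summable coefficients, so it is
  represented by a continuous function and Parseval applies.\<close>

lemma comm_l1:
  "(\<lambda>p. cmod (of_real (Lambda_symbol (1/2) p) * comm_coeff \<psi> theta p)) summable_on UNIV"
proof -
  let ?v = "\<lambda>m. wt m ^ 2 * cmod (rfc \<psi> m)"
  have r: "cmod (rfc \<psi> (k - p)) = cmod (rfc \<psi> (p - k))" "wt (k - p) = wt (p - k)" for k p
    using rfc_minus[of \<psi> "p - k"] wt_minus[of "p - k"] test_continuous[OF \<psi>] by simp_all
  have S: "(\<lambda>(p, k). w k * ?v (k - p)) summable_on UNIV"
    by (intro summable_shift_product c_sum rfc_rapid \<psi>) auto
  then have "(\<lambda>p. \<Sum>\<^sub>\<infinity>k. w k * ?v (k - p)) summable_on UNIV"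
    using summable_swap_infsum[OF S] by simp
  then have "(\<lambda>p. norm (cmod (of_real (Lambda_symbol (1/2) p) * comm_coeff \<psi> theta p))) summable_on UNIV"
  proof (rule Infinite_Sum.abs_summable_on_comparison_test')
    fix p
    let ?t = "\<lambda>k. of_real (cross p k * (1 / fnorm p - 1 / fnorm k)) * (rfc \<psi> (p - k) * theta k)"
    have L: "Lambda_symbol (1/2) p = sqrt (fnorm p)"
      by (simp add: Lambda_symbol_def powr_half_sqrt fnorm_def)
    have b: "cmod (of_real (sqrt (fnorm p)) * ?t k) \<le> w k * ?v (k - p)" for k
    proof (cases "p = 0")
      case False
      then have p: "0 < sqrt (fnorm p)" by (simp add: order_less_le)
      \<comment> \<open>A second factor \<open>sqrt (fnorm p)\<close> completes the full power in
        \<open>comm_term\<close>; it is cancelled again against the one from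
        \<open>abs_cross_diff_le\<close>.\<close>
      have "sqrt (fnorm p) * cmod (of_real (sqrt (fnorm p)) * ?t k) = cmod (of_real (fnorm p) * ?t k)"
        by (simp add: norm_mult mult.assoc[symmetric])
      also have "\<dots> = \<bar>cross p k * (fnorm k - fnorm p)\<bar> * \<bar>c k\<bar> * cmod (rfc \<psi> (p - k))"
        unfolding comm_term by (simp only: norm_mult norm_of_real abs_mult)
      also have "\<dots> \<le> (wt (p - k) ^ 2 * (sqrt (fnorm p) * sqrt (fnorm k))) * \<bar>c k\<bar> * cmod (rfc \<psi> (p - k))"
        by (intro mult_right_mono abs_cross_diff_le) auto
      also have "\<dots> = sqrt (fnorm p) * (w k * ?v (k - p))" by (simp add: r mult_ac)
      finally show ?thesis using p by (rule mult_left_le_imp_le)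
    qed simp
    have row: "(\<lambda>k. w k * ?v (k - p)) summable_on UNIV"
      using summable_on_SigmaD1[of "\<lambda>p k. w k * ?v (k - p)" UNIV "\<lambda>_. UNIV" p] S by simp
    have "(\<lambda>k. norm (of_real (sqrt (fnorm p)) * ?t k)) summable_on UNIV"
      by (rule Infinite_Sum.abs_summable_on_comparison_test'[OF row b])
    then have ts: "(\<lambda>k. of_real (sqrt (fnorm p)) * ?t k) summable_on UNIV" by (rule abs_summable_summable)
    have "of_real (Lambda_symbol (1/2) p) * comm_coeff \<psi> theta p = (\<Sum>\<^sub>\<infinity>k. of_real (sqrt (fnorm p)) * ?t k)"
      unfolding comm_coeff_def L infsum_cmult_right' ..
    moreover have "cmod (\<Sum>\<^sub>\<infinity>k. of_real (sqrt (fnorm p)) * ?t k) \<le> (\<Sum>\<^sub>\<infinity>k. w k * ?v (k - p))"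
      by (rule norm_infsum_le[OF has_sum_infsum[OF ts] has_sum_infsum[OF row] b])
    ultimately show "norm (cmod (of_real (Lambda_symbol (1/2) p) * comm_coeff \<psi> theta p)) \<le> (\<Sum>\<^sub>\<infinity>k. w k * ?v (k - p))"
      by simp
  qed
  then show ?thesis by simp
qed

lemma G_summable: "(\<lambda>(p, m). G p (p - m)) summable_on UNIV \<times> UNIV"
  unfolding UNIV_Times_UNIV
proof (rule abs_summable_summable, rule Infinite_Sum.abs_summable_on_comparison_test')
  let ?v = "\<lambda>m. wt m ^ 2 * cmod (rfc \<psi> m)"
  show "(\<lambda>z. infsum w UNIV * (\<lambda>(p, m). w p * ?v m) z) summable_on UNIV"
    by (intro summable_on_cmult_right summable_product c_sum rfc_rapid \<psi>) auto
  fix z :: "(int^2) \<times> (int^2)"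
  obtain p m where z: "z = (p, m)" by (cases z)
  let ?k = "p - m"
  have "cmod (G p ?k) = \<bar>cross p ?k * (fnorm ?k - fnorm p)\<bar> * (\<bar>c p\<bar> * \<bar>c ?k\<bar> * cmod (rfc \<psi> m))"
    by (simp only: norm_mult norm_of_real abs_mult mult.assoc diff_diff_eq2 add_diff_cancel_left')
  also have "\<dots> \<le> (wt m ^ 2 * (sqrt (fnorm p) * sqrt (fnorm ?k))) * (\<bar>c p\<bar> * \<bar>c ?k\<bar> * cmod (rfc \<psi> m))"
    using abs_cross_diff_le[of p ?k] by (intro mult_right_mono) auto
  also have "\<dots> = w ?k * (w p * ?v m)" by (simp add: mult_ac)
  also have "\<dots> \<le> infsum w UNIV * (w p * ?v m)" by (intro mult_right_mono w_le) auto
  finally show "norm ((\<lambda>(p, m). G p (p - m)) z) \<le> infsum w UNIV * (\<lambda>(p, m). w p * ?v m) z"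
    by (simp add: z)
qed

text \<open>Grouping by the frequency m of \<psi> instead of p, the inner sum is
  \<open>2 * (fnorm m)^2 * Q c c m\<close> times the coefficient of \<psi>, and the equation for c
  converts it into the dissipation.\<close>

lemma sum_G:
  "(\<Sum>\<^sub>\<infinity>p. of_real (c p) * (of_real (fnorm p) * comm_coeff \<psi> theta p))
    = (\<Sum>\<^sub>\<infinity>m. of_real (- 2 * \<nu> * fnorm m powr (\<gamma> + 1) * c m) * rfc \<psi> m)"
proof -
  have "(\<Sum>\<^sub>\<infinity>p. of_real (c p) * (of_real (fnorm p) * comm_coeff \<psi> theta p)) = (\<Sum>\<^sub>\<infinity>p. \<Sum>\<^sub>\<infinity>m. G p (p - m))"
  proof (rule infsum_cong)
    fix p
    have "of_real (c p) * (of_real (fnorm p) * comm_coeff \<psi> theta p) = (\<Sum>\<^sub>\<infinity>k. G p k)"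
      unfolding comm_coeff_def infsum_cmult_right'[symmetric] comm_term by (simp add: mult_ac)
    also have "\<dots> = (\<Sum>\<^sub>\<infinity>m. G p (p - m))" by (rule infsum_reflect[symmetric])
    finally show "of_real (c p) * (of_real (fnorm p) * comm_coeff \<psi> theta p) = (\<Sum>\<^sub>\<infinity>m. G p (p - m))" .
  qed
  also have "\<dots> = (\<Sum>\<^sub>\<infinity>m. \<Sum>\<^sub>\<infinity>p. G p (p - m))"
    by (rule infsum_swap_banach[OF G_summable])
  also have "\<dots> = (\<Sum>\<^sub>\<infinity>m. of_real (- 2 * \<nu> * fnorm m powr (\<gamma> + 1) * c m) * rfc \<psi> m)"
  proof (rule infsum_cong)
    fix m
    \<comment> \<open>Passing from p - m to m - p uses that c is even; the sign of the cross product
      and that of the difference of lengths cancel.\<close>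
    have t: "G p (p - m) = (of_real ((fnorm m)^2) * rfc \<psi> m) * of_real (c p * (sig p (m - p) * c (m - p)))" for p
    proof (cases "m = 0")
      case False
      have "fnorm (p - m) = fnorm (m - p)" "c (p - m) = c (m - p)" "cross p (p - m) = - cross p (m - p)"
        using fnorm_minus[of "m - p"] c_even[of "m - p"] cross_minus_right[of p "m - p"] by simp_all
      then show ?thesis using False by (simp add: sig_def field_simps)
    qed simp
    have "(\<Sum>\<^sub>\<infinity>p. G p (p - m)) = (of_real ((fnorm m)^2) * rfc \<psi> m) * of_real (\<Sum>\<^sub>\<infinity>p. c p * (sig p (m - p) * c (m - p)))"
      unfolding t infsum_cmult_right' infsumI[OF has_sum_of_real[OF has_sum_infsum[OF sig_prod_summable[OF c_sum, of m]]]] ..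
    also have "(\<Sum>\<^sub>\<infinity>p. c p * (sig p (m - p) * c (m - p))) = 2 * Q c c m" by (simp add: Q_def pair_def)
    also have "(of_real ((fnorm m)^2) * rfc \<psi> m) * of_real (2 * Q c c m) = of_real (- 2 * \<nu> * fnorm m powr (\<gamma> + 1) * c m) * rfc \<psi> m"
    proof -
      have "(fnorm m)^2 * fnorm m powr (\<gamma> - 1) = fnorm m powr (\<gamma> + 1)"
      proof (cases "m = 0")
        case False
        then have "(fnorm m)^2 * fnorm m powr (\<gamma> - 1) = fnorm m powr 2 * fnorm m powr (\<gamma> - 1)"
          by (simp add: powr_numeral)
        also have "\<dots> = fnorm m powr (\<gamma> + 1)" unfolding powr_add[symmetric] by (simp add: add.commute)
        finally show ?thesis .
      qed simp
      note P = this
      have "(fnorm m)^2 * (2 * Q c c m) = - 2 * \<nu> * ((fnorm m)^2 * fnorm m powr (\<gamma> - 1)) * c m"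
        unfolding c_eq by (simp add: mult_ac)
      then have "(fnorm m)^2 * (2 * Q c c m) = - 2 * \<nu> * fnorm m powr (\<gamma> + 1) * c m"
        unfolding P .
      then have "complex_of_real ((fnorm m)^2) * of_real (2 * Q c c m) = of_real (- 2 * \<nu> * fnorm m powr (\<gamma> + 1) * c m)"
        unfolding of_real_mult[symmetric] by (rule arg_cong)
      then show ?thesis by (simp only: mult_ac)
    qed
    finally show "(\<Sum>\<^sub>\<infinity>p. G p (p - m)) = of_real (- 2 * \<nu> * fnorm m powr (\<gamma> + 1) * c m) * rfc \<psi> m" .
  qed
  finally show ?thesis .
qed

text \<open>By Parseval both integrals are sums over frequencies. The half powers from
  \<open>Lambda (-1/2)\<close> of the solution and from \<open>Lambda (1/2)\<close> combine to the
  full power in \<open>sum_G\<close>; on the right, 1/2 and \<gamma> + 1/2 combine to \<gamma> +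
  1.\<close>

lemma weak_equation:
  "\<exists>g h. represents_L2 g (Lambda (1/2) (Riesz_perp_commutator \<psi> (fdist theta))) \<and>
     represents_L2 h (Lambda (\<gamma> + 1/2) (dist_of \<psi>)) \<and>
     1/2 * torus_integral (\<lambda>x. Re (ser (\<lambda>k. of_real (sqrt (fnorm k) * c k)) x) * g x)
       = - \<nu> * torus_integral (\<lambda>x. Re (ser (\<lambda>k. of_real (sqrt (fnorm k) * c k)) x) * h x)"
proof -
  let ?a = "\<lambda>k. of_real (sqrt (fnorm k) * c k) :: complex"
  let ?b = "\<lambda>k. of_real (Lambda_symbol (1/2) k) * comm_coeff \<psi> theta k"
  let ?d = "\<lambda>k. of_real (Lambda_symbol (\<gamma> + 1/2) k) * rfc \<psi> k"
  have ah: "?a (- k) = cnj (?a k)" for k by (simp add: c_even)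
  have bm: "mild (comm_coeff \<psi> theta)" by (rule Riesz_perp_commutator_fdist(2)[OF mild_theta \<psi>])
  have bh: "?b (- k) = cnj (?b k)" for k by (rule mild_minus[OF mild_Lambda[OF bm]])
  have r1: "(\<lambda>k. cmod (rfc \<psi> k)) summable_on UNIV" using rfc_rapid[OF \<psi>, of 0] by simp
  have rh: "rfc \<psi> (- k) = cnj (rfc \<psi> k)" for k by (rule rfc_minus[OF test_continuous[OF \<psi>]])
  have rm: "mild (rfc \<psi>)" by (rule mild_l1[OF r1 rh])
  have dh: "?d (- k) = cnj (?d k)" for k by (rule mild_minus[OF mild_Lambda[OF rm]])
  have d1: "(\<lambda>k. cmod (?d k)) summable_on UNIV"
  proof -
    obtain n where n: "\<And>k. Lambda_symbol (\<gamma> + 1/2) k \<le> wt k ^ n" using Lambda_symbol_bound by blast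
    have "(\<lambda>k. norm (cmod (?d k))) summable_on UNIV"
      by (rule Infinite_Sum.abs_summable_on_comparison_test'[OF rfc_rapid[OF \<psi>, of n]])
         (simp add: norm_mult mult_right_mono n)
    then show ?thesis by simp
  qed
  have psi: "dist_of \<psi> = fdist (rfc \<psi>)"
    using dist_of_ser[OF r1 rh] by (simp add: fourier_inversion[OF \<psi>])
  have "represents_L2 (\<lambda>x. Re (ser ?b x)) (Lambda (1/2) (Riesz_perp_commutator \<psi> (fdist theta)))"
    unfolding Riesz_perp_commutator_fdist(1)[OF mild_theta \<psi>] Lambda_fdist[OF bm]
    by (rule represents_ser[OF comm_l1 bh])
  moreover have "represents_L2 (\<lambda>x. Re (ser ?d x)) (Lambda (\<gamma> + 1/2) (dist_of \<psi>))"
    unfolding psi Lambda_fdist[OF rm] by (rule represents_ser[OF d1 dh])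
  moreover have "1/2 * torus_integral (\<lambda>x. Re (ser ?a x) * Re (ser ?b x)) = - \<nu> * torus_integral (\<lambda>x. Re (ser ?a x) * Re (ser ?d x))"
  proof -
    have "?a k * cnj (?b k) = cnj (of_real (c k) * (of_real (fnorm k) * comm_coeff \<psi> theta k))" for k
    proof -
      have "Lambda_symbol (1/2) k = sqrt (fnorm k)" by (simp add: Lambda_symbol_def powr_half_sqrt fnorm_def)
      then have "c k * fnorm k = (sqrt (fnorm k) * c k) * Lambda_symbol (1/2) k" by (simp add: mult_ac)
      then have "complex_of_real (c k) * of_real (fnorm k) = ?a k * of_real (Lambda_symbol (1/2) k)"
        unfolding of_real_mult[symmetric] by (rule arg_cong)
      note E = this
      have "?a k * cnj (?b k) = (?a k * of_real (Lambda_symbol (1/2) k)) * cnj (comm_coeff \<psi> theta k)"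
        by (simp only: complex_cnj_mult complex_cnj_complex_of_real mult.assoc)
      then show ?thesis unfolding E[symmetric] by (simp only: complex_cnj_mult complex_cnj_complex_of_real mult.assoc)
    qed
    then have "(\<Sum>\<^sub>\<infinity>k. ?a k * cnj (?b k)) = cnj (\<Sum>\<^sub>\<infinity>k. of_real (c k) * (of_real (fnorm k) * comm_coeff \<psi> theta k))"
      by (simp only: infsum_cnj)
    also have "\<dots> = (\<Sum>\<^sub>\<infinity>k. cnj (of_real (- 2 * \<nu> * fnorm k powr (\<gamma> + 1) * c k) * rfc \<psi> k))"
      unfolding sum_G by (simp only: infsum_cnj)
    also have "\<dots> = (\<Sum>\<^sub>\<infinity>k. of_real (- 2 * \<nu>) * (?a k * cnj (?d k)))"
    proof (rule infsum_cong)
      fix k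
      have "fnorm k powr (\<gamma> + 1) = sqrt (fnorm k) * Lambda_symbol (\<gamma> + 1/2) k"
      proof -
        have "fnorm k powr (\<gamma> + 1) = fnorm k powr (1/2 + (\<gamma> + 1/2))" by (simp add: add.commute)
        also have "\<dots> = sqrt (fnorm k) * fnorm k powr (\<gamma> + 1/2)"
          unfolding powr_add[of _ "1/2"] by (simp add: powr_half_sqrt)
        also have "\<dots> = sqrt (fnorm k) * Lambda_symbol (\<gamma> + 1/2) k"
          using ga by (simp add: Lambda_symbol_def fnorm_def)
        finally show ?thesis .
      qed
      then show "cnj (of_real (- 2 * \<nu> * fnorm k powr (\<gamma> + 1) * c k) * rfc \<psi> k) = of_real (- 2 * \<nu>) * (?a k * cnj (?d k))"
        by (simp add: mult_ac)
    qed
    also have "\<dots> = of_real (- 2 * \<nu>) * (\<Sum>\<^sub>\<infinity>k. ?a k * cnj (?d k))" by (rule infsum_cmult_right')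
    finally show ?thesis
      unfolding parseval[OF half_l1 ah comm_l1 bh] parseval[OF half_l1 ah d1 dh] by simp
  qed
  ultimately show ?thesis by (intro exI conjI)
qed

end

lemma theta_solution: "stationary_weak_solution \<nu> \<gamma> (fdist theta)"
  unfolding stationary_weak_solution_def
proof (intro conjI theta_Hdot theta_mean ballI weak_equation
    exI[of _ "\<lambda>x. Re (ser (\<lambda>k. of_real (sqrt (fnorm k) * c k)) x)"])
  have ah: "of_real (sqrt (fnorm (- k)) * c (- k)) = cnj (of_real (sqrt (fnorm k) * c k))" for k
    by (simp add: c_even)
  show "represents_L2 (\<lambda>x. Re (ser (\<lambda>k. of_real (sqrt (fnorm k) * c k)) x)) (Lambda (- 1/2) (fdist theta))"
    unfolding Lambda_theta(2) by (rule represents_ser[OF half_l1 ah])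
qed

lemma theta_Hoelder:
  assumes "0 < \<alpha>" "\<alpha> \<le> 1" "(\<lambda>k. fnorm k powr \<alpha> * \<bar>c k\<bar>) summable_on UNIV"
  shows "Lambda (- 1) (fdist theta) \<in> Hoelder \<alpha>"
  unfolding Lambda_theta(1)
  by (rule ser_Hoelder[OF c_l1]) (use assms in \<open>simp_all add: c_even\<close>)

end

lemma fourier_zero_dist: "fourier_coeff zero_dist k = 0"
  by (simp add: fourier_coeff_def zero_dist_def cos_test sin_test complex_eq_iff)

theorem theorem1p2:
  fixes \<nu> \<gamma> \<alpha> :: real
  assumes "\<nu> \<ge> 0"
    and "0 < \<gamma>" and "\<gamma> < 3/2"
    and "1/2 \<le> \<alpha>" and "\<alpha> < 1/2 + min (1/6) (3/2 - \<gamma>)"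
  shows "infinite {\<theta>. stationary_weak_solution \<nu> \<gamma> \<theta> \<and> \<theta> \<noteq> zero_dist \<and>
           mean \<theta> = 0 \<and> Lambda (-1) \<theta> \<in> Hoelder \<alpha>}"
    (is "infinite ?S")
proof
  assume fin: "finite ?S"
  have sol: "\<exists>\<theta>\<in>?S. (\<exists>k. fourier_coeff \<theta> k \<noteq> 0) \<and> (\<forall>k. fnorm k \<le> R \<longrightarrow> fourier_coeff \<theta> k = 0)" for R
  proof -
    obtain c :: "int^2 \<Rightarrow> real" where c: "\<And>k. c (- k) = c k" "\<And>k. fnorm k \<le> R \<Longrightarrow> c k = 0" "c 0 = 0" "\<exists>k. c k \<noteq> 0"
      "(\<lambda>k. fnorm k powr \<alpha> * \<bar>c k\<bar>) summable_on UNIV" "(\<lambda>k. sqrt (fnorm k) * \<bar>c k\<bar>) summable_on UNIV"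
      "\<And>p. Q c c p = - \<nu> * fnorm p powr (\<gamma> - 1) * c p"
      using fourier_solution[OF assms(2-5), of R \<nu>] by blast
    interpret steady_coefficients \<nu> \<gamma> c using assms(2) c(1,3,6,7) by unfold_locales
    obtain k where k: "c k \<noteq> 0" using c(4) by blast
    then have "k \<noteq> 0" using c(3) by auto
    then have nz: "fourier_coeff (fdist theta) k \<noteq> 0"
      using k unfolding theta_fc theta_def by simp
    then have "fdist theta \<noteq> zero_dist" by (metis fourier_zero_dist)
    moreover have "fourier_coeff (fdist theta) k = 0" if "fnorm k \<le> R" for k
      using c(2)[OF that] unfolding theta_fc theta_def by simp
    moreover have "Lambda (- 1) (fdist theta) \<in> Hoelder \<alpha>"
      using assms by (intro theta_Hoelder c) auto
    ultimately show ?thesis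
      using nz theta_solution theta_mean by (intro bexI[of _ "fdist theta"]) auto
  qed
  \<comment> \<open>One frequency from the spectrum of each solution. The sum of their lengths
    bounds every one of them, so a solution whose spectrum lies beyond that radius cannot belong to
    the finite set.\<close>
  define low where "low \<theta> = (SOME k. fourier_coeff \<theta> k \<noteq> 0)" for \<theta>
  define R where "R = (\<Sum>\<theta>\<in>?S. fnorm (low \<theta>))"
  obtain \<theta> where \<theta>: "\<theta> \<in> ?S" "\<exists>k. fourier_coeff \<theta> k \<noteq> 0" "\<And>k. fnorm k \<le> R \<Longrightarrow> fourier_coeff \<theta> k = 0"
    using sol[of R] by blast
  have "fourier_coeff \<theta> (low \<theta>) \<noteq> 0" unfolding low_def using \<theta>(2) by (rule someI_ex)
  moreover have "fnorm (low \<theta>) \<le> R" unfolding R_def using fin \<theta>(1) by (intro member_le_sum) auto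
  ultimately show False using \<theta>(3) by blast
qed

end
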